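(* Let $2\le p<\infty$. For every measurable subset $\Omega\subset\mathbb{R}^2$ of finite measure, and every $f\in L^2(\mathbb{R})\setminus\{0\}$, $$\frac{\int_\Omega|\mathcal{V}f(x,\omega)|^p\,dx\,d\omega}{\|f\|_{L^2}^p}\le\frac2p\Big(1-e^{-p|\Omega|/2}\Big).$$ Moreover, equality occurs (for some $f$ and for some $\Omega$ such that $0<|\Omega|<\infty$) if and only if $\Omega$ is equivalent, up to a set of measure zero, to a ball centered at some $(x_0,\omega_0)\in\mathbb{R}^2$, and $$f(x)=c\,e^{2\pi ix\omega_0}\varphi(x-x_0)$$ for some $c\in\mathbb{C}\setminus\{0\}$.
   Context: The Gaussian window is $\varphi(x)=2^{1/4}e^{-\pi x^2}$, $x\in\mathbb{R}$ (so $\|\varphi\|_{L^2}=1$). The Short-time Fourier transform (STFT) of $f\in L^2(\mathbb{R})$ is $$\mathcal{V}f(x,\omega)=\int_{\mathbb{R}}e^{-2\pi iy\omega}f(y)\varphi(x-y)\,dy,\qquad x,\omega\in\mathbb{R}.$$ $|\Omega|$ is the Lebesgue measure of $\Omega$; functions are complex valued. *)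

theory Defs
  imports "HOL-Analysis.Analysis"
begin

definition gauss_window :: "real \<Rightarrow> real" where
  "gauss_window x = 2 powr (1/4) * exp (- pi * x\<^sup>2)"

text \<open>
  Elements of \<open>L\<^sup>2(\<real>)\<close> are represented by functions, so equality in \<open>L\<^sup>2(\<real>)\<close> has to be
  stated as equality almost everywhere.
\<close>

definition L2_functions :: "(real \<Rightarrow> complex) set" where
  "L2_functions = {f. f \<in> borel_measurable lebesgue \<and>
                      integrable lebesgue (\<lambda>x. (cmod (f x))\<^sup>2)}"

definition L2_norm :: "(real \<Rightarrow> complex) \<Rightarrow> real" where
  "L2_norm f = sqrt (LINT x|lebesgue. (cmod (f x))\<^sup>2)"

definition STFT :: "(real \<Rightarrow> complex) \<Rightarrow> real \<Rightarrow> real \<Rightarrow> complex" where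
  "STFT f x \<omega> =
     (LINT y|lebesgue. exp (- 2 * complex_of_real pi * \<i> * complex_of_real y * complex_of_real \<omega>)
                        * f y * complex_of_real (gauss_window (x - y)))"

end

theory Submission
  imports Defs "HOL-Probability.Probability" "HOL-Complex_Analysis.Complex_Analysis"
begin

text \<open>
  Normalise \<open>u = \<bar>Vf\<bar>\<^sup>2 / \<parallel>f\<parallel>\<^sup>2\<close> and put \<open>v = ln u\<close>, \<open>\<mu>(c) = \<bar>{v > c}\<bar>\<close>. Up to a Gaussian factor \<open>Vf\<close> is an
  entire function of \<open>x - i\<omega>\<close>, so \<open>\<Delta>v = -4\<pi>\<close> where \<open>u > 0\<close>. The heart of the matter is that
  \<open>\<mu>(c) + c\<close> is nonincreasing as long as \<open>\<mu>(c) > 0\<close>. Instead of the coarea formula and the isoperimetric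
  inequality, integrate against a weight \<open>\<psi>(v(z))\<close> the pointwise bound
  \<open>\<integral>\<^sub>D \<nabla>v(z) \<bullet> (y - z) / \<bar>y - z\<bar>\<^sup>2 dy \<le> \<bar>\<nabla>v(z)\<bar>\<^sup>2 / 4 + \<pi> \<bar>D\<bar>\<close> for \<open>D = {v > v(z)}\<close>. After Fubini, the left side
  is computed by \<open>\<integral> \<nabla>H(z) \<bullet> (y - z) / \<bar>y - z\<bar>\<^sup>2 dz = 2\<pi> H(y)\<close> and the gradient term by
  \<open>\<integral> \<psi>(v) \<bar>\<nabla>v\<bar>\<^sup>2 = 4\<pi> \<integral> \<Psi>(v)\<close> with \<open>\<Psi>' = \<psi>\<close>.

  Since \<open>\<integral> u \<le> 1\<close> (Bessel), \<open>\<mu>\<close> is therefore dominated by \<open>c \<mapsto> -c\<close>, the distribution of the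
  Gaussian, and the layer cake formula for \<open>u\<^bsup>p/2\<^esup>\<close> gives the inequality. Equality forces \<open>u = 1\<close> at
  some point, i.e. equality in the Cauchy--Schwarz inequality against a Gaussian wave packet.
\<close>

section \<open>The dipole kernel\<close>

text \<open>The classical route reads -\<mu>' \<ge> 1 off each level curve: the divergence theorem
  gives 4 pi \<mu> for the integral of |\<nabla>v|, the coarea formula gives -\<mu>' for that of 1 /
  |\<nabla>v|, and Cauchy-Schwarz with the isoperimetric inequality closes the argument. This needs
  regular level curves, although v may have critical points and u may have zeros. Testing the
  inequality against \<psi>(c) \<mu>(c) removes the curves: the claim becomes \<integral> \<Psi>(v)
  \<le> \<integral> \<psi>(v) \<mu>(v) over the plane. The constants fit: the double integral equals
  2 pi \<integral> \<Psi>(v), the gradient term takes 4 pi / 4 = pi of the 2 pi, and what is left is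
  pi times the claim. The pointwise bound is sharp: superlevel sets of the dipole kernel are discs
  with the singularity on their boundary, and for a Gaussian the set D is precisely such a disc.
  Weights that vanish at low levels keep all integrands away from the zeros of u and inside a
  bounded region.\<close>

lemma superlevel_dipole_eq_ball:
  fixes b :: "real \<times> real"
  assumes "s > 0"
  shows "{x. s < (b \<bullet> x) / (norm x)\<^sup>2} = ball ((1 / (2 * s)) *\<^sub>R b) (norm b / (2 * s))"
proof -
  have "(s < (b \<bullet> x) / (norm x)\<^sup>2) \<longleftrightarrow> dist ((1 / (2 * s)) *\<^sub>R b) x < norm b / (2 * s)" for x
  proof (cases "x = 0")
    \<comment> \<open>At the origin the quotient is \<open>0 / 0 = 0\<close>, and the origin lies on
      the boundary circle, so both sides are false.\<close>
    case True
    with assms show ?thesis by (auto simp: divide_simps)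
  next
    case False
    have sq: "(norm (c *\<^sub>R b - x))\<^sup>2 = c\<^sup>2 * (norm b)\<^sup>2 + (norm x)\<^sup>2 - 2 * c * (b \<bullet> x)" for c
      unfolding power2_norm_eq_inner
      by (simp add: inner_diff_left inner_diff_right inner_commute power2_eq_square algebra_simps)
    have "(dist ((1 / (2 * s)) *\<^sub>R b) x)\<^sup>2 = (norm b / (2 * s))\<^sup>2 + (norm x)\<^sup>2 - (b \<bullet> x) / s"
      unfolding dist_norm sq using assms by (simp add: power_divide)
    moreover have "dist ((1 / (2 * s)) *\<^sub>R b) x < norm b / (2 * s) \<longleftrightarrow>
       (dist ((1 / (2 * s)) *\<^sub>R b) x)\<^sup>2 < (norm b / (2 * s))\<^sup>2"
      using assms power_less_imp_less_base[of "dist ((1 / (2 * s)) *\<^sub>R b) x" 2 "norm b / (2 * s)"]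
      by (auto intro: power_strict_mono)
    moreover have "(s < (b \<bullet> x) / (norm x)\<^sup>2) \<longleftrightarrow> (norm x)\<^sup>2 < (b \<bullet> x) / s"
      using assms False by (simp add: field_simps)
    ultimately show ?thesis by linarith
  qed
  then show ?thesis by (auto simp: ball_def)
qed

text \<open>Layer cake in the level s: the superlevel disc has area pi |b|^2 / (4 s^2), and
  integrating over s \<ge> \<kappa> gives the value. Truncation by \<open>ennreal\<close> turns the
  difference into its positive part.\<close>

lemma nn_integral_dipole_excess:
  fixes b :: "real \<times> real"
  assumes "\<kappa> > 0"
  shows "(\<integral>\<^sup>+x. ennreal ((b \<bullet> x) / (norm x)\<^sup>2 - \<kappa>) \<partial>lborel) = ennreal (pi * (norm b)\<^sup>2 / (4 * \<kappa>))"
proof -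
  define K where "K = (\<lambda>x::real\<times>real. (b \<bullet> x) / (norm x)\<^sup>2)"
  have K[measurable]: "K \<in> borel_measurable borel" unfolding K_def by measurable
  have "(\<integral>\<^sup>+x. ennreal (K x - \<kappa>) \<partial>lborel) = (\<integral>\<^sup>+x. (\<integral>\<^sup>+s. indicator {\<kappa>..<K x} s \<partial>lborel) \<partial>lborel)"
  proof (intro nn_integral_cong)
    fix x
    have "emeasure lborel {\<kappa>..<K x} = ennreal (K x - \<kappa>)"
      by (cases "\<kappa> \<le> K x") (auto simp: ennreal_neg)
    then show "ennreal (K x - \<kappa>) = (\<integral>\<^sup>+s. indicator {\<kappa>..<K x} s \<partial>lborel)" by simp
  qed
  also have "\<dots> = (\<integral>\<^sup>+x. (\<integral>\<^sup>+s. indicator {\<kappa>..} s * indicator {x. s < K x} x \<partial>lborel) \<partial>lborel)"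
    by (intro nn_integral_cong) (auto split: split_indicator)
  also have "\<dots> = (\<integral>\<^sup>+s. (\<integral>\<^sup>+x. indicator {\<kappa>..} s * indicator {x. s < K x} x \<partial>lborel) \<partial>lborel)"
    by (rule lborel_pair.Fubini') (simp add: indicator_def)
  also have "\<dots> = (\<integral>\<^sup>+s. ennreal (pi * (norm b)\<^sup>2 / 4 * (1 / s\<^sup>2)) * indicator {\<kappa>..} s \<partial>lborel)"
  proof (intro nn_integral_cong)
    fix s :: real
    show "(\<integral>\<^sup>+x. indicator {\<kappa>..} s * indicator {x. s < K x} x \<partial>lborel)
       = ennreal (pi * (norm b)\<^sup>2 / 4 * (1 / s\<^sup>2)) * indicator {\<kappa>..} s"
    proof (cases "\<kappa> \<le> s")
      case True
      with assms have "s > 0" by simp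
      then have "emeasure lborel {x. s < K x} = ennreal (pi * (norm b)\<^sup>2 / 4 * (1 / s\<^sup>2))"
        unfolding K_def superlevel_dipole_eq_ball[OF \<open>s > 0\<close>]
        by (subst emeasure_ball) (simp_all add: power_divide unit_ball_vol_2 power2_eq_square field_simps)
      then show ?thesis using True by simp
    qed simp
  qed
  also have "\<dots> = ennreal (0 - (- (pi * (norm b)\<^sup>2 / 4 / \<kappa>)))"
  proof (rule nn_integral_FTC_atLeast)
    show "((\<lambda>s. - (pi * (norm b)\<^sup>2 / 4 / s)) \<longlongrightarrow> 0) at_top" by real_asymp
    show "((\<lambda>s. - (pi * (norm b)\<^sup>2 / 4 / s)) has_real_derivative pi * (norm b)\<^sup>2 / 4 * (1 / s\<^sup>2)) (at s)"
      if "\<kappa> \<le> s" for s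
      using that assms by (auto intro!: derivative_eq_intros simp: power2_eq_square)
  qed auto
  finally show ?thesis by (simp add: K_def field_simps)
qed

lemma nn_integral_lborel_shift:
  fixes g :: "'a::euclidean_space \<Rightarrow> ennreal"
  assumes [measurable]: "g \<in> borel_measurable borel"
  shows "(\<integral>\<^sup>+y. g (y - z) \<partial>lborel) = (\<integral>\<^sup>+y. g y \<partial>lborel)"
proof -
  have "(\<integral>\<^sup>+y. g y \<partial>lborel) = (\<integral>\<^sup>+y. g y \<partial>(distr lborel borel ((+) (-z))))"
    by (simp only: lborel_distr_plus)
  also have "\<dots> = (\<integral>\<^sup>+y. g (y - z) \<partial>lborel)" by (subst nn_integral_distr) simp_all
  finally show ?thesis ..
qed

text \<open>Absolute integrability for the later use of Fubini. Both signs of the kernel are cut off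
  at level pi, once with b and once with -b, so the gradient constant is twice that of the signed
  bound.\<close>

lemma nn_integral_abs_dipole_le:
  fixes b z :: "real \<times> real"
  assumes [measurable]: "k \<in> borel_measurable borel"
    and k: "\<And>y. 0 \<le> k y" "\<And>y. k y \<le> 1"
  shows "(\<integral>\<^sup>+y. ennreal (k y * \<bar>(b \<bullet> (y - z)) / (norm (y - z))\<^sup>2\<bar>) \<partial>lborel)
     \<le> ennreal ((norm b)\<^sup>2 / 2) + ennreal pi * (\<integral>\<^sup>+y. ennreal (k y) \<partial>lborel)"
proof -
  let ?K = "\<lambda>b y. (b \<bullet> (y - z)) / (norm (y - z))\<^sup>2"
  have ex: "(\<integral>\<^sup>+y. ennreal (?K b y - pi) \<partial>lborel) = ennreal ((norm b)\<^sup>2 / 4)" for b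
    by (subst nn_integral_lborel_shift[of "\<lambda>y. ennreal ((b \<bullet> y) / (norm y)\<^sup>2 - pi)"])
       (simp_all add: nn_integral_dipole_excess)
  have le: "ennreal (k y * \<bar>?K b y\<bar>) \<le> (ennreal (?K b y - pi) + ennreal (?K (-b) y - pi)) + ennreal pi * ennreal (k y)" for y
  proof -
    have "k y * \<bar>?K b y\<bar> \<le> max 0 (?K b y - pi) + max 0 (?K (-b) y - pi) + pi * k y"
    proof -
      have "k y * (\<bar>?K b y\<bar> - pi) \<le> k y * max 0 (\<bar>?K b y\<bar> - pi)"
        using k by (intro mult_left_mono) auto
      also have "\<dots> \<le> max 0 (\<bar>?K b y\<bar> - pi)"
        using k by (intro mult_left_le_one_le) auto
      also have "\<dots> \<le> max 0 (?K b y - pi) + max 0 (?K (-b) y - pi)" by auto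
      finally show ?thesis by (simp add: algebra_simps)
    qed
    then have "ennreal (k y * \<bar>?K b y\<bar>) \<le> ennreal (max 0 (?K b y - pi) + max 0 (?K (-b) y - pi) + pi * k y)"
      by (rule ennreal_leI)
    also have "\<dots> = ennreal (?K b y - pi) + ennreal (?K (-b) y - pi) + ennreal pi * ennreal (k y)"
      using k by (simp add: ennreal_plus ennreal_mult ennreal_max_0)
    finally show ?thesis .
  qed
  have "(\<integral>\<^sup>+y. ennreal (k y * \<bar>?K b y\<bar>) \<partial>lborel) \<le>
     (\<integral>\<^sup>+y. (ennreal (?K b y - pi) + ennreal (?K (-b) y - pi)) + ennreal pi * ennreal (k y) \<partial>lborel)"
    by (intro nn_integral_mono le)
  also have "\<dots> = (ennreal ((norm b)\<^sup>2 / 4) + ennreal ((norm b)\<^sup>2 / 4)) + ennreal pi * (\<integral>\<^sup>+y. ennreal (k y) \<partial>lborel)"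
    by (simp add: nn_integral_add nn_integral_cmult ex[of b] ex[of "-b", simplified])
  finally show ?thesis by (simp add: ennreal_plus[symmetric] del: ennreal_plus)
qed

text \<open>The bathtub bound at level \<open>\<pi>\<close>: it combines the Ahlfors--Beurling estimate
  \<open>\<bar>\<integral>\<^sub>D dA(y) / (z - y)\<bar>\<^sup>2 \<le> \<pi> \<bar>D\<bar>\<close> with the inequality between arithmetic and geometric means.\<close>

lemma integral_dipole_le:
  fixes b z :: "real \<times> real"
  assumes k_int: "integrable lborel k"
    and k: "\<And>y. 0 \<le> k y" "\<And>y. k y \<le> 1"
  shows "integrable lborel (\<lambda>y. k y * ((b \<bullet> (y - z)) / (norm (y - z))\<^sup>2))"
    and "(\<integral>y. k y * ((b \<bullet> (y - z)) / (norm (y - z))\<^sup>2) \<partial>lborel) \<le> (norm b)\<^sup>2 / 4 + pi * (\<integral>y. k y \<partial>lborel)"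
proof -
  let ?K = "\<lambda>y. (b \<bullet> (y - z)) / (norm (y - z))\<^sup>2"
  have km[measurable]: "k \<in> borel_measurable borel" using k_int by simp
  have ek: "(\<integral>\<^sup>+y. ennreal (k y) \<partial>lborel) = ennreal (\<integral>y. k y \<partial>lborel)"
    using k_int k by (simp add: nn_integral_eq_integral)
  show int: "integrable lborel (\<lambda>y. k y * ?K y)"
  proof (rule integrableI_bounded)
    have "(\<integral>\<^sup>+y. ennreal (norm (k y * ?K y)) \<partial>lborel) = (\<integral>\<^sup>+y. ennreal (k y * \<bar>?K y\<bar>) \<partial>lborel)"
      using k by (simp add: abs_mult)
    also have "\<dots> \<le> ennreal ((norm b)\<^sup>2 / 2) + ennreal pi * (\<integral>\<^sup>+y. ennreal (k y) \<partial>lborel)"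
      by (rule nn_integral_abs_dipole_le) (use k in auto)
    also have "\<dots> < \<infinity>" by (simp add: ek ennreal_mult_less_top)
    finally show "(\<integral>\<^sup>+y. ennreal (norm (k y * ?K y)) \<partial>lborel) < \<infinity>" .
  qed measurable
  have ex: "(\<integral>\<^sup>+y. ennreal (max 0 (?K y - pi)) \<partial>lborel) = ennreal ((norm b)\<^sup>2 / 4)"
    by (subst nn_integral_lborel_shift[of "\<lambda>y. ennreal (max 0 ((b \<bullet> y) / (norm y)\<^sup>2 - pi))"])
       (simp_all add: nn_integral_dipole_excess ennreal_max_0)
  have hb: "has_bochner_integral lborel (\<lambda>y. max 0 (?K y - pi)) ((norm b)\<^sup>2 / 4)"
    by (rule has_bochner_integral_nn_integral) (use ex in auto)
  have "(\<integral>y. k y * ?K y \<partial>lborel) \<le> (\<integral>y. max 0 (?K y - pi) + pi * k y \<partial>lborel)"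
  proof (rule integral_mono[OF int])
    show "integrable lborel (\<lambda>y. max 0 (?K y - pi) + pi * k y)"
      using hb k_int by (intro Bochner_Integration.integrable_add) (auto simp: has_bochner_integral_iff)
    fix y
    have "k y * (?K y - pi) \<le> k y * max 0 (?K y - pi)"
      using k by (intro mult_left_mono) auto
    also have "\<dots> \<le> max 0 (?K y - pi)"
      using k by (intro mult_left_le_one_le) auto
    finally show "k y * ?K y \<le> max 0 (?K y - pi) + pi * k y" by (simp add: algebra_simps)
  qed
  also have "\<dots> = (norm b)\<^sup>2 / 4 + pi * (\<integral>y. k y \<partial>lborel)"
    using hb k_int by (simp add: has_bochner_integral_iff)
  finally show "(\<integral>y. k y * ?K y \<partial>lborel) \<le> (norm b)\<^sup>2 / 4 + pi * (\<integral>y. k y \<partial>lborel)" .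
qed

section \<open>Integral of a gradient against the dipole kernel\<close>

lemma integral_lborel_shift:
  fixes g :: "'a::euclidean_space \<Rightarrow> 'b::{banach, second_countable_topology}"
  assumes [measurable]: "g \<in> borel_measurable borel"
  shows "(\<integral>y. g (y + z) \<partial>lborel) = (\<integral>y. g y \<partial>lborel)"
proof -
  have "(\<integral>y. g y \<partial>lborel) = (\<integral>y. g y \<partial>(distr lborel borel ((+) z)))"
    by (simp only: lborel_distr_plus)
  also have "\<dots> = (\<integral>y. g (y + z) \<partial>lborel)" by (subst integral_distr) (simp_all add: add.commute)
  finally show ?thesis ..
qed

lemma has_bochner_integral_1_plus_square:
  "has_bochner_integral lborel (\<lambda>m::real. 1 / (1 + m\<^sup>2)) pi"
proof -
  have half: "(\<integral>\<^sup>+m. ennreal (1 / (1 + m\<^sup>2)) * indicator {0..} m \<partial>lborel) = ennreal (pi / 2)"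
    by (subst nn_integral_FTC_atLeast[where F=arctan and T="pi/2"])
       (auto intro!: derivative_eq_intros tendsto_arctan_at_top simp: inverse_eq_divide)
  have "(\<integral>\<^sup>+m. ennreal (1 / (1 + m\<^sup>2)) * indicator {..0} m \<partial>lborel) = (\<integral>\<^sup>+m. ennreal (1 / (1 + m\<^sup>2)) * indicator {0..} m \<partial>lborel)"
    by (subst nn_integral_real_affine[where c="-1" and t=0]) (auto intro!: nn_integral_cong split: split_indicator)
  moreover have "(\<integral>\<^sup>+m. ennreal (1 / (1 + m\<^sup>2)) \<partial>lborel) = (\<integral>\<^sup>+m. ennreal (1 / (1 + m\<^sup>2)) * indicator {..0} m + ennreal (1 / (1 + m\<^sup>2)) * indicator {0..} m \<partial>lborel)"
    by (intro nn_integral_cong_AE, rule AE_mp[OF AE_lborel_singleton[of 0]]) (auto split: split_indicator)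
  ultimately have "(\<integral>\<^sup>+m. ennreal (1 / (1 + m\<^sup>2)) \<partial>lborel) = ennreal pi"
    using half by (simp add: nn_integral_add ennreal_plus[symmetric] del: ennreal_plus)
  then show ?thesis by (intro has_bochner_integral_nn_integral) auto
qed

lemma integral_lborel_pair:
  fixes f :: "real \<times> real \<Rightarrow> 'b::{banach, second_countable_topology}"
  assumes "integrable lborel f"
  shows "(\<integral>z. f z \<partial>lborel) = (\<integral>x. (\<integral>y. f (x, y) \<partial>lborel) \<partial>lborel)"
    and "(\<integral>z. f z \<partial>lborel) = (\<integral>y. (\<integral>x. f (x, y) \<partial>lborel) \<partial>lborel)"
proof -
  have i: "integrable (lborel \<Otimes>\<^sub>M lborel) f" using assms by (simp add: lborel_prod)
  show "(\<integral>z. f z \<partial>lborel) = (\<integral>x. (\<integral>y. f (x, y) \<partial>lborel) \<partial>lborel)"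
    using lborel_pair.integral_fst[of "\<lambda>x y. f (x,y)"] i by (simp add: lborel_prod)
  show "(\<integral>z. f z \<partial>lborel) = (\<integral>y. (\<integral>x. f (x, y) \<partial>lborel) \<partial>lborel)"
    using lborel_pair.integral_snd[of "\<lambda>x y. f (x,y)"] i by (simp add: lborel_prod)
qed

lemma has_derivative_along_line:
  fixes H :: "'a::real_inner \<Rightarrow> real"
  assumes "(H has_derivative (\<lambda>h. G (a + t *\<^sub>R d) \<bullet> h)) (at (a + t *\<^sub>R d))"
  shows "((\<lambda>t. H (a + t *\<^sub>R d)) has_real_derivative G (a + t *\<^sub>R d) \<bullet> d) (at t)"
proof -
  have "((\<lambda>t. a + t *\<^sub>R d) has_derivative (\<lambda>h. h *\<^sub>R d)) (at t)"
    by (auto intro!: derivative_eq_intros)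
  from has_derivative_compose[OF this assms]
  show ?thesis by (simp add: has_field_derivative_def mult_commute_abs)
qed

text \<open>The fundamental theorem on the two half-lines: with the sign the contributions at 0 add
  up to -2 h(0), without it they cancel. The signed form suits whole lines through the origin, where
  one slope covers two opposite rays.\<close>

lemma integral_ray_derivative:
  fixes h h' :: "real \<Rightarrow> real"
  assumes d: "\<And>t. (h has_real_derivative h' t) (at t)"
    and c: "continuous_on UNIV h'"
    and z: "\<And>t. \<bar>t\<bar> \<ge> R \<Longrightarrow> h t = 0 \<and> h' t = 0"
  shows "integrable lborel (\<lambda>t. sgn t * h' t)" "(\<integral>t. sgn t * h' t \<partial>lborel) = - 2 * h 0"
    and "integrable lborel h'" "(\<integral>t. h' t \<partial>lborel) = 0"
proof -
  define R' where "R' = max R 1"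
  have R': "R' > 0" "\<And>t. \<bar>t\<bar> \<ge> R' \<Longrightarrow> h t = 0 \<and> h' t = 0" using z by (auto simp: R'_def)
  have cont: "isCont h' t" for t using c by (simp add: continuous_on_eq_continuous_at)
  have a: "has_bochner_integral lborel (\<lambda>t. h' t * indicator {0..R'} t) (h R' - h 0)"
    and b: "has_bochner_integral lborel (\<lambda>t. h' t * indicator {-R'..0} t) (h 0 - h (-R'))"
    using R'(1) by (auto intro!: has_bochner_integral_FTC_Icc_real d cont simp del: diff_0_right diff_0)
  have ae: "AE t in lborel. t \<noteq> (0::real)" by (rule AE_lborel_singleton)
  have [measurable]: "h' \<in> borel_measurable borel" using c by (rule borel_measurable_continuous_onI)
  have "has_bochner_integral lborel (\<lambda>t. sgn t * h' t) ((h R' - h 0) - (h 0 - h (-R')))"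
    by (rule has_bochner_integral_cong_AE[THEN iffD1, OF _ _ _ has_bochner_integral_diff[OF a b]])
       (use R'(2) ae in \<open>auto simp: sgn_if indicator_def not_le elim!: eventually_mono intro: sym\<close>)
  then show "integrable lborel (\<lambda>t. sgn t * h' t)" "(\<integral>t. sgn t * h' t \<partial>lborel) = - 2 * h 0"
    using R' by (auto simp: has_bochner_integral_iff)
  have "has_bochner_integral lborel h' ((h R' - h 0) + (h 0 - h (-R')))"
    by (rule has_bochner_integral_cong_AE[THEN iffD1, OF _ _ _ has_bochner_integral_add[OF a b]])
       (use R'(2) ae in \<open>auto simp: sgn_if indicator_def not_le elim!: eventually_mono intro: sym\<close>)
  then show "integrable lborel h'" "(\<integral>t. h' t \<partial>lborel) = 0"
    using R' by (auto simp: has_bochner_integral_iff)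
qed

lemma integrable_continuous_bounded_support:
  fixes g :: "'a::euclidean_space \<Rightarrow> real"
  assumes "continuous_on UNIV g" "\<And>z. norm z \<ge> R \<Longrightarrow> g z = 0"
  shows "integrable lborel g"
proof -
  have "integrable lborel (\<lambda>x. indicat_real (cball 0 R) x *\<^sub>R g x)"
    using assms(1) by (intro borel_integrable_compact) (auto intro: continuous_on_subset)
  moreover have "(\<lambda>x. indicat_real (cball 0 R) x *\<^sub>R g x) = g"
    using assms(2) by (fastforce simp: indicator_def)
  ultimately show ?thesis by simp
qed

text \<open>Divergence theorem without boundary term: Fubini with the differentiated variable
  innermost, where each line integral of the derivative vanishes by bounded support.\<close>

lemma integral_partial_derivative_eq_0:
  fixes A A1 A2 :: "real \<times> real \<Rightarrow> real"
  assumes z: "\<And>z. norm z \<ge> R \<Longrightarrow> A z = 0"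
  shows "(\<And>x y. ((\<lambda>x. A (x, y)) has_real_derivative A1 (x, y)) (at x)) \<Longrightarrow> continuous_on UNIV A1 \<Longrightarrow> 
      (\<And>z. norm z \<ge> R \<Longrightarrow> A1 z = 0) \<Longrightarrow> (\<integral>z. A1 z \<partial>lborel) = 0"
    and "(\<And>x y. ((\<lambda>y. A (x, y)) has_real_derivative A2 (x, y)) (at y)) \<Longrightarrow> continuous_on UNIV A2 \<Longrightarrow> 
      (\<And>z. norm z \<ge> R \<Longrightarrow> A2 z = 0) \<Longrightarrow> (\<integral>z. A2 z \<partial>lborel) = 0"
proof -
  have big: "R \<le> norm (x, y)" if "\<bar>x\<bar> \<ge> R \<or> \<bar>y\<bar> \<ge> R" for x y :: real
    using that norm_fst_le[of x y] norm_snd_le[of y x] by auto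
  {
    assume d: "\<And>x y. ((\<lambda>x. A (x, y)) has_real_derivative A1 (x, y)) (at x)" and c: "continuous_on UNIV A1"
      and z1: "\<And>z. norm z \<ge> R \<Longrightarrow> A1 z = 0"
    have "(\<integral>z. A1 z \<partial>lborel) = (\<integral>y. (\<integral>x. A1 (x, y) \<partial>lborel) \<partial>lborel)"
      using integrable_continuous_bounded_support[OF c z1] by (rule integral_lborel_pair)
    also have "\<dots> = 0"
    proof -
      have "(\<integral>x. A1 (x, y) \<partial>lborel) = 0" for y
        by (rule integral_ray_derivative(4)[OF d, of _ R])
           (use z z1 big in \<open>auto intro!: continuous_intros continuous_on_compose2[OF c]\<close>)
      then show ?thesis by simp
    qed
    finally show "(\<integral>z. A1 z \<partial>lborel) = 0" .
  }
  {
    assume d: "\<And>x y. ((\<lambda>y. A (x, y)) has_real_derivative A2 (x, y)) (at y)" and c: "continuous_on UNIV A2"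
      and z1: "\<And>z. norm z \<ge> R \<Longrightarrow> A2 z = 0"
    have "(\<integral>z. A2 z \<partial>lborel) = (\<integral>x. (\<integral>y. A2 (x, y) \<partial>lborel) \<partial>lborel)"
      using integrable_continuous_bounded_support[OF c z1] by (rule integral_lborel_pair)
    also have "\<dots> = 0"
    proof -
      have "(\<integral>y. A2 (x, y) \<partial>lborel) = 0" for x
        by (rule integral_ray_derivative(4)[OF d, of _ R])
           (use z z1 big in \<open>auto intro!: continuous_intros continuous_on_compose2[OF c]\<close>)
      then show ?thesis by simp
    qed
    finally show "(\<integral>z. A2 z \<partial>lborel) = 0" .
  }
qed

text \<open>In the coordinates \<open>z = (r, r m)\<close> the integrand becomes a radial derivative divided by \<open>1 + m\<^sup>2\<close>.\<close>

lemma integral_gradient_dipole_0: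
  fixes H :: "real \<times> real \<Rightarrow> real"
  assumes d: "\<And>z. (H has_derivative (\<lambda>h. G z \<bullet> h)) (at z)"
    and c: "continuous_on UNIV G"
    and z: "\<And>z. norm z \<ge> R \<Longrightarrow> H z = 0 \<and> G z = 0"
  shows "(\<integral>z. (G z \<bullet> z) / (norm z)\<^sup>2 \<partial>lborel) = - 2 * pi * H 0"
proof -
  define g where "g = (\<lambda>z. (G z \<bullet> z) / (norm z)\<^sup>2)"
  have [measurable]: "G \<in> borel_measurable borel" using c by (rule borel_measurable_continuous_onI)
  have gm[measurable]: "g \<in> borel_measurable borel" unfolding g_def by measurable
  have "compact (G ` cball 0 R)" using c by (intro compact_continuous_image) (auto intro: continuous_on_subset)
  then obtain C where "\<And>z. z \<in> cball 0 R \<Longrightarrow> norm (G z) \<le> C"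
    using compact_imp_bounded[of "G ` cball 0 R"] unfolding bounded_iff by blast
  then have C: "norm (G z) \<le> max C 0 * indicator (cball 0 R) z" for z
    proof (cases "norm z \<le> R")
    case True
    then have "norm (G z) \<le> C" using \<open>\<And>z. z \<in> cball 0 R \<Longrightarrow> norm (G z) \<le> C\<close> by simp
    with True show ?thesis by simp
  qed (use z[of z] in simp)
  \<comment> \<open>Domination of the 1 / |z| singularity: |z| \<le> |x| + |y| bounds the integrand
    by dipole kernels in the two coordinate directions, already known to be integrable on bounded
    sets.\<close>
  define K :: "real \<times> real \<Rightarrow> real \<times> real \<Rightarrow> real"
    where "K = (\<lambda>b z. indicator (cball 0 R) z * ((b \<bullet> (z - 0)) / (norm (z - 0))\<^sup>2))"
  have Kint: "integrable lborel (K b)" for b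
  proof -
    have i: "integrable lborel (\<lambda>z. indicator (cball 0 R) z :: real)"
      by (rule integrable_real_indicator) (simp, rule emeasure_bounded_finite[OF bounded_cball])
    show ?thesis unfolding K_def
      by (rule integral_dipole_le(1)[where k="\<lambda>z. indicator (cball 0 R) z", OF i]) (simp_all add: indicator_def)
  qed
  have gint: "integrable lborel g"
  proof (rule Bochner_Integration.integrable_bound)
    show "integrable lborel (\<lambda>z. max C 0 * (\<bar>K (1,0) z\<bar> + \<bar>K (0,1) z\<bar>))"
      using Kint by simp
    show "AE z in lborel. norm (g z) \<le> norm (max C 0 * (\<bar>K (1,0) z\<bar> + \<bar>K (0,1) z\<bar>))"
    proof (intro AE_I2)
      fix z
      have "\<bar>G z \<bullet> z\<bar> \<le> norm (G z) * norm z" by (rule Cauchy_Schwarz_ineq2)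
      also have "\<dots> \<le> (max C 0 * indicator (cball 0 R) z) * (\<bar>fst z\<bar> + \<bar>snd z\<bar>)"
      proof (rule mult_mono[OF C])
        show "norm z \<le> \<bar>fst z\<bar> + \<bar>snd z\<bar>"
          using norm_Pair_le[of "fst z" "snd z"] by simp
      qed auto
      finally have "\<bar>g z\<bar> \<le> (max C 0 * indicator (cball 0 R) z) * (\<bar>fst z\<bar> + \<bar>snd z\<bar>) / (norm z)\<^sup>2"
        unfolding g_def by (simp add: divide_right_mono)
      then show "norm (g z) \<le> norm (max C 0 * (\<bar>K (1,0) z\<bar> + \<bar>K (0,1) z\<bar>))"
        by (simp add: K_def inner_prod_def abs_mult add_divide_distrib algebra_simps)
    qed
  qed simp
  \<comment> \<open>Substituting y = r m brings in the Jacobian |r|, which cancels the singularity: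
    |r| (G . z) / |z|^2 = sgn r (G . (1, m)) / (1 + m^2).\<close>
  define k where "k = (\<lambda>(r, m). sgn r * (G (r *\<^sub>R (1, m)) \<bullet> (1, m)) / (1 + m\<^sup>2))"
  have kg: "k (r, m) = \<bar>r\<bar> * g (r, 0 + r * m)" for r m
  proof (cases "r = 0")
    case False
    have n: "(norm (r, r * m))\<^sup>2 = r\<^sup>2 * (1 + m\<^sup>2)"
      unfolding power2_norm_eq_inner by (simp add: inner_prod_def power2_eq_square algebra_simps)
    have "k (r, m) = sgn r * (G (r, r * m) \<bullet> (1, m)) / (1 + m\<^sup>2)" by (simp add: k_def)
    also have "\<dots> = \<bar>r\<bar> * (r * (G (r, r * m) \<bullet> (1, m))) / (r\<^sup>2 * (1 + m\<^sup>2))"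
    proof -
      have "\<bar>r\<bar> * (r * X) = r\<^sup>2 * (sgn r * X)" for X by (simp add: sgn_if power2_eq_square)
      then have "\<bar>r\<bar> * (r * (G (r, r * m) \<bullet> (1, m))) = r\<^sup>2 * (sgn r * (G (r, r * m) \<bullet> (1, m)))" .
      then show ?thesis using False by (simp only: mult_divide_mult_cancel_left power_not_zero not_False_eq_True)
    qed
    also have "r * (G (r, r * m) \<bullet> (1, m)) = G (r, r * m) \<bullet> (r, r * m)"
      by (simp add: inner_prod_def algebra_simps)
    finally show ?thesis by (simp add: g_def n)
  qed (simp add: k_def)
  have km[measurable]: "k \<in> borel_measurable borel"
    unfolding k_def borel_prod[symmetric] by measurable
  have ae: "AE r in lborel. r \<noteq> (0::real)" by (rule AE_lborel_singleton)
  \<comment> \<open>Tonelli on absolute values transfers integrability from \<open>g\<close> to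
    \<open>k\<close>; the line r = 0, where the substitution degenerates, is a null set.\<close>
  have kint: "integrable lborel k"
  proof (rule integrableI_bounded)
    have "(\<integral>\<^sup>+z. ennreal (norm (k z)) \<partial>lborel) = (\<integral>\<^sup>+r. \<integral>\<^sup>+m. ennreal (norm (k (r, m))) \<partial>lborel \<partial>lborel)"
      by (subst lborel.nn_integral_fst) (simp_all add: lborel_prod)
    also have "\<dots> = (\<integral>\<^sup>+r. \<integral>\<^sup>+y. ennreal (norm (g (r, y))) \<partial>lborel \<partial>lborel)"
    proof (rule nn_integral_cong_AE, rule AE_mp[OF ae], intro AE_I2 impI)
      fix r :: real assume "r \<noteq> 0"
      then show "(\<integral>\<^sup>+m. ennreal (norm (k (r, m))) \<partial>lborel) = (\<integral>\<^sup>+y. ennreal (norm (g (r, y))) \<partial>lborel)"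
        by (subst nn_integral_real_affine[where c=r and t=0 and f="\<lambda>y. ennreal (norm (g (r, y)))"])
           (simp_all add: kg abs_mult ennreal_mult nn_integral_cmult)
    qed
    also have "\<dots> = (\<integral>\<^sup>+z. ennreal (norm (g z)) \<partial>lborel)"
      by (subst lborel.nn_integral_fst) (simp_all add: lborel_prod)
    also have "\<dots> < \<infinity>" using gint by (simp add: integrable_iff_bounded)
    finally show "(\<integral>\<^sup>+z. ennreal (norm (k z)) \<partial>lborel) < \<infinity>" .
  qed simp
  have "(\<integral>z. g z \<partial>lborel) = (\<integral>r. (\<integral>y. g (r, y) \<partial>lborel) \<partial>lborel)"
    using gint by (rule integral_lborel_pair)
  also have "\<dots> = (\<integral>r. (\<integral>m. k (r, m) \<partial>lborel) \<partial>lborel)"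
  proof (rule integral_cong_AE)
    show "AE r in lborel. (\<integral>y. g (r, y) \<partial>lborel) = (\<integral>m. k (r, m) \<partial>lborel)"
    proof (rule AE_mp[OF ae], intro AE_I2 impI)
      fix r :: real assume "r \<noteq> 0"
      then show "(\<integral>y. g (r, y) \<partial>lborel) = (\<integral>m. k (r, m) \<partial>lborel)"
        by (subst lborel_integral_real_affine[where c=r and t=0 and f="\<lambda>y. g (r, y)"])
           (simp_all add: kg)
    qed
    show "(\<lambda>r. \<integral>y. g (r, y) \<partial>lborel) \<in> borel_measurable lborel" "(\<lambda>r. \<integral>m. k (r, m) \<partial>lborel) \<in> borel_measurable lborel"
      by (auto intro!: lborel.borel_measurable_lebesgue_integral simp: borel_prod)
  qed
  also have "\<dots> = (\<integral>z. k z \<partial>lborel)"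
    using kint by (rule integral_lborel_pair[symmetric])
  also have "\<dots> = (\<integral>m. (\<integral>r. k (r, m) \<partial>lborel) \<partial>lborel)"
    using kint by (rule integral_lborel_pair)
  also have "\<dots> = (\<integral>m. (- 2 * H 0) * (1 / (1 + m\<^sup>2)) \<partial>lborel)"
  proof (rule Bochner_Integration.integral_cong[OF refl])
    \<comment> \<open>Along the line of slope m the integrand is the signed derivative of
      \<open>H\<close> divided by 1 + m^2, so it contributes -2 H(0) / (1 + m^2).\<close>
    fix m :: real
    have "(\<integral>r. sgn r * (G (0 + r *\<^sub>R (1, m)) \<bullet> (1, m)) \<partial>lborel) = -2 * H (0 + 0 *\<^sub>R (1, m))"
    proof (rule integral_ray_derivative(2))
      show "((\<lambda>t. H (0 + t *\<^sub>R (1, m))) has_real_derivative G (0 + t *\<^sub>R (1, m)) \<bullet> (1, m)) (at t)" for t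
        by (rule has_derivative_along_line[where G=G]) (rule d)
      show "continuous_on UNIV (\<lambda>t. G (0 + t *\<^sub>R (1, m)) \<bullet> (1, m))"
        by (intro continuous_intros continuous_on_compose2[OF c]) auto
      fix t :: real assume t: "R \<le> \<bar>t\<bar>"
      have "\<bar>t\<bar> \<le> norm (t, t * m)" using norm_fst_le[of t "t * m"] by simp
      with t z[of "(t, t*m)"] show "H (0 + t *\<^sub>R (1, m)) = 0 \<and> G (0 + t *\<^sub>R (1, m)) \<bullet> (1, m) = 0" by simp
    qed
    then show "(\<integral>r. k (r, m) \<partial>lborel) = (- 2 * H 0) * (1 / (1 + m\<^sup>2))" 
      by (simp add: k_def zero_prod_def)
  qed
  also have "\<dots> = - 2 * pi * H 0"
    using has_bochner_integral_1_plus_square by (simp only: integral_mult_right_zero has_bochner_integral_iff) simp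
  finally show ?thesis unfolding g_def .
qed

lemma integral_gradient_dipole:
  fixes H :: "real \<times> real \<Rightarrow> real"
  assumes d: "\<And>z. (H has_derivative (\<lambda>h. G z \<bullet> h)) (at z)"
    and c: "continuous_on UNIV G"
    and z: "\<And>z. norm z \<ge> R \<Longrightarrow> H z = 0 \<and> G z = 0"
  shows "(\<integral>z. (G z \<bullet> (y - z)) / (norm (y - z))\<^sup>2 \<partial>lborel) = 2 * pi * H y"
proof -
  have [measurable]: "G \<in> borel_measurable borel" using c by (rule borel_measurable_continuous_onI)
  have "(\<integral>z. (G z \<bullet> (y - z)) / (norm (y - z))\<^sup>2 \<partial>lborel)
     = (\<integral>z. (G (z + y) \<bullet> (y - (z + y))) / (norm (y - (z + y)))\<^sup>2 \<partial>lborel)"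
    by (rule integral_lborel_shift[symmetric]) measurable
  also have "\<dots> = - (\<integral>z. (G (z + y) \<bullet> z) / (norm z)\<^sup>2 \<partial>lborel)" by simp
  also have "(\<integral>z. (G (z + y) \<bullet> z) / (norm z)\<^sup>2 \<partial>lborel) = - 2 * pi * H (0 + y)"
  proof (rule integral_gradient_dipole_0)
    show "((\<lambda>z. H (z + y)) has_derivative (\<lambda>h. G (z + y) \<bullet> h)) (at z)" for z
      by (rule has_derivative_compose[where f="\<lambda>z. z + y" and f'="\<lambda>h. h"])
         (auto intro!: derivative_eq_intros d)
    show "continuous_on UNIV (\<lambda>z. G (z + y))"
      by (intro continuous_intros continuous_on_compose2[OF c]) auto
    fix x :: "real \<times> real" assume "R + norm y \<le> norm x"
    moreover have "norm x \<le> norm (x + y) + norm y" by (metis add_diff_cancel norm_triangle_ineq4)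
    ultimately show "H (x + y) = 0 \<and> G (x + y) = 0" using z by auto
  qed
  finally show ?thesis by simp
qed

section \<open>Superlevel sets of a function with constant logarithmic Laplacian\<close>

text \<open>The interval \<open>{c..b}\<close> is empty for b < c, so the formula yields 0 there; as
  \<rho> vanishes up to c, it is an antiderivative on the whole line. The proof moves the base point
  to some m below both c and b, which makes b an interior point.\<close>

lemma antiderivative_vanishing_left:
  fixes \<rho> :: "real \<Rightarrow> real"
  assumes c: "continuous_on UNIV \<rho>" and z: "\<And>a. a \<le> c \<Longrightarrow> \<rho> a = 0"
  shows "((\<lambda>b. integral {c..b} \<rho>) has_real_derivative \<rho> b) (at b)"
    and "b \<le> c \<Longrightarrow> integral {c..b} \<rho> = 0"
proof -
  have i: "\<rho> integrable_on {x..y}" for x y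
    using c by (intro integrable_continuous_real) (auto intro: continuous_on_subset)
  show 0: "integral {c..b} \<rho> = 0" if "b \<le> c" for b
    using that by (cases "b = c") auto
  define m where "m = min c b - 1"
  have eq: "integral {m..x} \<rho> = integral {c..x} \<rho>" if "x > m" for x
  proof (cases "x \<le> c")
    case True
    have "integral {m..x} \<rho> = integral {m..x} (\<lambda>_. 0)" using True z by (intro integral_cong) auto
    then show ?thesis using True 0 by simp
  next
    case False
    have "integral {m..c} \<rho> = integral {m..c} (\<lambda>_. 0)" using z by (intro integral_cong) auto
    moreover have "integral {m..c} \<rho> + integral {c..x} \<rho> = integral {m..x} \<rho>"
      using False by (intro Henstock_Kurzweil_Integration.integral_combine i) (auto simp: m_def)
    ultimately show ?thesis by simp
  qed
  have "((\<lambda>x. integral {m..x} \<rho>) has_real_derivative \<rho> b) (at b within {m..b + 1})"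
    using c by (intro integral_has_real_derivative) (auto simp: m_def intro: continuous_on_subset)
  then have "((\<lambda>x. integral {m..x} \<rho>) has_real_derivative \<rho> b) (at b)"
    by (subst (asm) at_within_interior) (auto simp: m_def)
  then show "((\<lambda>b. integral {c..b} \<rho>) has_real_derivative \<rho> b) (at b)"
    by (rule has_field_derivative_transform_within_open[where S="{m<..}"]) (use eq in \<open>simp_all add: m_def\<close>)
qed

text \<open>The pair (p, q) stands for the gradient of ln u, and p1, q2 for the diagonal of its
  Hessian. Apart from measurability they are constrained only where u > 0, since zeros are allowed;
  global measurability of p and q gives meaning to the double integrals below.\<close>

locale log_laplacian =
  fixes u p q p1 q2 :: "real \<times> real \<Rightarrow> real"
  assumes u_cont: "continuous_on UNIV u"
    and u_nonneg: "u z \<ge> 0"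
    and u_bounded: "t > 0 \<Longrightarrow> bounded {z. t \<le> u z}"
    and u_deriv: "u z > 0 \<Longrightarrow> (u has_derivative (\<lambda>h. u z * ((p z, q z) \<bullet> h))) (at z)"
    and meas [measurable]: "p \<in> borel_measurable borel" "q \<in> borel_measurable borel"
    and p_cont: "continuous_on {z. u z > 0} p" and q_cont: "continuous_on {z. u z > 0} q"
    and p_deriv: "u (x, y) > 0 \<Longrightarrow> ((\<lambda>x. p (x, y)) has_real_derivative p1 (x, y)) (at x)"
    and q_deriv: "u (x, y) > 0 \<Longrightarrow> ((\<lambda>y. q (x, y)) has_real_derivative q2 (x, y)) (at y)"
    and p1_cont: "continuous_on {z. u z > 0} p1" and q2_cont: "continuous_on {z. u z > 0} q2"
    and laplacian: "u z > 0 \<Longrightarrow> p1 z + q2 z = - 4 * pi"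
begin

definition A :: "real \<Rightarrow> real" where "A c = measure lborel {z. u z > exp c}"

text \<open>The case distinction guards against the junk value \<open>ln 0 = 0\<close>.\<close>

definition lift :: "(real \<Rightarrow> real) \<Rightarrow> (real \<times> real \<Rightarrow> 'b::real_normed_vector) \<Rightarrow> real \<times> real \<Rightarrow> 'b"
  where "lift F w z = (if u z > 0 then F (ln (u z)) *\<^sub>R w z else 0)"

lemma u_meas [measurable]: "u \<in> borel_measurable borel"
  using u_cont by (rule borel_measurable_continuous_onI)

lemma open_u_gt: "open {z. t < u z}" and open_u_lt: "open {z. u z < t}"
  using u_cont by (auto intro!: open_Collect_less continuous_intros)

lemma obtain_radius: obtains R where "\<And>z. norm z \<ge> R \<Longrightarrow> u z < exp c"
proof -
  obtain B where B: "\<And>z. exp c \<le> u z \<Longrightarrow> norm z \<le> B"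
    using u_bounded[of "exp c"] by (auto simp: bounded_iff)
  have "u z < exp c" if "norm z \<ge> B + 1" for z
    using B[of z] that by (cases "exp c \<le> u z") auto
  then show thesis by (rule that)
qed

lemma finite_superlevel: "emeasure lborel {z. u z > exp c} < \<infinity>"
proof -
  have "bounded {z. u z > exp c}" by (rule bounded_subset[OF u_bounded[of "exp c"]]) auto
  then show ?thesis by (rule emeasure_bounded_finite)
qed

lemma integrable_superlevel: "integrable lborel (indicator {z. u z > exp c} :: _ \<Rightarrow> real)"
  using finite_superlevel[of c] by (intro integrable_real_indicator) auto

lemma A_nonneg: "A c \<ge> 0" by (simp add: A_def)

lemma A_antimono: "c \<le> c' \<Longrightarrow> A c' \<le> A c"
  unfolding A_def using finite_superlevel[of c]
  by (intro measure_mono_fmeasurable) (auto simp: fmeasurable_def intro: le_less_trans)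

lemma lift_zero: "(\<And>a. a \<le> c \<Longrightarrow> F a = 0) \<Longrightarrow> u z < exp c \<Longrightarrow> lift F w z = 0"
  using ln_less_cancel_iff[of "u z" "exp c"] by (auto simp: lift_def)

text \<open>The open sets u > 0 and u < exp c cover the plane. On the first the composition is
  continuous, on the second it is identically 0 because F kills all levels up to c, so zeros of u
  cause no discontinuity.\<close>

lemma continuous_lift:
  assumes F: "continuous_on UNIV F" and z: "\<And>a. a \<le> c \<Longrightarrow> F a = 0"
    and w: "continuous_on {z. u z > 0} w"
  shows "continuous_on UNIV (lift F w)"
proof -
  have "continuous_on {z. u z > 0} (\<lambda>z. F (ln (u z)) *\<^sub>R w z)"
    by (intro continuous_intros w continuous_on_compose2[OF F] continuous_on_subset[OF u_cont]) auto
  then have 1: "continuous_on {z. u z > 0} (lift F w)"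
    by (subst continuous_on_cong[OF refl, of _ _ "\<lambda>z. F (ln (u z)) *\<^sub>R w z"]) (auto simp: lift_def)
  have 2: "continuous_on {z. u z < exp c} (lift F w)"
    by (subst continuous_on_cong[OF refl, of _ _ "\<lambda>z. 0"]) (auto intro: lift_zero[OF z])
  have "continuous_on ({z. u z > 0} \<union> {z. u z < exp c}) (lift F w)"
    by (intro continuous_on_open_Un 1 2 open_u_gt open_u_lt)
  moreover have "{z. u z > 0} \<union> {z. u z < exp c} = UNIV"
    using exp_gt_zero[of c] by (auto simp: not_less intro: le_less_trans)
  ultimately show ?thesis by simp
qed

lemma integrable_lift:
  fixes w :: "real \<times> real \<Rightarrow> real"
  assumes "continuous_on UNIV F" "\<And>a. a \<le> c \<Longrightarrow> F a = 0" "continuous_on {z. u z > 0} w"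
  shows "integrable lborel (lift F w)"
proof -
  obtain R where "\<And>z. norm z \<ge> R \<Longrightarrow> u z < exp c" using obtain_radius by blast
  with assms show ?thesis
    by (intro integrable_continuous_bounded_support[of _ R] continuous_lift) (auto intro: lift_zero)
qed

text \<open>Chain rule through ln where u > 0; near a zero of u the lift is locally 0, by the same
  open cover.\<close>

lemma lift_deriv:
  assumes R: "\<And>a. (R has_real_derivative \<rho> a) (at a)" and z: "\<And>a. a \<le> c \<Longrightarrow> R a = 0" "\<And>a. a \<le> c \<Longrightarrow> \<rho> a = 0"
  shows "(lift R (\<lambda>_. 1) has_derivative (\<lambda>h. lift \<rho> (\<lambda>z. (p z, q z)) z \<bullet> h)) (at z)"
proof (cases "u z > 0")
  case True
  have "((\<lambda>z. R (ln (u z))) has_derivative (\<lambda>h. (\<rho> (ln (u z)) *\<^sub>R (p z, q z)) \<bullet> h)) (at z)"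
  proof -
    have "((\<lambda>t. R (ln t)) has_real_derivative \<rho> (ln (u z)) * (1 / u z)) (at (u z))"
      by (rule DERIV_chain2[OF R]) (use True in \<open>auto intro!: derivative_eq_intros\<close>)
    from has_derivative_compose[OF u_deriv[OF True] this[unfolded has_field_derivative_def]]
    show ?thesis using True by (simp add: inner_prod_def algebra_simps)
  qed
  then show ?thesis
    by (rule has_derivative_transform_within_open[OF _ open_u_gt[of 0], THEN has_derivative_eq_rhs])
       (use True in \<open>auto simp: lift_def\<close>)
next
  case False
  then have "u z < exp c" using exp_gt_zero[of c] by linarith
  then have "(lift R (\<lambda>_. 1) has_derivative (\<lambda>h. 0)) (at z)"
    by (intro has_derivative_transform_within_open[OF has_derivative_const[of 0] open_u_lt[of "exp c"]])
       (auto simp: lift_zero[OF z(1)])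
  then show ?thesis using False by (simp add: lift_def)
qed

lemma u_partial:
  assumes "u (x, y) > 0"
  shows "((\<lambda>x. u (x, y)) has_real_derivative u (x, y) * p (x, y)) (at x)"
    and "((\<lambda>y. u (x, y)) has_real_derivative u (x, y) * q (x, y)) (at y)"
proof -
  have "((\<lambda>x. (x, y)) has_derivative (\<lambda>h. (h, 0))) (at x)" "((\<lambda>y. (x, y)) has_derivative (\<lambda>h. (0, h))) (at y)"
    by (auto intro!: derivative_eq_intros)
  from this[THEN has_derivative_compose, OF u_deriv[OF assms]]
  show "((\<lambda>x. u (x, y)) has_real_derivative u (x, y) * p (x, y)) (at x)"
    and "((\<lambda>y. u (x, y)) has_real_derivative u (x, y) * q (x, y)) (at y)"
    by (auto simp: has_field_derivative_def inner_prod_def elim!: has_derivative_eq_rhs)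
qed

text \<open>Integrate div (\<Psi>(v) \<nabla>v) = \<psi>(v) |\<nabla>v|^2 + \<Psi>(v) \<Delta>v over
  the plane: the left side integrates to 0 by bounded support, and \<Delta>v = -4 pi.\<close>

lemma integral_lift_gradient_square:
  assumes R: "\<And>a. (\<Psi> has_real_derivative \<psi> a) (at a)" and z: "\<And>a. a \<le> c \<Longrightarrow> \<Psi> a = 0" "\<And>a. a \<le> c \<Longrightarrow> \<psi> a = 0"
    and c: "continuous_on UNIV \<psi>"
  shows "(\<integral>z. lift \<psi> (\<lambda>z. (p z)\<^sup>2 + (q z)\<^sup>2) z \<partial>lborel) = 4 * pi * (\<integral>z. lift \<Psi> (\<lambda>_. 1) z \<partial>lborel)"
proof -
  have cR: "continuous_on UNIV \<Psi>" using R by (meson DERIV_isCont continuous_at_imp_continuous_on)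
  obtain B where B: "\<And>z. norm z \<ge> B \<Longrightarrow> u z < exp c" using obtain_radius by blast
  have lz: "lift \<Psi> w z = 0" "lift \<psi> w z = 0" if "u z < exp c" for w :: "real \<times> real \<Rightarrow> real" and z
    using that z by (auto intro: lift_zero)
  \<comment> \<open>One computation for both coordinates: \<open>U\<close> is u along a line and
    \<open>P\<close> its logarithmic derivative. Where \<open>U\<close> vanishes, a neighbourhood
    lies below the level exp c, so the function is locally 0.\<close>
  have part: "((\<lambda>x. if U x > 0 then \<Psi> (ln (U x)) *\<^sub>R P x else 0) has_real_derivative 
        (if U x > 0 then \<psi> (ln (U x)) *\<^sub>R (P x)\<^sup>2 else 0) + (if U x > 0 then \<Psi> (ln (U x)) *\<^sub>R P' else 0)) (at x)"
    if U: "continuous_on UNIV U" "\<And>x. U x \<ge> 0" "U x > 0 \<Longrightarrow> (U has_real_derivative U x * P x) (at x)"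
      "U x > 0 \<Longrightarrow> (P has_real_derivative P') (at x)" for U P :: "real \<Rightarrow> real" and x P'
  proof (cases "U x > 0")
    case True
    have o: "open {x. 0 < U x}" using U(1) by (auto intro!: open_Collect_less continuous_intros)
    have "((\<lambda>x. \<Psi> (ln (U x)) * P x) has_real_derivative \<psi> (ln (U x)) * (P x)\<^sup>2 + \<Psi> (ln (U x)) * P') (at x)"
      using True by (auto intro!: derivative_eq_intros U DERIV_chain2[OF R] simp: power2_eq_square)
    then show ?thesis
      by (rule DERIV_cong[OF has_field_derivative_transform_within_open[OF _ o]]) (use True in auto)
  next
    case False
    then have 1: "U x < exp c" using exp_gt_zero[of c] by linarith
    have o: "open {x. U x < exp c}" using U(1) by (auto intro!: open_Collect_less continuous_intros)
    have [simp]: "\<Psi> (ln t) = 0" if "t < exp c" "t > 0" for t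
      using that by (intro z) (metis exp_less_cancel_iff exp_ln less_imp_le)
    have "((\<lambda>x. 0) has_real_derivative 0) (at x)" by simp
    then show ?thesis
      by (rule DERIV_cong[OF has_field_derivative_transform_within_open[OF _ o]]) (use 1 False in auto)
  qed
  have cy: "continuous_on UNIV (\<lambda>x. u (x, y))" and cx: "continuous_on UNIV (\<lambda>y. u (x, y))" for x y
    by (auto intro!: continuous_on_compose2[OF u_cont] continuous_intros)
  let ?P = "\<lambda>z. lift \<psi> (\<lambda>z. (p z)\<^sup>2) z + lift \<Psi> p1 z"
  let ?Q = "\<lambda>z. lift \<psi> (\<lambda>z. (q z)\<^sup>2) z + lift \<Psi> q2 z"
  have iP: "(\<integral>z. ?P z \<partial>lborel) = 0"
  proof (rule integral_partial_derivative_eq_0(1)[of B "lift \<Psi> p"])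
    show "((\<lambda>x. lift \<Psi> p (x, y)) has_real_derivative ?P (x, y)) (at x)" for x y
      unfolding lift_def by (rule part[of "\<lambda>x. u (x, y)" x "\<lambda>x. p (x, y)"]) (auto intro: cy u_nonneg u_partial p_deriv)
    show "continuous_on UNIV ?P"
      using z by (intro continuous_intros continuous_lift[of _ c] cR c p_cont p1_cont) auto
  qed (use B lz in auto)
  have iQ: "(\<integral>z. ?Q z \<partial>lborel) = 0"
  proof (rule integral_partial_derivative_eq_0(2)[of B "lift \<Psi> q"])
    show "((\<lambda>y. lift \<Psi> q (x, y)) has_real_derivative ?Q (x, y)) (at y)" for x y
      unfolding lift_def by (rule part[of "\<lambda>y. u (x, y)" y "\<lambda>y. q (x, y)"]) (auto intro: cx u_nonneg u_partial q_deriv)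
    show "continuous_on UNIV ?Q"
      using z by (intro continuous_intros continuous_lift[of _ c] cR c q_cont q2_cont) auto
  qed (use B lz in auto)
  have int: "integrable lborel (lift \<psi> (\<lambda>z. (p z)\<^sup>2))" "integrable lborel (lift \<psi> (\<lambda>z. (q z)\<^sup>2))"
     "integrable lborel (lift \<Psi> p1)" "integrable lborel (lift \<Psi> q2)" "integrable lborel (lift \<Psi> (\<lambda>_. 1::real))"
    using z by (auto intro!: integrable_lift[of _ c] continuous_intros cR c p_cont q_cont p1_cont q2_cont)
  have "0 = (\<integral>z. ?P z + ?Q z \<partial>lborel)" using iP iQ int by simp
  also have "\<dots> = (\<integral>z. (lift \<psi> (\<lambda>z. (p z)\<^sup>2) z + lift \<psi> (\<lambda>z. (q z)\<^sup>2) z) - 4 * pi * lift \<Psi> (\<lambda>_. 1) z \<partial>lborel)"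
  proof (intro Bochner_Integration.integral_cong refl)
    fix z
    have "lift \<Psi> p1 z + lift \<Psi> q2 z = - 4 * pi * lift \<Psi> (\<lambda>_. 1) z"
      using laplacian[of z] unfolding lift_def by (auto simp flip: distrib_left)
    then show "?P z + ?Q z = (lift \<psi> (\<lambda>z. (p z)\<^sup>2) z + lift \<psi> (\<lambda>z. (q z)\<^sup>2) z) - 4 * pi * lift \<Psi> (\<lambda>_. 1) z" by simp
  qed
  also have "\<dots> = (\<integral>z. lift \<psi> (\<lambda>z. (p z)\<^sup>2) z + lift \<psi> (\<lambda>z. (q z)\<^sup>2) z \<partial>lborel) - 4 * pi * (\<integral>z. lift \<Psi> (\<lambda>_. 1) z \<partial>lborel)"
    using int by simp
  also have "(\<lambda>z. lift \<psi> (\<lambda>z. (p z)\<^sup>2) z + lift \<psi> (\<lambda>z. (q z)\<^sup>2) z) = lift \<psi> (\<lambda>z. (p z)\<^sup>2 + (q z)\<^sup>2)"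
    by (auto simp: lift_def algebra_simps)
  finally show ?thesis by simp
qed


text \<open>Here \<open>\<psi>\<close> and \<open>\<kappa>\<close> are continuous substitutes for the indicators of \<open>{c1<..<c2}\<close> and of \<open>a < b\<close>;
  \<open>\<epsilon>\<close> is the price of the regularisation.\<close>

lemma level_inequality:
  assumes c: "c1 < c2" and \<epsilon>: "\<epsilon> > 0"
  shows "(c2 - c1 - 2 * \<epsilon>) * A c2 \<le> A c1 * (A c1 - A c2) + 2 * \<epsilon> * A c1"
proof -
  define \<psi> where "\<psi> = (\<lambda>a. max 0 (min 1 (min (a - c1) (c2 - a) / \<epsilon>)))"
  define \<kappa> where "\<kappa> = (\<lambda>a b. max 0 (min 1 ((b - a) / \<epsilon>)))"
  \<comment> \<open>For fixed b, \<open>\<rho> b\<close> is the level profile of the double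
    integrand in the variable z, and \<open>R b\<close> is its antiderivative. Freezing b turns the
    z-integral into that of an exact gradient.\<close>
  define \<rho> where "\<rho> = (\<lambda>b a. \<psi> a * \<kappa> a b)"
  define \<Psi> where "\<Psi> = (\<lambda>b. integral {c1..b} \<psi>)"
  define R where "R = (\<lambda>b x. integral {c1..x} (\<rho> b))"
  have \<psi>: "0 \<le> \<psi> a" "\<psi> a \<le> 1" "a \<le> c1 \<Longrightarrow> \<psi> a = 0" "a \<ge> c2 \<Longrightarrow> \<psi> a = 0" for a
    using \<epsilon> by (auto simp: \<psi>_def min_def divide_simps)
  have \<psi>1: "\<psi> a = 1" if "c1 + \<epsilon> \<le> a" "a \<le> c2 - \<epsilon>" for a
    using \<epsilon> that by (auto simp: \<psi>_def min_def divide_simps)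
  have \<kappa>: "0 \<le> \<kappa> a b" "\<kappa> a b \<le> 1" "b \<le> a \<Longrightarrow> \<kappa> a b = 0" "a \<le> b - \<epsilon> \<Longrightarrow> \<kappa> a b = 1" for a b
    using \<epsilon> by (auto simp: \<kappa>_def min_def divide_simps)
  have c\<psi>: "continuous_on UNIV \<psi>" and c\<rho>: "continuous_on UNIV (\<rho> b)" for b
    using \<epsilon> unfolding \<rho>_def \<psi>_def \<kappa>_def by (auto intro!: continuous_intros)
  have [measurable]: "\<psi> \<in> borel_measurable borel" "(\<lambda>(a, b). \<kappa> a b) \<in> borel_measurable (borel \<Otimes>\<^sub>M borel)"
    unfolding \<psi>_def \<kappa>_def by measurable
  have \<rho>0: "\<rho> b a = 0" if "a \<le> c1" for a b using \<psi>(3)[OF that] by (simp add: \<rho>_def)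
  have d\<Psi>: "(\<Psi> has_real_derivative \<psi> b) (at b)" and \<Psi>0: "b \<le> c1 \<Longrightarrow> \<Psi> b = 0" for b
    unfolding \<Psi>_def using antiderivative_vanishing_left[OF c\<psi> \<psi>(3)] by auto
  have dR: "(R b has_real_derivative \<rho> b x) (at x)" and R0: "x \<le> c1 \<Longrightarrow> R b x = 0" for b x
    unfolding R_def using antiderivative_vanishing_left[OF c\<rho> \<rho>0] by auto
  have c\<Psi>: "continuous_on UNIV \<Psi>" using d\<Psi> by (meson DERIV_isCont continuous_at_imp_continuous_on)
  have i: "\<psi> integrable_on {x..y}" "\<rho> b integrable_on {x..y}" for x y b
    using c\<psi> c\<rho>[of b] by (auto intro!: integrable_continuous_real intro: continuous_on_subset)
  \<comment> \<open>Only levels within \<epsilon> below b are damped by \<kappa>, and there \<psi>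
    \<le> 1, so at most \<epsilon> of \<Psi> b is lost.\<close>
  have R_ge: "\<Psi> b - \<epsilon> \<le> R b b" if "c1 \<le> b" for b
  proof -
    define m where "m = max c1 (b - \<epsilon>)"
    have m: "c1 \<le> m" "m \<le> b" "b - m \<le> \<epsilon>" using that \<epsilon> by (auto simp: m_def)
    have "integral {c1..m} \<psi> = integral {c1..m} (\<rho> b)"
    proof (cases "c1 < b - \<epsilon>")
      case True
      then show ?thesis by (intro integral_cong) (auto simp: \<rho>_def \<kappa> m_def)
    qed (simp add: m_def)
    moreover have "integral {m..b} \<psi> - integral {m..b} (\<rho> b) \<le> \<epsilon>"
    proof -
      have "integral {m..b} \<psi> \<le> integral {m..b} (\<lambda>_. 1)"
        using \<psi> by (intro integral_le i) auto
      moreover have "0 \<le> integral {m..b} (\<rho> b)"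
        using \<psi> \<kappa> by (intro Henstock_Kurzweil_Integration.integral_nonneg i) (auto simp: \<rho>_def)
      ultimately show ?thesis using m by simp
    qed
    moreover have "integral {c1..m} \<psi> + integral {m..b} \<psi> = \<Psi> b" "integral {c1..m} (\<rho> b) + integral {m..b} (\<rho> b) = R b b"
      unfolding \<Psi>_def R_def using m by (auto intro!: Henstock_Kurzweil_Integration.integral_combine i)
    ultimately show ?thesis by linarith
  qed
  have \<Psi>_nonneg: "0 \<le> \<Psi> b" for b
    using \<psi> unfolding \<Psi>_def by (intro Henstock_Kurzweil_Integration.integral_nonneg i) auto
  \<comment> \<open>\<psi> equals 1 between c1 + \<epsilon> and c2 - \<epsilon>; if these bounds are
    in the wrong order, the left side is negative.\<close>
  have \<Psi>_ge: "c2 - c1 - 2 * \<epsilon> \<le> \<Psi> b" if "b \<ge> c2" for b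
  proof (cases "c1 + \<epsilon> \<le> c2 - \<epsilon>")
    case True
    have "integral {c1 + \<epsilon>..c2 - \<epsilon>} (\<lambda>_. 1) = integral {c1 + \<epsilon>..c2 - \<epsilon>} \<psi>"
      using \<psi>1 by (intro integral_cong) auto
    also have "\<dots> \<le> \<Psi> b"
      unfolding \<Psi>_def using that \<epsilon> \<psi> by (intro integral_subset_le i) auto
    finally show ?thesis using True by simp
  qed (use \<Psi>_nonneg[of b] in auto)

  define k where "k = (\<lambda>z y. if u y > 0 then \<kappa> (ln (u z)) (ln (u y)) else 0)"
  define D where "D = (\<lambda>z y. ((p z, q z) \<bullet> (y - z)) / (norm (y - z))\<^sup>2)"
  \<comment> \<open>The double integrand, with \<open>k z\<close> as a continuous stand-in for the
    indicator of {u > u z}. Integrated over y it is controlled by the dipole bound; integrated over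
    z it is computed exactly. The inequality arises by comparing the two orders.\<close>
  define J where "J = (\<lambda>z y. lift \<psi> (\<lambda>_. 1) z * (k z y * D z y))"
  have km [measurable]: "(\<lambda>(z, y). k z y) \<in> borel_measurable (borel \<Otimes>\<^sub>M borel)"
    unfolding k_def by measurable
  have [measurable]: "lift \<psi> (\<lambda>_. 1::real) \<in> borel_measurable borel"
    unfolding lift_def by measurable
  have [measurable]: "(\<lambda>(z, y). J z y) \<in> borel_measurable (borel \<Otimes>\<^sub>M borel)"
    unfolding J_def D_def by measurable
  have k01: "0 \<le> k z y" "k z y \<le> 1" for z y by (auto simp: k_def \<kappa>)
  have k_le: "k z y \<le> indicator {y. u y > exp (ln (u z))} y" if "u z > 0" for z y
  proof (cases "u y > 0 \<and> u y \<le> u z")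
    case True
    then have "\<kappa> (ln (u z)) (ln (u y)) = 0" using that by (intro \<kappa>(3)) simp
    then show ?thesis by (simp add: k_def)
  qed (use that \<kappa>[of "ln (u z)" "ln (u y)"] in \<open>auto simp: k_def indicator_def\<close>)
  have k_int: "integrable lborel (k z)" and k_A: "(\<integral>y. k z y \<partial>lborel) \<le> A (ln (u z))" if "u z > 0" for z
  proof -
    have *: "integrable lborel (\<lambda>y. indicator {y. u y > exp (ln (u z))} y :: real)" by (rule integrable_superlevel)
    show ki: "integrable lborel (k z)"
      by (rule Bochner_Integration.integrable_bound[OF *]) (use k_le[OF that] k01 in auto)
    have "(\<integral>y. k z y \<partial>lborel) \<le> (\<integral>y. indicator {y. u y > exp (ln (u z))} y \<partial>lborel)"
      by (rule integral_mono[OF ki *]) (rule k_le[OF that])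
    then show "(\<integral>y. k z y \<partial>lborel) \<le> A (ln (u z))" by (simp add: A_def)
  qed
  have l\<psi>: "lift \<psi> (\<lambda>_. 1) z = 0 \<or> (u z > 0 \<and> c1 < ln (u z) \<and> ln (u z) < c2)" for z
    using \<psi>(3,4)[of "ln (u z)"] by (cases "ln (u z) \<le> c1"; cases "c2 \<le> ln (u z)") (auto simp: lift_def)
  have l\<psi>0: "0 \<le> lift \<psi> (\<lambda>_. 1::real) z" for z using \<psi>(1) by (simp add: lift_def)
  have A_le: "A (ln (u z)) \<le> A c1" if "c1 < ln (u z)" for z using that by (intro A_antimono) simp
  have n: "(norm (p z, q z))\<^sup>2 = (p z)\<^sup>2 + (q z)\<^sup>2" for z
    unfolding power2_norm_eq_inner by (simp add: inner_prod_def power2_eq_square)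
  have lint: "integrable lborel (lift \<psi> (\<lambda>_. 1::real))" "integrable lborel (lift \<psi> (\<lambda>z. (p z)\<^sup>2 + (q z)\<^sup>2))"
      "integrable lborel (lift \<Psi> (\<lambda>_. 1::real))"
    using \<psi> \<Psi>0 by (auto intro!: integrable_lift[of _ c1] continuous_intros c\<psi> c\<Psi> p_cont q_cont)
  have l_mult: "lift \<psi> (\<lambda>_. 1) z * ((p z)\<^sup>2 + (q z)\<^sup>2) = lift \<psi> (\<lambda>z. (p z)\<^sup>2 + (q z)\<^sup>2) z" for z
    by (simp add: lift_def)
  \<comment> \<open>Absolute convergence for Fubini: the absolute dipole bound leaves a multiple of
    |\<nabla>v|^2, whose weighted integral is finite because the weight vanishes at low levels and
    hence off a bounded set.\<close>
  have Jint: "integrable (lborel \<Otimes>\<^sub>M lborel) (\<lambda>(z, y). J z y)"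
  proof (rule integrableI_bounded)
    have "(\<integral>\<^sup>+x. ennreal (norm (case x of (z, y) \<Rightarrow> J z y)) \<partial>(lborel \<Otimes>\<^sub>M lborel)) = 
       (\<integral>\<^sup>+z. \<integral>\<^sup>+y. ennreal (norm (J z y)) \<partial>lborel \<partial>lborel)"
      by (subst lborel.nn_integral_fst[symmetric]) (auto simp: split_beta')
    also have "\<dots> \<le> (\<integral>\<^sup>+z. ennreal (lift \<psi> (\<lambda>z. (p z)\<^sup>2 + (q z)\<^sup>2) z / 2 + pi * A c1 * lift \<psi> (\<lambda>_. 1) z) \<partial>lborel)"
    proof (intro nn_integral_mono)
      fix z
      show "(\<integral>\<^sup>+y. ennreal (norm (J z y)) \<partial>lborel) \<le> ennreal (lift \<psi> (\<lambda>z. (p z)\<^sup>2 + (q z)\<^sup>2) z / 2 + pi * A c1 * lift \<psi> (\<lambda>_. 1) z)"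
      proof (cases "lift \<psi> (\<lambda>_. 1::real) z = 0")
        case True
        then show ?thesis by (simp add: J_def)
      next
        case False
        with l\<psi>[of z] have z: "u z > 0" "c1 < ln (u z)" by auto
        have "ennreal (norm (J z y)) = ennreal (lift \<psi> (\<lambda>_. 1) z) * ennreal (k z y * \<bar>D z y\<bar>)" for y
          by (subst ennreal_mult[symmetric]) (use k01 l\<psi>0 in \<open>simp_all add: J_def abs_mult\<close>)
        moreover have "(\<lambda>y. ennreal (k z y * \<bar>D z y\<bar>)) \<in> borel_measurable lborel"
          unfolding D_def by measurable
        ultimately have "(\<integral>\<^sup>+y. ennreal (norm (J z y)) \<partial>lborel) = ennreal (lift \<psi> (\<lambda>_. 1) z) * (\<integral>\<^sup>+y. ennreal (k z y * \<bar>D z y\<bar>) \<partial>lborel)"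
          by (simp add: nn_integral_cmult)
        also have "(\<integral>\<^sup>+y. ennreal (k z y * \<bar>D z y\<bar>) \<partial>lborel) \<le> ennreal ((norm (p z, q z))\<^sup>2 / 2) + ennreal pi * (\<integral>\<^sup>+y. ennreal (k z y) \<partial>lborel)"
          unfolding D_def by (rule nn_integral_abs_dipole_le) (use k01 in auto)
        also have "(\<integral>\<^sup>+y. ennreal (k z y) \<partial>lborel) = ennreal (\<integral>y. k z y \<partial>lborel)"
          using k_int[OF z(1)] k01 by (intro nn_integral_eq_integral) auto
        also have "ennreal ((norm (p z, q z))\<^sup>2 / 2) + ennreal pi * ennreal (\<integral>y. k z y \<partial>lborel)
            = ennreal (((p z)\<^sup>2 + (q z)\<^sup>2) / 2 + pi * (\<integral>y. k z y \<partial>lborel))"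
          using k01 by (simp add: n ennreal_mult[symmetric] integral_nonneg_AE)
        also have "\<dots> \<le> ennreal (((p z)\<^sup>2 + (q z)\<^sup>2) / 2 + pi * A c1)"
          using k_A[OF z(1)] A_le[OF z(2)] by (intro ennreal_leI add_left_mono mult_left_mono) auto
        also have "ennreal (lift \<psi> (\<lambda>_. 1) z) * \<dots> = ennreal (lift \<psi> (\<lambda>_. 1) z * (((p z)\<^sup>2 + (q z)\<^sup>2) / 2 + pi * A c1))"
          by (rule ennreal_mult[symmetric]) (simp_all add: l\<psi>0 A_nonneg)
        also have "lift \<psi> (\<lambda>_. 1) z * (((p z)\<^sup>2 + (q z)\<^sup>2) / 2 + pi * A c1) = lift \<psi> (\<lambda>z. (p z)\<^sup>2 + (q z)\<^sup>2) z / 2 + pi * A c1 * lift \<psi> (\<lambda>_. 1) z"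
          by (simp add: l_mult[symmetric] algebra_simps)
        finally show ?thesis by (simp add: mult_left_mono)
      qed
    qed
    also have "\<dots> < \<infinity>"
    proof -
      have "integrable lborel (\<lambda>z. lift \<psi> (\<lambda>z. (p z)\<^sup>2 + (q z)\<^sup>2) z / 2 + pi * A c1 * lift \<psi> (\<lambda>_. 1) z)" 
        using lint by simp
      then show ?thesis
        by (subst nn_integral_eq_integral)
           (auto simp: l_mult[symmetric] l\<psi>0 A_nonneg intro!: AE_I2 add_nonneg_nonneg mult_nonneg_nonneg)
    qed
    finally show "(\<integral>\<^sup>+x. ennreal (norm (case x of (z, y) \<Rightarrow> J z y)) \<partial>(lborel \<Otimes>\<^sub>M lborel)) < \<infinity>" .
  qed measurable
  have swap: "(\<integral>y. (\<integral>z. J z y \<partial>lborel) \<partial>lborel) = (\<integral>z. (\<integral>y. J z y \<partial>lborel) \<partial>lborel)"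
    by (rule lborel_pair.Fubini_integral[OF Jint])
  have int_zy: "integrable lborel (\<lambda>z. \<integral>y. J z y \<partial>lborel)" by (rule lborel_pair.integrable_fst[OF Jint])
  have int_yz: "integrable lborel (\<lambda>y. \<integral>z. J z y \<partial>lborel)" by (rule lborel_pair.integrable_snd[OF Jint])
  have I: "indicator {z. u z > exp c} z = (if u z > 0 \<and> ln (u z) > c then 1 else 0 :: real)" for c z
    by (smt (verit, best) exp_gt_zero exp_le_cancel_iff exp_ln indicator_simps mem_Collect_eq)
  \<comment> \<open>With b = v(y) frozen, the field facing the kernel is the gradient of R_b(v), so
    the dipole formula evaluates the integral to 2 pi R_b(b), which loses at most 2 pi \<epsilon>
    against 2 pi \<Psi>(v(y)).\<close>
  have lower: "2 * pi * (lift \<Psi> (\<lambda>_. 1) y - \<epsilon> * indicator {z. u z > exp c1} y) \<le> (\<integral>z. J z y \<partial>lborel)" for y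
  proof (cases "u y > 0")
    case True
    have "(\<integral>z. J z y \<partial>lborel) = (\<integral>z. (lift (\<rho> (ln (u y))) (\<lambda>z. (p z, q z)) z \<bullet> (y - z)) / (norm (y - z))\<^sup>2 \<partial>lborel)"
      using True by (intro Bochner_Integration.integral_cong refl) (auto simp: J_def k_def D_def lift_def \<rho>_def mult.assoc simp del: scaleR_Pair)
    also obtain B where B: "\<And>z. norm z \<ge> B \<Longrightarrow> u z < exp c1" using obtain_radius by blast
    have "(\<integral>z. (lift (\<rho> (ln (u y))) (\<lambda>z. (p z, q z)) z \<bullet> (y - z)) / (norm (y - z))\<^sup>2 \<partial>lborel) = 2 * pi * lift (R (ln (u y))) (\<lambda>_. 1) y"
    proof (rule integral_gradient_dipole[where H="lift (R (ln (u y))) (\<lambda>_. 1)" and R=B and G="lift (\<rho> (ln (u y))) (\<lambda>z. (p z, q z))"])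
      show "(lift (R (ln (u y))) (\<lambda>_. 1) has_derivative (\<lambda>h. lift (\<rho> (ln (u y))) (\<lambda>z. (p z, q z)) z \<bullet> h)) (at z)" for z
        by (rule lift_deriv[OF dR R0 \<rho>0])
      show "continuous_on UNIV (lift (\<rho> (ln (u y))) (\<lambda>z. (p z, q z)))"
        by (intro continuous_lift[OF c\<rho> \<rho>0] continuous_intros p_cont q_cont)
      show "lift (R (ln (u y))) (\<lambda>_. 1) z = 0 \<and> lift (\<rho> (ln (u y))) (\<lambda>z. (p z, q z)) z = 0" if "B \<le> norm z" for z
        using B[OF that] by (simp add: lift_zero[OF R0] lift_zero[OF \<rho>0])
    qed
    finally have eq: "(\<integral>z. J z y \<partial>lborel) = 2 * pi * R (ln (u y)) (ln (u y))"
      using True by (simp add: lift_def)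
    have "lift \<Psi> (\<lambda>_. 1) y - \<epsilon> * indicator {z. u z > exp c1} y \<le> R (ln (u y)) (ln (u y))"
      using True R_ge[of "ln (u y)"] \<Psi>0[of "ln (u y)"] R0[of "ln (u y)" "ln (u y)"] unfolding I by (auto simp: lift_def)
    then show ?thesis unfolding eq by (intro mult_left_mono) auto
  next
    case False
    then show ?thesis by (simp add: J_def k_def lift_def indicator_def \<epsilon> less_imp_le)
  qed
  \<comment> \<open>The weight restricts z to levels between c1 and c2; there the superlevel set
    above z has measure at most A c1, and the weight is at most 1.\<close>
  have upper: "(\<integral>y. J z y \<partial>lborel) \<le> lift \<psi> (\<lambda>z. (p z)\<^sup>2 + (q z)\<^sup>2) z / 4 + pi * A c1 * (indicator {z. u z > exp c1} z - indicator {z. u z > exp c2} z)" for z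
  proof (cases "lift \<psi> (\<lambda>_. 1::real) z = 0")
    case True
    then have "lift \<psi> (\<lambda>z. (p z)\<^sup>2 + (q z)\<^sup>2) z = 0" using l_mult[of z] by simp
    then show ?thesis using True A_nonneg[of c1] c by (auto simp: J_def I)
  next
    case False
    with l\<psi>[of z] have z: "u z > 0" "c1 < ln (u z)" "ln (u z) < c2" by auto
    have "(\<integral>y. J z y \<partial>lborel) = lift \<psi> (\<lambda>_. 1) z * (\<integral>y. k z y * D z y \<partial>lborel)" by (simp add: J_def)
    also have "\<dots> \<le> lift \<psi> (\<lambda>_. 1) z * ((norm (p z, q z))\<^sup>2 / 4 + pi * (\<integral>y. k z y \<partial>lborel))"
      unfolding D_def by (intro mult_left_mono integral_dipole_le(2) k_int z k01 l\<psi>0)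
    also have "\<dots> \<le> lift \<psi> (\<lambda>_. 1) z * (((p z)\<^sup>2 + (q z)\<^sup>2) / 4 + pi * A c1)"
      unfolding n using k_A[OF z(1)] A_le[OF z(2)] by (intro mult_left_mono add_left_mono l\<psi>0) auto
    also have "\<dots> = lift \<psi> (\<lambda>z. (p z)\<^sup>2 + (q z)\<^sup>2) z / 4 + pi * A c1 * lift \<psi> (\<lambda>_. 1) z"
      by (simp add: l_mult[symmetric] algebra_simps)
    also have "\<dots> \<le> lift \<psi> (\<lambda>z. (p z)\<^sup>2 + (q z)\<^sup>2) z / 4 + pi * A c1 * 1"
      using \<psi>(2) A_nonneg[of c1] z by (intro add_left_mono mult_left_mono) (auto simp: lift_def)
    finally show ?thesis using z by (simp add: I)
  qed
  have "2 * pi * ((\<integral>y. lift \<Psi> (\<lambda>_. 1) y \<partial>lborel) - \<epsilon> * A c1) = (\<integral>y. 2 * pi * (lift \<Psi> (\<lambda>_. 1) y - \<epsilon> * indicator {z. u z > exp c1} y) \<partial>lborel)"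
    using lint(3) integrable_superlevel[of c1] by (simp add: A_def)
  also have "\<dots> \<le> (\<integral>y. (\<integral>z. J z y \<partial>lborel) \<partial>lborel)"
    using lint(3) integrable_superlevel[of c1] by (intro integral_mono int_yz lower) simp
  also have "\<dots> = (\<integral>z. (\<integral>y. J z y \<partial>lborel) \<partial>lborel)" by (rule swap)
  also have "\<dots> \<le> (\<integral>z. lift \<psi> (\<lambda>z. (p z)\<^sup>2 + (q z)\<^sup>2) z / 4 + pi * A c1 * (indicator {z. u z > exp c1} z - indicator {z. u z > exp c2} z) \<partial>lborel)"
    using lint(2) integrable_superlevel[of c1] integrable_superlevel[of c2] by (intro integral_mono int_zy upper) simp
  also have "\<dots> = pi * (\<integral>y. lift \<Psi> (\<lambda>_. 1) y \<partial>lborel) + pi * A c1 * (A c1 - A c2)"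
    using lint(2) integrable_superlevel[of c1] integrable_superlevel[of c2] 
      integral_lift_gradient_square[OF d\<Psi> \<Psi>0 \<psi>(3) c\<psi>] by (simp add: A_def)
  finally have "pi * (\<integral>y. lift \<Psi> (\<lambda>_. 1) y \<partial>lborel) \<le> pi * (A c1 * (A c1 - A c2) + 2 * \<epsilon> * A c1)"
    by (simp add: algebra_simps)
  then have "(\<integral>y. lift \<Psi> (\<lambda>_. 1) y \<partial>lborel) \<le> A c1 * (A c1 - A c2) + 2 * \<epsilon> * A c1" by simp
  moreover have "(c2 - c1 - 2 * \<epsilon>) * A c2 \<le> (\<integral>y. lift \<Psi> (\<lambda>_. 1) y \<partial>lborel)"
  proof -
    have "(c2 - c1 - 2 * \<epsilon>) * A c2 = (\<integral>y. (c2 - c1 - 2 * \<epsilon>) * indicator {z. u z > exp c2} y \<partial>lborel)"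
      by (simp add: A_def)
    also have "\<dots> \<le> (\<integral>y. lift \<Psi> (\<lambda>_. 1) y \<partial>lborel)"
      using \<Psi>_ge \<Psi>_nonneg by (intro integral_mono lint integrable_mult_right integrable_superlevel) (auto simp: I lift_def)
    finally show ?thesis .
  qed
  ultimately show ?thesis by linarith
qed

end

section \<open>Comparison of distribution functions\<close>

text \<open>The second hypothesis misses the slope bound by the factor A b / A a. Over a step of
  length h it reads h \<le> (A x - A y) (1 + h / A x), with correction at most h / A c2 throughout.
  Summing over N + 1 equal steps telescopes, and refining the subdivision removes the
  correction.\<close>

lemma slope_by_subdivision:
  fixes A :: "real \<Rightarrow> real"
  assumes anti: "\<And>a b. a \<le> b \<Longrightarrow> A b \<le> A a"
    and ineq: "\<And>a b. a < b \<Longrightarrow> (b - a) * A b \<le> A a * (A a - A b)"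
    and "A c2 > 0" "c1 < c2"
  shows "c2 - c1 \<le> A c1 - A c2"
proof -
  have step: "c2 - c1 \<le> (A c1 - A c2) * (1 + (c2 - c1) / real (Suc N) / A c2)" for N
  proof -
    define h where "h = (c2 - c1) / real (Suc N)"
    have h: "h > 0" using assms by (simp add: h_def)
    have "real n * h \<le> (A c1 - A (c1 + real n * h)) * (1 + h / A c2)" if "n \<le> Suc N" for n
      using that
    proof (induction n)
      case (Suc n)
      define x where "x = c1 + real n * h"
      define y where "y = c1 + real (Suc n) * h"
      have xy: "y - x = h" by (simp add: x_def y_def algebra_simps)
      have "y \<le> c2"
      proof -
        have "real (Suc n) * h \<le> real (Suc N) * h" using Suc h by (intro mult_right_mono) auto
        then show ?thesis by (simp add: y_def h_def)
      qed
      then have Ay: "A c2 \<le> A y" by (rule anti)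
      have Ax: "A y \<le> A x" using xy h by (intro anti) simp
      have "h * A x \<le> (A x - A y) * (A x + h)"
        using ineq[of x y] xy h by (simp add: algebra_simps)
      then have "h \<le> (A x - A y) * (1 + h / A x)"
        using Ax Ay assms by (simp add: field_simps)
      also have "\<dots> \<le> (A x - A y) * (1 + h / A c2)"
        using Ax Ay assms h by (intro mult_left_mono add_left_mono divide_left_mono) auto
      finally have "h \<le> (A x - A y) * (1 + h / A c2)" .
      moreover have "real n * h \<le> (A c1 - A x) * (1 + h / A c2)" using Suc by (simp add: x_def)
      ultimately have "real (Suc n) * h \<le> (A c1 - A y) * (1 + h / A c2)" by (simp add: algebra_simps)
      then show ?case by (simp only: y_def)
    qed simp
    from this[of "Suc N"] show ?thesis by (simp add: h_def)
  qed
  have "((\<lambda>N. (A c1 - A c2) * (1 + (c2 - c1) / real (Suc N) / A c2)) \<longlonglongrightarrow> (A c1 - A c2) * (1 + 0 / A c2))"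
    using assms(3) by (intro tendsto_intros LIMSEQ_Suc[OF lim_const_over_n]) auto
  from LIMSEQ_le_const[OF this] step show ?thesis by auto
qed

lemma integral_pos_on_interval:
  fixes f :: "real \<Rightarrow> real"
  assumes f: "integrable lborel f" and nonneg: "\<And>x. 0 \<le> f x" and "a < b" and pos: "\<And>x. a < x \<Longrightarrow> x < b \<Longrightarrow> 0 < f x"
  shows "0 < (\<integral>x. f x \<partial>lborel)"
proof (rule ccontr)
  assume "\<not> ?thesis"
  then have "(\<integral>x. f x \<partial>lborel) = 0" using nonneg by (simp add: not_less order_antisym integral_nonneg_AE)
  then have "AE x in lborel. f x = 0"
    using f nonneg by (subst (asm) integral_nonneg_eq_0_iff_AE) auto
  then have "AE x in lborel. x \<notin> {a<..<b}" by eventually_elim (use pos in force)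
  then have "emeasure lborel {a<..<b} = 0" by (subst (asm) AE_iff_measurable[of "{a<..<b}"]) auto
  then show False using \<open>a < b\<close> by simp
qed

text \<open>The mass of the comparison function -c. It equals the bound imposed on the mass of A
  below, which is why A + c has nonpositive total weight on the negative half-line.\<close>

lemma has_bochner_integral_exp_tail:
  "has_bochner_integral lborel (\<lambda>c. exp c * (- c) * indicator {..0::real} c) 1"
proof (rule has_bochner_integral_nn_integral)
  have "(\<integral>\<^sup>+c. ennreal (exp c * (- c) * indicator {..0::real} c) \<partial>lborel) = 
     (\<integral>\<^sup>+x. ennreal (x ^ 1 * exp (- x)) * indicator {0..} x \<partial>lborel)"
    by (subst nn_integral_real_affine[where c="-1" and t=0]) (auto intro!: nn_integral_cong split: split_indicator simp: mult.commute)
  also have "\<dots> = ennreal 1" using nn_intergal_power_times_exp_Ici[of 1] by simp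
  finally show "(\<integral>\<^sup>+c. ennreal (exp c * (- c) * indicator {..0::real} c) \<partial>lborel) = ennreal 1" .
qed (auto split: split_indicator simp: mult_nonneg_nonpos)

text \<open>With L = -m this is the Gaussian value (1 - exp (-a m)) / a - m exp (-a m): the part of
  the layer-cake integral above the threshold exp (-a m).\<close>

lemma has_bochner_integral_exp_segment:
  fixes a L :: real
  assumes "a > 0" "L \<le> 0"
  shows "has_bochner_integral lborel (\<lambda>c. a * exp (a * c) * (- c) * indicator {L..0} c) (L * exp (a * L) + (1 - exp (a * L)) / a)"
proof -
  have "has_bochner_integral lborel (\<lambda>c. a * exp (a * c) * (- c) * indicator {L..0} c)
      ((- 0 * exp (a * 0) + exp (a * 0) / a) - (- L * exp (a * L) + exp (a * L) / a))"
    by (rule has_bochner_integral_FTC_Icc_real)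
       (use assms in \<open>auto intro!: derivative_eq_intros simp: field_simps\<close>)
  then show ?thesis by (simp add: algebra_simps diff_divide_distrib)
qed

text \<open>Since \<open>A c + c\<close> changes sign at most once, from positive to negative, and \<open>A c\<close> has no more
  mass than \<open>-c\<close> with respect to the weight \<open>exp c\<close>, it has no more mass with respect to any
  weight that grows faster on \<open>{L..0}\<close>.\<close>

lemma crossing_comparison:
  fixes A :: "real \<Rightarrow> real"
  assumes nonneg: "\<And>c. 0 \<le> A c" and anti: "\<And>a b. a \<le> b \<Longrightarrow> A b \<le> A a"
    and slope: "\<And>a b. a < b \<Longrightarrow> A b > 0 \<Longrightarrow> b - a \<le> A a - A b"
    and mass: "(\<integral>\<^sup>+c. ennreal (exp c * A c) \<partial>lborel) \<le> 1"
    and "a \<ge> 1" "L < 0"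
  shows "integrable lborel (\<lambda>c. a * exp (a * c) * A c * indicator {L..0} c)"
    and "(\<integral>c. a * exp (a * c) * A c * indicator {L..0} c \<partial>lborel) \<le> L * exp (a * L) + (1 - exp (a * L)) / a"
    and "(\<exists>c<0. A c = 0) \<Longrightarrow> (\<integral>c. a * exp (a * c) * A c * indicator {L..0} c \<partial>lborel) < L * exp (a * L) + (1 - exp (a * L)) / a"
proof -
  have Am[measurable]: "A \<in> borel_measurable borel"
  proof -
    have "mono (\<lambda>c. - A c)" using anti by (auto simp: mono_def)
    then have "(\<lambda>c. - (- A c)) \<in> borel_measurable borel" by (intro borel_measurable_uminus borel_measurable_mono)
    then show ?thesis by simp
  qed
  define d where "d c = A c + c" for c
  have [measurable]: "d \<in> borel_measurable borel" unfolding d_def by measurable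
  \<comment> \<open>Ratio of the weights a exp (a c) and exp c. It is nondecreasing because a \<ge>
    1; this is the use of p \<ge> 2.\<close>
  define q where "q c = a * exp ((a - 1) * c)" for c
  have qexp: "q c * exp c = a * exp (a * c)" for c by (simp add: q_def flip: exp_add) (simp add: algebra_simps)
  have q_mono: "c \<le> c' \<Longrightarrow> q c \<le> q c'" for c c'
    using \<open>a \<ge> 1\<close> by (auto simp: q_def intro!: mult_left_mono)
  have q_pos: "q c > 0" for c using \<open>a \<ge> 1\<close> by (simp add: q_def)
  \<comment> \<open>If d x > 0 with x \<le> 0, then A x > -x \<ge> 0, so the slope bound applies and
    d is at least d x at every earlier point.\<close>
  have d_left: "d c > 0" if "d x > 0" "c \<le> x" "x \<le> 0" for c x
    using slope[of c x] that by (cases "c = x") (auto simp: d_def)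
  have iA: "integrable lborel (\<lambda>c. exp c * A c * indicator {..0} c)"
    and iA1: "(\<integral>c. exp c * A c * indicator {..0} c \<partial>lborel) \<le> 1"
  proof -
    have le: "(\<integral>\<^sup>+c. ennreal (exp c * A c * indicator {..0} c) \<partial>lborel) \<le> 1"
      by (rule order.trans[OF nn_integral_mono mass]) (auto split: split_indicator)
    show i: "integrable lborel (\<lambda>c. exp c * A c * indicator {..0} c)"
    proof (rule integrableI_bounded)
      show "(\<integral>\<^sup>+c. ennreal (norm (exp c * A c * indicator {..0} c)) \<partial>lborel) < \<infinity>"
        using le nonneg by (auto simp: abs_mult intro: le_less_trans)
    qed measurable
    have "ennreal (\<integral>c. exp c * A c * indicator {..0} c \<partial>lborel) \<le> ennreal 1"
      using le nonneg by (subst nn_integral_eq_integral[symmetric, OF i]) auto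
    then show "(\<integral>c. exp c * A c * indicator {..0} c \<partial>lborel) \<le> 1"
      by (subst (asm) ennreal_le_iff) auto
  qed
  have id: "integrable lborel (\<lambda>c. exp c * d c * indicator {..0} c)"
    and id0: "(\<integral>c. exp c * d c * indicator {..0} c \<partial>lborel) \<le> 0"
  proof -
    have eq: "(\<lambda>c. exp c * d c * indicator {..0} c) = (\<lambda>c. exp c * A c * indicator {..0} c - exp c * (- c) * indicator {..0} c)"
      by (auto simp: d_def algebra_simps)
    show "integrable lborel (\<lambda>c. exp c * d c * indicator {..0} c)"
      unfolding eq using iA has_bochner_integral_exp_tail by (intro Bochner_Integration.integrable_diff) (auto simp: has_bochner_integral_iff)
    show "(\<integral>c. exp c * d c * indicator {..0} c \<partial>lborel) \<le> 0"
      unfolding eq using iA iA1 has_bochner_integral_exp_tail by (subst Bochner_Integration.integral_diff) (auto simp: has_bochner_integral_iff)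
  qed
  have bint: "integrable lborel (\<lambda>c. f c * indicator {L..0} c)"
    if [measurable]: "f \<in> borel_measurable borel" and "\<And>c. c \<in> {L..0} \<Longrightarrow> \<bar>f c\<bar> \<le> B" for f :: "real \<Rightarrow> real" and B
  proof (rule Bochner_Integration.integrable_bound)
    show "integrable lborel (\<lambda>c. B * indicator {L..0} c)"
      using \<open>L < 0\<close> by (intro integrable_mult_right integrable_real_indicator) auto
    show "AE c in lborel. norm (f c * indicator {L..0} c) \<le> norm (B * indicator {L..0} c)"
      using that(2) by (intro AE_I2) (fastforce split: split_indicator)
  qed measurable
  have bA: "\<bar>A c\<bar> \<le> A L" "\<bar>c\<bar> \<le> \<bar>L\<bar>" "exp c \<le> 1" "exp (a * c) \<le> 1" if "c \<in> {L..0}" for c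
    using that nonneg anti \<open>a \<ge> 1\<close> by (auto simp: mult_nonneg_nonpos)
  have intA: "integrable lborel (\<lambda>c. a * exp (a * c) * A c * indicator {L..0} c)"
  proof (rule bint[where B="a * (1 * A L)"])
    fix c assume "c \<in> {L..0}"
    then have "a * (exp (a * c) * \<bar>A c\<bar>) \<le> a * (1 * A L)"
      using \<open>a \<ge> 1\<close> bA[of c] nonneg[of L] by (intro mult_left_mono mult_mono) auto
    then show "\<bar>a * exp (a * c) * A c\<bar> \<le> a * (1 * A L)" using \<open>a \<ge> 1\<close> by (simp add: abs_mult)
  qed measurable
  then show "integrable lborel (\<lambda>c. a * exp (a * c) * A c * indicator {L..0} c)" .
  have intc: "has_bochner_integral lborel (\<lambda>c. a * exp (a * c) * (- c) * indicator {L..0} c) (L * exp (a * L) + (1 - exp (a * L)) / a)"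
    using \<open>L < 0\<close> \<open>a \<ge> 1\<close> by (intro has_bochner_integral_exp_segment) auto
  define I where "I = (\<integral>c. a * exp (a * c) * d c * indicator {L..0} c \<partial>lborel)"
  have eqd: "(\<lambda>c. a * exp (a * c) * d c * indicator {L..0} c) = (\<lambda>c. a * exp (a * c) * A c * indicator {L..0} c - a * exp (a * c) * (- c) * indicator {L..0} c)"
    by (auto simp: d_def algebra_simps)
  have intd: "integrable lborel (\<lambda>c. a * exp (a * c) * d c * indicator {L..0} c)"
    unfolding eqd using intA intc by (intro Bochner_Integration.integrable_diff) (auto simp: has_bochner_integral_iff)
  have I: "(\<integral>c. a * exp (a * c) * A c * indicator {L..0} c \<partial>lborel) = I + (L * exp (a * L) + (1 - exp (a * L)) / a)"
    unfolding I_def eqd using intA intc by (subst Bochner_Integration.integral_diff) (auto simp: has_bochner_integral_iff)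
  have "I \<le> 0 \<and> ((\<exists>c<0. A c = 0) \<longrightarrow> I < 0)"
  proof (cases "\<exists>c. L < c \<and> c \<le> 0 \<and> d c > 0")
    \<comment> \<open>Without a positive value of d above L the integrand is nonpositive almost
      everywhere. It is strictly negative on an interval if A vanishes at some c < 0, since then A =
      0 from there on and d c = c.\<close>
    case False
    then have neg: "d c \<le> 0" if "L < c" "c \<le> 0" for c using that by (auto simp: not_less)
    have ae: "AE c in lborel. c \<noteq> L" by (rule AE_lborel_singleton)
    define g where "g c = a * exp (a * c) * (- d c) * indicator {L<..0} c" for c
    have g0: "0 \<le> g c" for c
      using neg \<open>a \<ge> 1\<close> by (auto simp: g_def mult_nonneg_nonpos split: split_indicator)
    have aeg: "AE c in lborel. - (a * exp (a * c) * d c * indicator {L..0} c) = g c"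
      using ae by eventually_elim (auto simp: g_def split: split_indicator)
    have gm[measurable]: "g \<in> borel_measurable borel" unfolding g_def by measurable
    have gint: "integrable lborel g"
      using integrable_minus[OF intd] by (rule integrable_cong_AE_imp) (use aeg in \<open>auto simp: eq_commute\<close>)
    have "- I = (\<integral>c. g c \<partial>lborel)"
      unfolding I_def by (subst Bochner_Integration.integral_minus[symmetric], rule integral_cong_AE) (use aeg in auto)
    then have I_eq: "I = - (\<integral>c. g c \<partial>lborel)" by linarith
    have "0 \<le> (\<integral>c. g c \<partial>lborel)" using g0 by (intro integral_nonneg_AE) auto
    moreover have "0 < (\<integral>c. g c \<partial>lborel)" if "c0 < 0" "A c0 = 0" for c0
    proof (rule integral_pos_on_interval[OF gint g0, of "max c0 L" 0])
      show "max c0 L < 0" using that \<open>L < 0\<close> by simp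
      fix c assume c: "max c0 L < c" "c < 0"
      then have "A c = 0" using anti[of c0 c] nonneg[of c] that by simp
      then show "0 < g c" using c \<open>a \<ge> 1\<close> by (simp add: g_def d_def mult_pos_neg)
    qed
    ultimately show ?thesis unfolding I_eq by auto
  next
    case True
    then obtain c' where c': "L < c'" "c' \<le> 0" "d c' > 0" by auto
    define S where "S = {c. c \<le> 0 \<and> d c > 0}"
    \<comment> \<open>The crossing point: d > 0 to the left of s and d \<le> 0 between s and 0.
      Replacing the increasing ratio q c by the constant q s therefore cannot decrease the
      integral.\<close>
    define s where "s = Sup S"
    have S: "c' \<in> S" "bdd_above S" using c' by (auto simp: S_def)
    have dpos: "d c > 0" if "c < s" for c
      using less_cSupD[of S c] that S(1) d_left[of _ c] unfolding s_def S_def by fastforce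
    have dneg: "d c \<le> 0" if "s < c" "c \<le> 0" for c
    proof (rule ccontr)
      assume "\<not> d c \<le> 0"
      then have "c \<in> S" using that by (simp add: S_def)
      then have "c \<le> s" unfolding s_def using S(2) by (intro cSup_upper)
      then show False using that by simp
    qed
    have dL: "d L > 0" using d_left[of c' L] c' by auto
    have "(\<lambda>c. indicator {L..0} c *\<^sub>R (exp c * d c * indicator {..0} c)) = (\<lambda>c. exp c * d c * indicator {L..0} c)"
      by (auto split: split_indicator)
    then have id': "integrable lborel (\<lambda>c. exp c * d c * indicator {L..0} c)"
      using integrable_mult_indicator[OF _ id, of "{L..0}"] by simp
    have "(\<lambda>c. indicator {..<L} c *\<^sub>R (exp c * d c * indicator {..0} c)) = (\<lambda>c. exp c * d c * indicator {..<L} c)"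
      using \<open>L < 0\<close> by (auto split: split_indicator)
    then have id'': "integrable lborel (\<lambda>c. exp c * d c * indicator {..<L} c)"
      using integrable_mult_indicator[OF _ id, of "{..<L}"] by simp
    have "I \<le> (\<integral>c. q s * (exp c * d c * indicator {L..0} c) \<partial>lborel)"
      unfolding I_def
    proof (intro integral_mono intd integrable_mult_right id')
      fix c
      have "(q c - q s) * d c \<le> 0" if "c \<le> 0"
        using dpos[of c] dneg[of c] q_mono[of c s] q_mono[of s c] that
        by (cases c s rule: linorder_cases) (auto simp: mult_nonpos_nonneg mult_nonneg_nonpos less_imp_le)
      then have "(exp c * indicator {L..0} c) * ((q c - q s) * d c) \<le> 0"
        by (cases "c \<le> 0") (simp_all add: mult_nonneg_nonpos del: mult_le_0_iff)
      then have "q c * exp c * d c * indicator {L..0} c \<le> q s * (exp c * d c * indicator {L..0} c)"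
        by (simp add: algebra_simps)
      then show "a * exp (a * c) * d c * indicator {L..0} c \<le> q s * (exp c * d c * indicator {L..0} c)"
        by (simp add: qexp)
    qed
    also have "\<dots> = q s * (\<integral>c. exp c * d c * indicator {L..0} c \<partial>lborel)" by simp
    \<comment> \<open>Strict, because d is positive on all of c < L, and that part takes a positive
      share of a total that is at most 0.\<close>
    also have "\<dots> < 0"
    proof -
      have "(\<integral>c. exp c * d c * indicator {..0} c \<partial>lborel) = (\<integral>c. exp c * d c * indicator {..<L} c + exp c * d c * indicator {L..0} c \<partial>lborel)"
        using \<open>L < 0\<close> by (intro Bochner_Integration.integral_cong) (auto split: split_indicator)
      then have "(\<integral>c. exp c * d c * indicator {..<L} c \<partial>lborel) + (\<integral>c. exp c * d c * indicator {L..0} c \<partial>lborel) \<le> 0"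
        using id0 id' id'' by simp
      moreover have "0 < (\<integral>c. exp c * d c * indicator {..<L} c \<partial>lborel)"
        by (rule integral_pos_on_interval[OF id'', of "L - 1" L])
           (use d_left[OF dL] \<open>L < 0\<close> in \<open>auto split: split_indicator simp: less_imp_le\<close>)
      ultimately show ?thesis using q_pos[of s] by (intro mult_pos_neg) auto
    qed
    finally show ?thesis by simp
  qed
  then show "(\<integral>c. a * exp (a * c) * A c * indicator {L..0} c \<partial>lborel) \<le> L * exp (a * L) + (1 - exp (a * L)) / a"
    and "(\<exists>c<0. A c = 0) \<Longrightarrow> (\<integral>c. a * exp (a * c) * A c * indicator {L..0} c \<partial>lborel) < L * exp (a * L) + (1 - exp (a * L)) / a"
    unfolding I by auto
qed

section \<open>Gaussian wave packets and the short-time Fourier transform\<close>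

text \<open>Rescaling by sqrt (2 a) turns the integral into the characteristic function of the
  standard normal distribution.\<close>

lemma has_bochner_integral_gaussian_fourier:
  assumes "a > 0"
  shows "has_bochner_integral lborel (\<lambda>y. exp (\<i> * of_real (t * y)) * of_real (exp (- a * y\<^sup>2)))
     (of_real (sqrt (pi / a) * exp (- t\<^sup>2 / (4 * a))))"
proof -
  define s where "s = t / sqrt (2 * a)"
  have s2: "s\<^sup>2 / 2 = t\<^sup>2 / (4 * a)" using assms by (simp add: s_def power_divide)
  define h where "h x = std_normal_density x *\<^sub>R iexp (s * x)" for x
  have hint: "integrable lborel h"
    unfolding h_def by (rule Bochner_Integration.integrable_bound[OF integrable_normal_density[of 1 0]]) auto
  have "(\<integral>x. h x \<partial>lborel) = char std_normal_distribution s"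
    unfolding char_def h_def by (subst integral_density) (auto intro: borel_measurable_continuous_onI continuous_intros)
  also have "\<dots> = of_real (exp (- (t\<^sup>2 / (4 * a))))"
    by (simp add: char_std_normal_distribution s2[symmetric])
  finally have hb: "has_bochner_integral lborel h (of_real (exp (- (t\<^sup>2 / (4 * a)))))"
    using hint by (simp add: has_bochner_integral_iff)
  have pos: "sqrt (2 * a) \<noteq> 0" using assms by simp
  have "has_bochner_integral lborel (\<lambda>y. h (0 + sqrt (2 * a) * y)) (of_real (exp (- (t\<^sup>2 / (4 * a)))) /\<^sub>R \<bar>sqrt (2 * a)\<bar>)"
    using hb by (subst (asm) lborel_has_bochner_integral_real_affine_iff[OF pos, where t=0])
  then have "has_bochner_integral lborel (\<lambda>y. sqrt (2 * pi) *\<^sub>R h (0 + sqrt (2 * a) * y)) (sqrt (2 * pi) *\<^sub>R (of_real (exp (- (t\<^sup>2 / (4 * a)))) /\<^sub>R \<bar>sqrt (2 * a)\<bar>))"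
    by (rule has_bochner_integral_scaleR_right)
  moreover have "sqrt (2 * pi) *\<^sub>R h (0 + sqrt (2 * a) * y) = exp (\<i> * of_real (t * y)) * of_real (exp (- a * y\<^sup>2))" for y
    using assms by (simp add: h_def std_normal_density_def s_def scaleR_conv_of_real power_mult_distrib)
  moreover have "sqrt (2 * pi) *\<^sub>R (complex_of_real (exp (- (t\<^sup>2 / (4 * a)))) /\<^sub>R \<bar>sqrt (2 * a)\<bar>) = of_real (sqrt (pi / a) * exp (- t\<^sup>2 / (4 * a)))"
    using assms by (simp add: scaleR_conv_of_real real_sqrt_mult real_sqrt_divide field_simps)
  ultimately show ?thesis by simp
qed

lemma has_bochner_integral_gaussian:
  assumes "a > 0"
  shows "has_bochner_integral lborel (\<lambda>y. exp (- a * (y - m)\<^sup>2)) (sqrt (pi / a))"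
proof -
  have "has_bochner_integral lborel (\<lambda>y. Re (exp (\<i> * of_real (0 * y)) * of_real (exp (- a * y\<^sup>2)))) (Re (of_real (sqrt (pi / a) * exp (- 0\<^sup>2 / (4 * a)))))"
    by (rule has_bochner_integral_Re[OF has_bochner_integral_gaussian_fourier[OF assms]])
  then have "has_bochner_integral lborel (\<lambda>y. exp (- a * y\<^sup>2)) (sqrt (pi / a))" by simp
  then have "has_bochner_integral lborel (\<lambda>y. exp (- a * (-m + 1 * y)\<^sup>2)) (sqrt (pi / a) /\<^sub>R \<bar>1\<bar>)"
    by (subst (asm) lborel_has_bochner_integral_real_affine_iff[where c=1 and t="-m"]) auto
  then show ?thesis by simp
qed

lemma cnj_measurable [measurable]: "cnj \<in> borel_measurable borel"
  by (intro borel_measurable_continuous_onI continuous_intros)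

lemma L2_product_integrable:
  fixes f g :: "real \<Rightarrow> complex"
  assumes [measurable]: "f \<in> borel_measurable borel" "g \<in> borel_measurable borel"
    and f: "integrable lborel (\<lambda>x. (cmod (f x))\<^sup>2)" and g: "integrable lborel (\<lambda>x. (cmod (g x))\<^sup>2)"
  shows "integrable lborel (\<lambda>x. f x * g x)"
proof (rule Bochner_Integration.integrable_bound)
  show "integrable lborel (\<lambda>x. (cmod (f x))\<^sup>2 + (cmod (g x))\<^sup>2)" using f g by simp
  show "AE x in lborel. norm (f x * g x) \<le> norm ((cmod (f x))\<^sup>2 + (cmod (g x))\<^sup>2)"
  proof (intro AE_I2)
    fix x
    have "2 * (cmod (f x) * cmod (g x)) \<le> (cmod (f x))\<^sup>2 + (cmod (g x))\<^sup>2"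
      using sum_squares_bound[of "cmod (f x)" "cmod (g x)"] by simp
    moreover have "0 \<le> cmod (f x) * cmod (g x)" by simp
    ultimately have "cmod (f x) * cmod (g x) \<le> (cmod (f x))\<^sup>2 + (cmod (g x))\<^sup>2" by linarith
    then show "norm (f x * g x) \<le> norm ((cmod (f x))\<^sup>2 + (cmod (g x))\<^sup>2)"
      by (simp add: norm_mult)
  qed
qed measurable

text \<open>The exact defect in Cauchy-Schwarz, used for the inequality as well as for its equality
  case. Working with G f - V g instead of f - (V / G) g avoids division by G.\<close>

lemma L2_defect:
  fixes f g :: "real \<Rightarrow> complex"
  assumes [measurable]: "f \<in> borel_measurable borel" "g \<in> borel_measurable borel"
    and f: "integrable lborel (\<lambda>x. (cmod (f x))\<^sup>2)" and g: "integrable lborel (\<lambda>x. (cmod (g x))\<^sup>2)"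
  defines "F \<equiv> \<integral>x. (cmod (f x))\<^sup>2 \<partial>lborel" and "G \<equiv> \<integral>x. (cmod (g x))\<^sup>2 \<partial>lborel"
    and "V \<equiv> \<integral>x. f x * cnj (g x) \<partial>lborel"
  shows "has_bochner_integral lborel (\<lambda>x. (cmod (of_real G * f x - V * g x))\<^sup>2) (G * (G * F - (cmod V)\<^sup>2))"
proof -
  have fg: "integrable lborel (\<lambda>x. f x * cnj (g x))" by (rule L2_product_integrable) (use f g in auto)
  have eq: "(cmod (of_real G * f x - V * g x))\<^sup>2 = G\<^sup>2 * (cmod (f x))\<^sup>2 - 2 * G * Re (cnj V * (f x * cnj (g x))) + (cmod V)\<^sup>2 * (cmod (g x))\<^sup>2" for x
    unfolding cmod_power2 by (simp add: algebra_simps power2_eq_square)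
  have 1: "has_bochner_integral lborel (\<lambda>x. G\<^sup>2 * (cmod (f x))\<^sup>2) (G\<^sup>2 * F)"
    unfolding F_def using f by (intro has_bochner_integral_mult_right has_bochner_integral_integrable)
  have 2: "has_bochner_integral lborel (\<lambda>x. 2 * G * Re (cnj V * (f x * cnj (g x)))) (2 * G * Re (cnj V * V))"
    unfolding V_def using fg by (intro has_bochner_integral_mult_right has_bochner_integral_Re has_bochner_integral_integrable)
  have 3: "has_bochner_integral lborel (\<lambda>x. (cmod V)\<^sup>2 * (cmod (g x))\<^sup>2) ((cmod V)\<^sup>2 * G)"
    unfolding G_def using g by (intro has_bochner_integral_mult_right has_bochner_integral_integrable)
  have "Re (cnj V * V) = (cmod V)\<^sup>2" unfolding cmod_power2 by (simp add: power2_eq_square)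
  then have "G\<^sup>2 * F - 2 * G * Re (cnj V * V) + (cmod V)\<^sup>2 * G = G * (G * F - (cmod V)\<^sup>2)"
    by (simp add: algebra_simps power2_eq_square)
  then show ?thesis
    unfolding eq using has_bochner_integral_add[OF has_bochner_integral_diff[OF 1 2] 3] by simp
qed

lemma L2_Cauchy_Schwarz:
  fixes f g :: "real \<Rightarrow> complex"
  assumes [measurable]: "f \<in> borel_measurable borel" "g \<in> borel_measurable borel"
    and f: "integrable lborel (\<lambda>x. (cmod (f x))\<^sup>2)" and g: "integrable lborel (\<lambda>x. (cmod (g x))\<^sup>2)"
  shows "(cmod (\<integral>x. f x * cnj (g x) \<partial>lborel))\<^sup>2 \<le> (\<integral>x. (cmod (f x))\<^sup>2 \<partial>lborel) * (\<integral>x. (cmod (g x))\<^sup>2 \<partial>lborel)"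
proof -
  define G where "G = (\<integral>x. (cmod (g x))\<^sup>2 \<partial>lborel)"
  have "G \<ge> 0" by (simp add: G_def)
  then consider "G = 0" | "G > 0" by linarith
  then show ?thesis
  proof cases
    \<comment> \<open>The defect identity carries no information for G = 0; instead g = 0 almost
      everywhere.\<close>
    case 1
    then have "AE x in lborel. (cmod (g x))\<^sup>2 = 0"
      unfolding G_def using g by (subst (asm) integral_nonneg_eq_0_iff_AE) auto
    then have "AE x in lborel. f x * cnj (g x) = 0" by eventually_elim simp
    then have "(\<integral>x. f x * cnj (g x) \<partial>lborel) = 0" by (rule integral_eq_zero_AE)
    then show ?thesis by simp
  next
    case 2
    have "0 \<le> G * (G * (\<integral>x. (cmod (f x))\<^sup>2 \<partial>lborel) - (cmod (\<integral>x. f x * cnj (g x) \<partial>lborel))\<^sup>2)"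
      unfolding G_def has_bochner_integral_integral_eq[OF L2_defect[OF assms], symmetric] by simp
    then show ?thesis using 2 by (simp add: zero_le_mult_iff G_def[symmetric] mult.commute)
  qed
qed

text \<open>The time-frequency shift of the window: both the analysing function behind
  \<open>STFT\<close> and the expected extremiser.\<close>

definition wave_packet :: "real \<Rightarrow> real \<Rightarrow> real \<Rightarrow> complex" where
  "wave_packet x \<omega> y = exp (2 * complex_of_real pi * \<i> * complex_of_real y * complex_of_real \<omega>) * complex_of_real (gauss_window (y - x))"

lemma gauss_window_measurable [measurable]: "gauss_window \<in> borel_measurable borel"
  unfolding gauss_window_def by measurable

lemma wave_packet_measurable [measurable]: "wave_packet x \<omega> \<in> borel_measurable borel"
  unfolding wave_packet_def
  by (rule borel_measurable_times) (intro borel_measurable_continuous_onI continuous_intros, measurable)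

lemma gauss_window_minus: "gauss_window (x - y) = gauss_window (y - x)"
  by (simp add: gauss_window_def power2_commute)

lemma gauss_window_square: "(gauss_window x)\<^sup>2 = sqrt 2 * exp (- 2 * pi * x\<^sup>2)"
proof -
  have "(2 powr (1/4))\<^sup>2 = (sqrt 2 :: real)" by (simp add: powr_half_sqrt[symmetric] powr_powr flip: powr_numeral)
  moreover have "(exp (- pi * x\<^sup>2))\<^sup>2 = exp (- 2 * pi * x\<^sup>2)" by (simp flip: exp_double)
  ultimately show ?thesis by (simp add: gauss_window_def power_mult_distrib)
qed

lemma cmod_wave_packet: "cmod (wave_packet x \<omega> y) = gauss_window (y - x)"
  by (simp add: wave_packet_def norm_mult gauss_window_def)

lemma has_bochner_integral_wave_packet: "has_bochner_integral lborel (\<lambda>y. (cmod (wave_packet x \<omega> y))\<^sup>2) 1"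
proof -
  have "has_bochner_integral lborel (\<lambda>y. sqrt 2 * exp (- (2 * pi) * (y - x)\<^sup>2)) (sqrt 2 * sqrt (pi / (2 * pi)))"
    by (intro has_bochner_integral_mult_right has_bochner_integral_gaussian) simp
  then show ?thesis by (simp add: cmod_wave_packet gauss_window_square real_sqrt_divide)
qed

text \<open>Evenness of the window turns the transform into an inner product; for Borel f the
  integral may be taken over \<open>lborel\<close>, where the product measure arguments
  live.\<close>

lemma STFT_eq_inner:
  assumes [measurable]: "f \<in> borel_measurable borel"
  shows "STFT f x \<omega> = (\<integral>y. f y * cnj (wave_packet x \<omega> y) \<partial>lborel)"
proof -
  have "STFT f x \<omega> = (LINT y|lebesgue. f y * cnj (wave_packet x \<omega> y))"
    unfolding STFT_def wave_packet_def
    by (intro Bochner_Integration.integral_cong refl) (simp add: exp_cnj gauss_window_minus[of x] mult_ac)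
  also have "\<dots> = (\<integral>y. f y * cnj (wave_packet x \<omega> y) \<partial>lborel)"
    by (rule integral_completion) measurable
  finally show ?thesis .
qed

text \<open>The product of two shifted Gaussians is a Gaussian centred at the midpoint m, so only
  the Fourier transform of a Gaussian remains. Its modulus depends on the phase-space distance
  alone.\<close>

lemma STFT_wave_packet:
  "STFT (wave_packet x' \<omega>') x \<omega> = exp (- \<i> * of_real (pi * (x + x') * (\<omega> - \<omega>'))) * of_real (exp (- pi * ((x - x')\<^sup>2 + (\<omega> - \<omega>')\<^sup>2) / 2))"
proof -
  define t where "t = - 2 * pi * (\<omega> - \<omega>')"
  define m where "m = (x + x') / 2"
  define h where "h y = exp (\<i> * of_real (t * y)) * complex_of_real (exp (- (2 * pi) * y\<^sup>2))" for y
  have "has_bochner_integral lborel h (of_real (sqrt (pi / (2 * pi)) * exp (- t\<^sup>2 / (4 * (2 * pi)))))"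
    unfolding h_def by (rule has_bochner_integral_gaussian_fourier) simp
  then have h: "has_bochner_integral lborel (\<lambda>y. h (- m + 1 * y)) (of_real (sqrt (pi / (2 * pi)) * exp (- t\<^sup>2 / (4 * (2 * pi)))))"
    by (subst (asm) lborel_has_bochner_integral_real_affine_iff[where c=1 and t="-m"]) auto
  define C where "C = exp (\<i> * of_real (t * m)) * complex_of_real (sqrt 2 * exp (- pi * (x - x')\<^sup>2 / 2))"
  have "wave_packet x' \<omega>' y * cnj (wave_packet x \<omega> y) = C * h (- m + 1 * y)" for y
  proof -
    have g: "gauss_window (y - x') * gauss_window (y - x) = sqrt 2 * exp (- pi * (x - x')\<^sup>2 / 2) * exp (- (2 * pi) * (y - m)\<^sup>2)"
    proof -
      have "(2 powr (1/4)) * (2 powr (1/4)) = (sqrt 2 :: real)" by (simp add: powr_half_sqrt[symmetric] flip: powr_add)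
      moreover have "- pi * (y - x')\<^sup>2 + - pi * (y - x)\<^sup>2 = - pi * (x - x')\<^sup>2 / 2 + - (2 * pi) * (y - m)\<^sup>2"
        by (simp add: m_def power2_eq_square field_simps)
      ultimately have "exp (- pi * (y - x')\<^sup>2) * exp (- pi * (y - x)\<^sup>2) = exp (- pi * (x - x')\<^sup>2 / 2) * exp (- (2 * pi) * (y - m)\<^sup>2)"
        and "(2 powr (1/4)) * (2 powr (1/4)) = (sqrt 2 :: real)"
        by (simp_all only: exp_add[symmetric])
      moreover have "gauss_window (y - x') * gauss_window (y - x) = ((2 powr (1/4)) * (2 powr (1/4))) * (exp (- pi * (y - x')\<^sup>2) * exp (- pi * (y - x)\<^sup>2))"
        by (simp add: gauss_window_def)
      ultimately show ?thesis by simp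
    qed
    have e: "exp (2 * complex_of_real pi * \<i> * y * \<omega>') * cnj (exp (2 * complex_of_real pi * \<i> * y * \<omega>)) = exp (\<i> * of_real (t * m)) * exp (\<i> * of_real (t * (- m + 1 * y)))"
      by (simp add: exp_cnj t_def algebra_simps flip: exp_add)
    have "wave_packet x' \<omega>' y * cnj (wave_packet x \<omega> y) = 
      (exp (2 * complex_of_real pi * \<i> * y * \<omega>') * cnj (exp (2 * complex_of_real pi * \<i> * y * \<omega>))) * of_real (gauss_window (y - x') * gauss_window (y - x))"
      by (simp add: wave_packet_def)
    also have "\<dots> = C * h (- m + 1 * y)"
      unfolding e g by (simp add: C_def h_def)
    finally show ?thesis .
  qed
  then have "STFT (wave_packet x' \<omega>') x \<omega> = C * of_real (sqrt (pi / (2 * pi)) * exp (- t\<^sup>2 / (4 * (2 * pi))))"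
    using h by (simp add: STFT_eq_inner has_bochner_integral_iff)
  also have "\<dots> = exp (\<i> * of_real (t * m)) * of_real (exp (- pi * (x - x')\<^sup>2 / 2) * exp (- t\<^sup>2 / (4 * (2 * pi))))"
    by (simp add: C_def real_sqrt_divide)
  also have "exp (- pi * (x - x')\<^sup>2 / 2) * exp (- t\<^sup>2 / (4 * (2 * pi))) = exp (- pi * ((x - x')\<^sup>2 + (\<omega> - \<omega>')\<^sup>2) / 2)"
    by (simp add: t_def power2_eq_square field_simps flip: exp_add)
  also have "\<i> * of_real (t * m) = - \<i> * of_real (pi * (x + x') * (\<omega> - \<omega>'))"
    by (simp add: t_def m_def)
  finally show ?thesis .
qed

lemma L2_wave_packet: "integrable lborel (\<lambda>y. (cmod (wave_packet x \<omega> y))\<^sup>2)"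
  and L2_wave_packet_1: "(\<integral>y. (cmod (wave_packet x \<omega> y))\<^sup>2 \<partial>lborel) = 1"
  using has_bochner_integral_wave_packet by (auto simp: has_bochner_integral_iff)

text \<open>The phase \<open>E\<close> makes the inner product of the two wave packets positive.\<close>

lemma STFT_increment:
  assumes [measurable]: "f \<in> borel_measurable borel" and f: "integrable lborel (\<lambda>x. (cmod (f x))\<^sup>2)"
  shows "cmod (STFT f x \<omega>) \<le> cmod (STFT f x' \<omega>') + sqrt ((\<integral>x. (cmod (f x))\<^sup>2 \<partial>lborel) * (2 - 2 * exp (- pi * ((x - x')\<^sup>2 + (\<omega> - \<omega>')\<^sup>2) / 2)))"
proof -
  define \<rho> where "\<rho> = exp (- pi * ((x - x')\<^sup>2 + (\<omega> - \<omega>')\<^sup>2) / 2)"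
  define E where "E = exp (- \<i> * of_real (pi * (x + x') * (\<omega> - \<omega>')))"
  have E1: "cmod E = 1" by (simp add: E_def)
  have EE: "cnj E * E = 1" using E1 by (metis complex_norm_square mult.commute of_real_1 one_power2)
  let ?w = "wave_packet x \<omega>" and ?w' = "wave_packet x' \<omega>'"
  \<comment> \<open>Difference of the two packets after aligning phases: the aligned inner product
    is \<rho>, so its squared norm is 2 - 2 \<rho>.\<close>
  define g where "g y = ?w y - cnj E * ?w' y" for y
  have [measurable]: "g \<in> borel_measurable borel" unfolding g_def by measurable
  have ww: "integrable lborel (\<lambda>y. ?w' y * cnj (?w y))"
    by (rule L2_product_integrable) (auto simp: L2_wave_packet)
  have I: "(\<integral>y. ?w' y * cnj (?w y) \<partial>lborel) = E * of_real \<rho>"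
    using STFT_wave_packet[of x' \<omega>' x \<omega>] by (simp add: STFT_eq_inner E_def \<rho>_def)
  have eq: "(cmod (g y))\<^sup>2 = (cmod (?w y))\<^sup>2 + (cmod (?w' y))\<^sup>2 - 2 * Re (cnj E * (?w' y * cnj (?w y)))" for y
  proof -
    have "(cmod (a - b))\<^sup>2 = (cmod a)\<^sup>2 + (cmod b)\<^sup>2 - 2 * Re (b * cnj a)" for a b
      unfolding cmod_power2 by (simp add: power2_eq_square algebra_simps)
    from this[of "?w y" "cnj E * ?w' y"] show ?thesis by (simp add: g_def norm_mult E1 mult.assoc)
  qed
  have "has_bochner_integral lborel (\<lambda>y. (cmod (g y))\<^sup>2) (1 + 1 - 2 * Re (cnj E * (E * of_real \<rho>)))"
    unfolding eq using ww
    by (intro has_bochner_integral_diff has_bochner_integral_add has_bochner_integral_wave_packet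
        has_bochner_integral_mult_right has_bochner_integral_Re) (simp add: has_bochner_integral_iff I)
  also have "1 + 1 - 2 * Re (cnj E * (E * of_real \<rho>)) = 2 - 2 * \<rho>"
    using EE by (simp flip: mult.assoc)
  finally have g: "integrable lborel (\<lambda>y. (cmod (g y))\<^sup>2)" "(\<integral>y. (cmod (g y))\<^sup>2 \<partial>lborel) = 2 - 2 * \<rho>"
    by (auto simp: has_bochner_integral_iff)
  have fw: "integrable lborel (\<lambda>y. f y * cnj (wave_packet x \<omega> y))" for x \<omega>
    by (rule L2_product_integrable) (auto simp: L2_wave_packet f)
  have "(\<integral>y. f y * cnj (g y) \<partial>lborel) = (\<integral>y. f y * cnj (?w y) - E * (f y * cnj (?w' y)) \<partial>lborel)"
    by (intro Bochner_Integration.integral_cong refl) (simp add: g_def algebra_simps)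
  also have "\<dots> = STFT f x \<omega> - E * STFT f x' \<omega>'"
    using fw by (simp add: STFT_eq_inner)
  finally have "(cmod (STFT f x \<omega> - E * STFT f x' \<omega>'))\<^sup>2 \<le> (\<integral>x. (cmod (f x))\<^sup>2 \<partial>lborel) * (2 - 2 * \<rho>)"
    using L2_Cauchy_Schwarz[of f g] f g by simp
  then have "cmod (STFT f x \<omega> - E * STFT f x' \<omega>') \<le> sqrt ((\<integral>x. (cmod (f x))\<^sup>2 \<partial>lborel) * (2 - 2 * \<rho>))"
    by (rule real_le_rsqrt)
  moreover have "cmod (STFT f x \<omega>) \<le> cmod (E * STFT f x' \<omega>') + cmod (STFT f x \<omega> - E * STFT f x' \<omega>')"
    by (metis add.commute diff_add_cancel norm_triangle_ineq)
  ultimately show ?thesis unfolding \<rho>_def[symmetric] by (simp add: norm_mult E1)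
qed

section \<open>The Bessel inequality for the transform\<close>

lemma integrable_tensor:
  fixes a :: "'a::euclidean_space \<Rightarrow> complex" and b :: "'b::euclidean_space \<Rightarrow> complex"
  assumes a: "integrable lborel a" and b: "integrable lborel b"
  shows "integrable (lborel \<Otimes>\<^sub>M lborel) (\<lambda>(x, y). a x * b y)"
proof (rule lborel_pair.Fubini_integrable)
  have [measurable]: "a \<in> borel_measurable borel" "b \<in> borel_measurable borel" using a b by auto
  show "(\<lambda>(x, y). a x * b y) \<in> borel_measurable (lborel \<Otimes>\<^sub>M lborel)" by measurable
  show "integrable lborel (\<lambda>x. \<integral>y. norm (case (x, y) of (x, y) \<Rightarrow> a x * b y) \<partial>lborel)"
    using a by (simp add: norm_mult)
  show "AE x in lborel. integrable lborel (\<lambda>y. case (x, y) of (x, y) \<Rightarrow> a x * b y)"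
    using b by simp
qed

text \<open>One half of Plancherel. The Gaussian weight makes the integral over (\<omega>, y, y')
  absolutely convergent; integrating \<omega> first leaves a kernel K(y' - y) of total mass 1, and
  |g(y) g(y')| is at most the mean of the two squares.\<close>

lemma fourier_gaussian_weight_le:
  fixes g :: "real \<Rightarrow> complex"
  assumes g: "integrable lborel g" and g2: "integrable lborel (\<lambda>y. (cmod (g y))\<^sup>2)" and \<epsilon>: "\<epsilon> > 0"
  defines "G \<equiv> \<lambda>\<omega>. \<integral>y. g y * exp (- 2 * complex_of_real pi * \<i> * of_real y * of_real \<omega>) \<partial>lborel"
  shows "(\<integral>\<^sup>+\<omega>. ennreal ((cmod (G \<omega>))\<^sup>2 * exp (- (pi * \<epsilon>\<^sup>2) * \<omega>\<^sup>2)) \<partial>lborel) \<le> ennreal (\<integral>y. (cmod (g y))\<^sup>2 \<partial>lborel)"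
proof -
  have [measurable]: "g \<in> borel_measurable borel" using g by simp
  define w where "w \<omega> = exp (- (pi * \<epsilon>\<^sup>2) * \<omega>\<^sup>2)" for \<omega> :: real
  define K where "K s = exp (- (pi / \<epsilon>\<^sup>2) * s\<^sup>2) / \<epsilon>" for s :: real
  define e where "e y \<omega> = exp (- 2 * complex_of_real pi * \<i> * of_real y * of_real \<omega>)" for y \<omega>
  have e1: "cmod (e y \<omega>) = 1" for y \<omega> by (simp add: e_def)
  have em[measurable]: "(\<lambda>(y, \<omega>). e y \<omega>) \<in> borel_measurable (borel \<Otimes>\<^sub>M borel)"
    unfolding borel_prod e_def by (intro borel_measurable_continuous_onI) (auto intro!: continuous_intros simp: split_beta')
  have ee: "e y \<omega> * cnj (e y' \<omega>) = exp (\<i> * of_real ((2 * pi * (y' - y)) * \<omega>))" for y y' \<omega>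
    by (simp add: e_def exp_cnj algebra_simps flip: exp_add)
  have [measurable]: "w \<in> borel_measurable borel" "K \<in> borel_measurable borel" unfolding w_def K_def by measurable
  have wint: "integrable lborel w"
    using has_bochner_integral_gaussian[of "pi * \<epsilon>\<^sup>2" 0] \<epsilon> by (simp add: w_def[abs_def] has_bochner_integral_iff)
  have Kint: "has_bochner_integral lborel K 1"
    using has_bochner_integral_divide_zero[OF has_bochner_integral_gaussian[of "pi / \<epsilon>\<^sup>2" 0], of \<epsilon>] \<epsilon>
    by (simp add: K_def[abs_def] real_sqrt_divide)
  \<comment> \<open>A weight of width 1 / \<epsilon> in frequency becomes an approximate identity of
    width \<epsilon>, whose height 1 / \<epsilon> normalises its mass to 1.\<close>
  have wK: "(\<integral>\<omega>. e y \<omega> * cnj (e y' \<omega>) * of_real (w \<omega>) \<partial>lborel) = of_real (K (y' - y))" for y y'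
  proof -
    have "(\<integral>\<omega>. e y \<omega> * cnj (e y' \<omega>) * of_real (w \<omega>) \<partial>lborel) = of_real (sqrt (pi / (pi * \<epsilon>\<^sup>2)) * exp (- (2 * pi * (y' - y))\<^sup>2 / (4 * (pi * \<epsilon>\<^sup>2))))"
      using has_bochner_integral_gaussian_fourier[of "pi * \<epsilon>\<^sup>2" "2 * pi * (y' - y)"] \<epsilon> unfolding ee w_def has_bochner_integral_iff by simp
    also have "sqrt (pi / (pi * \<epsilon>\<^sup>2)) = 1 / \<epsilon>" using \<epsilon> by (simp add: real_sqrt_divide)
    also have "- (2 * pi * (y' - y))\<^sup>2 / (4 * (pi * \<epsilon>\<^sup>2)) = - (pi / \<epsilon>\<^sup>2) * (y' - y)\<^sup>2"
      using \<epsilon> by (simp add: power2_eq_square field_simps)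
    finally show ?thesis by (simp add: K_def)
  qed
  define T where "T \<omega> v = (g (fst v) * cnj (g (snd v))) * (e (fst v) \<omega> * cnj (e (snd v) \<omega>)) * of_real (w \<omega>)" for \<omega> and v :: "real \<times> real"
  have gg: "integrable lborel (\<lambda>v. g (fst v) * cnj (g (snd v)))"
    using integrable_tensor[OF g integrable_cnj[OF g]] by (simp add: lborel_prod split_beta')
  have "(\<lambda>(\<omega>, v). T \<omega> v) \<in> borel_measurable (borel \<Otimes>\<^sub>M (borel \<Otimes>\<^sub>M borel))"
    unfolding T_def by measurable
  then have [measurable]: "(\<lambda>(\<omega>, v). T \<omega> v) \<in> borel_measurable (lborel \<Otimes>\<^sub>M lborel)"
    by (simp add: borel_prod lborel_prod)
  have Tint: "integrable (lborel \<Otimes>\<^sub>M lborel) (\<lambda>(\<omega>, v). T \<omega> v)"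
  proof (rule Bochner_Integration.integrable_bound)
    show "integrable (lborel \<Otimes>\<^sub>M lborel) (\<lambda>(\<omega>, v). complex_of_real (w \<omega>) * (g (fst v) * cnj (g (snd v))))"
      using wint by (intro integrable_tensor gg) simp
    show "AE x in lborel \<Otimes>\<^sub>M lborel. norm (case x of (\<omega>, v) \<Rightarrow> T \<omega> v) \<le> norm (case x of (\<omega>, v) \<Rightarrow> complex_of_real (w \<omega>) * (g (fst v) * cnj (g (snd v))))"
      by (auto simp: T_def norm_mult e1)
  qed measurable
  have inner: "(\<integral>v. T \<omega> v \<partial>lborel) = of_real ((cmod (G \<omega>))\<^sup>2 * w \<omega>)" for \<omega>
  proof -
    have ge: "integrable lborel (\<lambda>y. g y * e y \<omega>)"
      by (rule Bochner_Integration.integrable_bound[OF g]) (auto simp: norm_mult e1)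
    have "integrable lborel (\<lambda>v. (g (fst v) * e (fst v) \<omega>) * cnj (g (snd v) * e (snd v) \<omega>))"
      using integrable_tensor[OF ge integrable_cnj[OF ge]] by (simp add: lborel_prod split_beta')
    then have "(\<integral>v. (g (fst v) * e (fst v) \<omega>) * cnj (g (snd v) * e (snd v) \<omega>) \<partial>lborel)
       = (\<integral>y. (\<integral>y'. (g y * e y \<omega>) * cnj (g y' * e y' \<omega>) \<partial>lborel) \<partial>lborel)"
      using lborel_pair.integral_fst'[of "\<lambda>v. (g (fst v) * e (fst v) \<omega>) * cnj (g (snd v) * e (snd v) \<omega>)"] by (simp add: lborel_prod)
    also have "\<dots> = G \<omega> * cnj (G \<omega>)"
      by (simp only: integral_mult_right_zero integral_mult_left_zero Bochner_Integration.integral_cnj G_def e_def)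
    also have "\<dots> = of_real ((cmod (G \<omega>))\<^sup>2)" by (simp only: complex_norm_square)
    finally have *: "(\<integral>v. (g (fst v) * e (fst v) \<omega>) * cnj (g (snd v) * e (snd v) \<omega>) \<partial>lborel) = of_real ((cmod (G \<omega>))\<^sup>2)" .
    have "(\<integral>v. T \<omega> v \<partial>lborel) = (\<integral>v. ((g (fst v) * e (fst v) \<omega>) * cnj (g (snd v) * e (snd v) \<omega>)) * of_real (w \<omega>) \<partial>lborel)"
      by (intro Bochner_Integration.integral_cong refl) (simp add: T_def)
    also have "\<dots> = of_real ((cmod (G \<omega>))\<^sup>2) * of_real (w \<omega>)"
      by (simp only: integral_mult_left_zero *)
    finally show ?thesis by simp
  qed
  have outer: "(\<integral>\<omega>. T \<omega> v \<partial>lborel) = g (fst v) * cnj (g (snd v)) * of_real (K (snd v - fst v))" for v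
    unfolding T_def using wK[of "fst v" "snd v"] by (simp add: mult.assoc)
  have I1: "integrable lborel (\<lambda>\<omega>. \<integral>v. T \<omega> v \<partial>lborel)" by (rule lborel_pair.integrable_fst[OF Tint])
  then have Iint: "integrable lborel (\<lambda>\<omega>. (cmod (G \<omega>))\<^sup>2 * w \<omega>)"
    unfolding inner by (simp only: complex_of_real_integrable_eq)
  have "of_real (\<integral>\<omega>. (cmod (G \<omega>))\<^sup>2 * w \<omega> \<partial>lborel) = (\<integral>\<omega>. (\<integral>v. T \<omega> v \<partial>lborel) \<partial>lborel)"
    unfolding inner by (simp only: integral_complex_of_real)
  also have "\<dots> = (\<integral>v. (\<integral>\<omega>. T \<omega> v \<partial>lborel) \<partial>lborel)"
    by (rule lborel_pair.Fubini_integral[OF Tint, symmetric])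
  finally have eq: "of_real (\<integral>\<omega>. (cmod (G \<omega>))\<^sup>2 * w \<omega> \<partial>lborel) = (\<integral>v. g (fst v) * cnj (g (snd v)) * of_real (K (snd v - fst v)) \<partial>lborel)"
    unfolding outer .
  have K0: "0 \<le> K s" for s using \<epsilon> by (simp add: K_def)
  have Kshift: "(\<integral>\<^sup>+y'. ennreal (K (y' - y)) \<partial>lborel) = 1" "(\<integral>\<^sup>+y. ennreal (K (y' - y)) \<partial>lborel) = 1" for y y'
  proof -
    have K1: "(\<integral>\<^sup>+s. ennreal (K s) \<partial>lborel) = 1"
      using Kint K0 by (subst nn_integral_eq_integral) (auto simp: has_bochner_integral_iff)
    show "(\<integral>\<^sup>+y'. ennreal (K (y' - y)) \<partial>lborel) = 1"
      using K1 by (subst (asm) nn_integral_real_affine[where c=1 and t="-y"]) auto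
    show "(\<integral>\<^sup>+y. ennreal (K (y' - y)) \<partial>lborel) = 1"
      using K1 by (subst (asm) nn_integral_real_affine[where c="-1" and t="y'"]) auto
  qed
  have nn: "(\<integral>\<^sup>+v. ennreal ((cmod (g (fst v)))\<^sup>2 * K (snd v - fst v)) \<partial>lborel) = ennreal (\<integral>y. (cmod (g y))\<^sup>2 \<partial>lborel)"
    "(\<integral>\<^sup>+v. ennreal ((cmod (g (snd v)))\<^sup>2 * K (snd v - fst v)) \<partial>lborel) = ennreal (\<integral>y. (cmod (g y))\<^sup>2 \<partial>lborel)"
  proof -
    have e: "(\<integral>\<^sup>+y. ennreal ((cmod (g y))\<^sup>2) \<partial>lborel) = ennreal (\<integral>y. (cmod (g y))\<^sup>2 \<partial>lborel)"
      using g2 by (intro nn_integral_eq_integral) auto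
    have "(\<integral>\<^sup>+v. ennreal ((cmod (g (fst v)))\<^sup>2 * K (snd v - fst v)) \<partial>(lborel \<Otimes>\<^sub>M lborel)) = (\<integral>\<^sup>+y. \<integral>\<^sup>+y'. ennreal ((cmod (g y))\<^sup>2) * ennreal (K (y' - y)) \<partial>lborel \<partial>lborel)"
      by (subst lborel.nn_integral_fst[symmetric]) (auto simp: ennreal_mult K0)
    also have "\<dots> = ennreal (\<integral>y. (cmod (g y))\<^sup>2 \<partial>lborel)"
      by (simp add: nn_integral_cmult Kshift e)
    finally show "(\<integral>\<^sup>+v. ennreal ((cmod (g (fst v)))\<^sup>2 * K (snd v - fst v)) \<partial>lborel) = ennreal (\<integral>y. (cmod (g y))\<^sup>2 \<partial>lborel)"
      by (simp add: lborel_prod)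
    have "(\<integral>\<^sup>+v. ennreal ((cmod (g (snd v)))\<^sup>2 * K (snd v - fst v)) \<partial>(lborel \<Otimes>\<^sub>M lborel)) = (\<integral>\<^sup>+y'. \<integral>\<^sup>+y. ennreal ((cmod (g y'))\<^sup>2) * ennreal (K (y' - y)) \<partial>lborel \<partial>lborel)"
      by (subst lborel_pair.nn_integral_snd[symmetric]) (auto simp: ennreal_mult K0)
    also have "\<dots> = ennreal (\<integral>y. (cmod (g y))\<^sup>2 \<partial>lborel)"
      by (simp add: nn_integral_cmult Kshift e)
    finally show "(\<integral>\<^sup>+v. ennreal ((cmod (g (snd v)))\<^sup>2 * K (snd v - fst v)) \<partial>lborel) = ennreal (\<integral>y. (cmod (g y))\<^sup>2 \<partial>lborel)"
      by (simp add: lborel_prod)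
  qed
  have mv[measurable]: "(\<lambda>v::real\<times>real. (cmod (g (fst v)))\<^sup>2 * K (snd v - fst v)) \<in> borel_measurable borel"
      "(\<lambda>v::real\<times>real. (cmod (g (snd v)))\<^sup>2 * K (snd v - fst v)) \<in> borel_measurable borel"
    unfolding borel_prod[symmetric] by measurable
  have hb: "has_bochner_integral lborel (\<lambda>v. (cmod (g (fst v)))\<^sup>2 * K (snd v - fst v)) (\<integral>y. (cmod (g y))\<^sup>2 \<partial>lborel)"
    "has_bochner_integral lborel (\<lambda>v. (cmod (g (snd v)))\<^sup>2 * K (snd v - fst v)) (\<integral>y. (cmod (g y))\<^sup>2 \<partial>lborel)"
    using nn K0 by (auto intro!: has_bochner_integral_nn_integral)
  have bound: "cmod (\<integral>v. g (fst v) * cnj (g (snd v)) * of_real (K (snd v - fst v)) \<partial>lborel) \<le>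
      (\<integral>v. ((cmod (g (fst v)))\<^sup>2 * K (snd v - fst v) + (cmod (g (snd v)))\<^sup>2 * K (snd v - fst v)) / 2 \<partial>lborel)"
  proof (rule order.trans[OF integral_norm_bound integral_mono'])
    show "integrable lborel (\<lambda>v. ((cmod (g (fst v)))\<^sup>2 * K (snd v - fst v) + (cmod (g (snd v)))\<^sup>2 * K (snd v - fst v)) / 2)"
      using hb by (auto simp: has_bochner_integral_iff)
    fix v :: "real \<times> real"
    have "2 * (cmod (g (fst v)) * cmod (g (snd v))) * K (snd v - fst v) \<le> ((cmod (g (fst v)))\<^sup>2 + (cmod (g (snd v)))\<^sup>2) * K (snd v - fst v)"
      using sum_squares_bound[of "cmod (g (fst v))" "cmod (g (snd v))"] K0 by (intro mult_right_mono) auto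
    then show "norm (g (fst v) * cnj (g (snd v)) * of_real (K (snd v - fst v))) \<le> ((cmod (g (fst v)))\<^sup>2 * K (snd v - fst v) + (cmod (g (snd v)))\<^sup>2 * K (snd v - fst v)) / 2"
      using K0[of "snd v - fst v"] by (simp add: norm_mult algebra_simps)
  qed (simp add: K0)
  have "(\<integral>\<omega>. (cmod (G \<omega>))\<^sup>2 * w \<omega> \<partial>lborel) \<le> cmod (of_real (\<integral>\<omega>. (cmod (G \<omega>))\<^sup>2 * w \<omega> \<partial>lborel))" by simp
  also have "\<dots> \<le> (\<integral>y. (cmod (g y))\<^sup>2 \<partial>lborel)"
    using bound hb unfolding eq by (simp add: has_bochner_integral_iff)
  finally have "(\<integral>\<omega>. (cmod (G \<omega>))\<^sup>2 * w \<omega> \<partial>lborel) \<le> (\<integral>y. (cmod (g y))\<^sup>2 \<partial>lborel)" .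
  moreover have "(\<integral>\<^sup>+\<omega>. ennreal ((cmod (G \<omega>))\<^sup>2 * w \<omega>) \<partial>lborel) = ennreal (\<integral>\<omega>. (cmod (G \<omega>))\<^sup>2 * w \<omega> \<partial>lborel)"
    by (intro nn_integral_eq_integral Iint) (simp add: w_def)
  ultimately show ?thesis unfolding w_def by (simp add: ennreal_leI)
qed

text \<open>Monotone convergence as the Gaussian weight increases to 1, along \<epsilon> = 1 / (n +
  1).\<close>

lemma fourier_bessel:
  fixes g :: "real \<Rightarrow> complex"
  assumes g: "integrable lborel g" and g2: "integrable lborel (\<lambda>y. (cmod (g y))\<^sup>2)"
  defines "G \<equiv> \<lambda>\<omega>. \<integral>y. g y * exp (- 2 * complex_of_real pi * \<i> * of_real y * of_real \<omega>) \<partial>lborel"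
  shows "(\<integral>\<^sup>+\<omega>. ennreal ((cmod (G \<omega>))\<^sup>2) \<partial>lborel) \<le> ennreal (\<integral>y. (cmod (g y))\<^sup>2 \<partial>lborel)"
proof -
  have [measurable]: "g \<in> borel_measurable borel" using g by simp
  have [measurable]: "(\<lambda>(\<omega>, y). exp (- 2 * complex_of_real pi * \<i> * of_real y * of_real \<omega>)) \<in> borel_measurable (borel \<Otimes>\<^sub>M borel)"
    unfolding borel_prod by (intro borel_measurable_continuous_onI) (auto intro!: continuous_intros simp: split_beta')
  have [measurable]: "G \<in> borel_measurable borel"
    unfolding G_def by measurable
  define F where "F n \<omega> = ennreal ((cmod (G \<omega>))\<^sup>2 * exp (- (pi * (1 / real (Suc n))\<^sup>2) * \<omega>\<^sup>2))" for n \<omega>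
  have "(\<lambda>n. \<integral>\<^sup>+\<omega>. F n \<omega> \<partial>lborel) \<longlonglongrightarrow> (\<integral>\<^sup>+\<omega>. ennreal ((cmod (G \<omega>))\<^sup>2) \<partial>lborel)"
  proof (rule nn_integral_LIMSEQ)
    show "incseq F"
    proof (rule incseq_SucI, rule le_funI)
      fix n \<omega>
      have "(1 / real (Suc (Suc n)))\<^sup>2 \<le> (1 / real (Suc n))\<^sup>2"
        by (intro power_mono divide_left_mono) auto
      then show "F n \<omega> \<le> F (Suc n) \<omega>" unfolding F_def
        by (intro ennreal_leI mult_left_mono) (auto intro!: mult_right_mono)
    qed
    show "F n \<in> borel_measurable lborel" for n unfolding F_def by measurable
    fix \<omega>
    have "(\<lambda>n. (cmod (G \<omega>))\<^sup>2 * exp (- (pi * (1 / real (Suc n))\<^sup>2) * \<omega>\<^sup>2)) \<longlonglongrightarrow> (cmod (G \<omega>))\<^sup>2 * exp (- (pi * 0\<^sup>2) * \<omega>\<^sup>2)"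
      by (intro tendsto_intros LIMSEQ_Suc[OF lim_const_over_n])
    then show "(\<lambda>n. F n \<omega>) \<longlonglongrightarrow> ennreal ((cmod (G \<omega>))\<^sup>2)"
      unfolding F_def by (intro tendsto_ennrealI) simp
  qed
  moreover have "(\<integral>\<^sup>+\<omega>. F n \<omega> \<partial>lborel) \<le> ennreal (\<integral>y. (cmod (g y))\<^sup>2 \<partial>lborel)" for n
    unfolding F_def G_def by (rule fourier_gaussian_weight_le[OF g g2]) simp
  ultimately show ?thesis by (blast intro: LIMSEQ_le_const2)
qed

text \<open>For fixed x the transform is the Fourier transform of f times the shifted window;
  Tonelli then integrates the squared window over x to 1 for each y.\<close>

lemma STFT_bessel:
  assumes [measurable]: "f \<in> borel_measurable borel" and f: "integrable lborel (\<lambda>x. (cmod (f x))\<^sup>2)"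
  shows "(\<integral>\<^sup>+x. \<integral>\<^sup>+\<omega>. ennreal ((cmod (STFT f x \<omega>))\<^sup>2) \<partial>lborel \<partial>lborel) \<le> ennreal (\<integral>y. (cmod (f y))\<^sup>2 \<partial>lborel)"
proof -
  have gauss: "has_bochner_integral lborel (\<lambda>x. (gauss_window (y - x))\<^sup>2) 1" for y
    using has_bochner_integral_wave_packet[of y 0] by (simp add: cmod_wave_packet gauss_window_minus[of y])
  have "(\<integral>\<^sup>+\<omega>. ennreal ((cmod (STFT f x \<omega>))\<^sup>2) \<partial>lborel) \<le> (\<integral>\<^sup>+y. ennreal ((cmod (f y))\<^sup>2) * ennreal ((gauss_window (y - x))\<^sup>2) \<partial>lborel)" for x
  proof -
    define g where "g y = f y * of_real (gauss_window (y - x))" for y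
    have [measurable]: "g \<in> borel_measurable borel" unfolding g_def by measurable
    have g: "integrable lborel g"
      unfolding g_def using has_bochner_integral_wave_packet[of x 0]
      by (intro L2_product_integrable f) (auto simp: cmod_wave_packet has_bochner_integral_iff)
    have gle: "(gauss_window y)\<^sup>2 \<le> sqrt 2" for y
      by (simp add: gauss_window_square)
    have g2eq: "(cmod (g y))\<^sup>2 = (cmod (f y))\<^sup>2 * (gauss_window (y - x))\<^sup>2" for y
      by (simp add: g_def norm_mult power_mult_distrib)
    have g2: "integrable lborel (\<lambda>y. (cmod (g y))\<^sup>2)"
      unfolding g2eq by (rule Bochner_Integration.integrable_bound[OF integrable_mult_left[OF f, of "sqrt 2"]])
        (auto intro!: mult_left_mono gle)
    have "STFT f x \<omega> = (\<integral>y. g y * exp (- 2 * complex_of_real pi * \<i> * of_real y * of_real \<omega>) \<partial>lborel)" for \<omega>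
      unfolding STFT_eq_inner[OF assms(1)] g_def wave_packet_def
      by (intro Bochner_Integration.integral_cong refl) (simp add: exp_cnj mult_ac)
    then have "(\<integral>\<^sup>+\<omega>. ennreal ((cmod (STFT f x \<omega>))\<^sup>2) \<partial>lborel) \<le> ennreal (\<integral>y. (cmod (g y))\<^sup>2 \<partial>lborel)"
      using fourier_bessel[OF g g2] by simp
    also have "\<dots> = (\<integral>\<^sup>+y. ennreal ((cmod (g y))\<^sup>2) \<partial>lborel)"
      using g2 by (intro nn_integral_eq_integral[symmetric]) auto
    finally show ?thesis by (simp add: g2eq ennreal_mult)
  qed
  then have "(\<integral>\<^sup>+x. \<integral>\<^sup>+\<omega>. ennreal ((cmod (STFT f x \<omega>))\<^sup>2) \<partial>lborel \<partial>lborel) \<le> (\<integral>\<^sup>+x. \<integral>\<^sup>+y. ennreal ((cmod (f y))\<^sup>2) * ennreal ((gauss_window (y - x))\<^sup>2) \<partial>lborel \<partial>lborel)"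
    by (rule nn_integral_mono)
  also have "\<dots> = (\<integral>\<^sup>+y. \<integral>\<^sup>+x. ennreal ((cmod (f y))\<^sup>2) * ennreal ((gauss_window (y - x))\<^sup>2) \<partial>lborel \<partial>lborel)"
    by (rule lborel_pair.Fubini') measurable
  also have "\<dots> = (\<integral>\<^sup>+y. ennreal ((cmod (f y))\<^sup>2) * 1 \<partial>lborel)"
  proof (intro nn_integral_cong)
    fix y
    have "(\<integral>\<^sup>+x. ennreal ((gauss_window (y - x))\<^sup>2) \<partial>lborel) = 1"
      using gauss[of y] by (subst nn_integral_eq_integral) (auto simp: has_bochner_integral_iff)
    then show "(\<integral>\<^sup>+x. ennreal ((cmod (f y))\<^sup>2) * ennreal ((gauss_window (y - x))\<^sup>2) \<partial>lborel) = ennreal ((cmod (f y))\<^sup>2) * 1"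
      by (subst nn_integral_cmult) auto
  qed
  also have "\<dots> = ennreal (\<integral>y. (cmod (f y))\<^sup>2 \<partial>lborel)"
    using f by (simp add: nn_integral_eq_integral)
  finally show ?thesis .
qed

section \<open>Holomorphy and the logarithmic Laplacian\<close>

text \<open>The increment is compared with its linear part through the Taylor remainder of exp,
  which is quadratic in the increment; the exponential moments of h absorb every other
  factor.\<close>

lemma laplace_transform_deriv:
  fixes h :: "real \<Rightarrow> complex"
  assumes [measurable]: "h \<in> borel_measurable borel"
    and h: "\<And>c. integrable lborel (\<lambda>y. cmod (h y) * exp (c * \<bar>y\<bar>))"
  shows "((\<lambda>\<zeta>. \<integral>y. h y * exp (of_real y * \<zeta>) \<partial>lborel) has_field_derivative (\<integral>y. h y * (of_real y * exp (of_real y * \<zeta>)) \<partial>lborel)) (at \<zeta>)"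
proof -
  define B where "B \<zeta> = (\<integral>y. h y * exp (of_real y * \<zeta>) \<partial>lborel)" for \<zeta>
  define D where "D = (\<integral>y. h y * (of_real y * exp (of_real y * \<zeta>)) \<partial>lborel)"
  have em[measurable]: "(\<lambda>y. exp (complex_of_real y * \<zeta>)) \<in> borel_measurable borel" for \<zeta>
    by (intro borel_measurable_continuous_onI continuous_intros)
  have norm_e: "cmod (exp (of_real y * \<zeta>)) \<le> exp (cmod \<zeta> * \<bar>y\<bar>)" for y \<zeta>
    using norm_exp[of "of_real y * \<zeta>"] by (simp add: norm_mult mult.commute)
  have le_exp: "\<bar>y\<bar> \<le> exp \<bar>y\<bar>" for y :: real using exp_ge_add_one_self[of "\<bar>y\<bar>"] by linarith
  have i0: "integrable lborel (\<lambda>y. h y * exp (of_real y * \<zeta>))" for \<zeta>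
    by (rule Bochner_Integration.integrable_bound[OF h[of "cmod \<zeta>"]])
       (auto simp: norm_mult simp del: norm_exp_eq_Re intro!: mult_left_mono norm_e)
  have i1: "integrable lborel (\<lambda>y. h y * (of_real y * exp (of_real y * \<zeta>)))"
  proof (rule Bochner_Integration.integrable_bound[OF h[of "cmod \<zeta> + 1"]])
    show "AE y in lborel. norm (h y * (of_real y * exp (of_real y * \<zeta>))) \<le> norm (cmod (h y) * exp ((cmod \<zeta> + 1) * \<bar>y\<bar>))"
    proof (intro AE_I2)
      fix y :: real
      have "\<bar>y\<bar> * cmod (exp (of_real y * \<zeta>)) \<le> exp \<bar>y\<bar> * exp (cmod \<zeta> * \<bar>y\<bar>)"
        by (intro mult_mono le_exp norm_e) auto
      also have "\<dots> = exp ((cmod \<zeta> + 1) * \<bar>y\<bar>)" by (simp add: algebra_simps flip: exp_add)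
      finally show "norm (h y * (of_real y * exp (of_real y * \<zeta>))) \<le> norm (cmod (h y) * exp ((cmod \<zeta> + 1) * \<bar>y\<bar>))"
        by (simp add: norm_mult mult_left_mono del: norm_exp_eq_Re)
    qed
  qed measurable
  \<comment> \<open>The 3 counts factors exp |y|: one from the Taylor remainder, as |\<eta>| \<le>
    1, and two from y^2 \<le> (exp |y|)^2.\<close>
  define K where "K = (\<integral>y. cmod (h y) * exp ((cmod \<zeta> + 3) * \<bar>y\<bar>) \<partial>lborel)"
  have step: "cmod (B (\<zeta> + \<eta>) - B \<zeta> - \<eta> * D) \<le> (cmod \<eta>)\<^sup>2 * K" if "cmod \<eta> \<le> 1" for \<eta>
  proof -
    have "B (\<zeta> + \<eta>) - B \<zeta> - \<eta> * D = (\<integral>y. h y * exp (of_real y * (\<zeta> + \<eta>)) - h y * exp (of_real y * \<zeta>) - \<eta> * (h y * (of_real y * exp (of_real y * \<zeta>))) \<partial>lborel)"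
      unfolding B_def D_def using i0 i1 by simp
    also have "cmod \<dots> \<le> (\<integral>y. (cmod \<eta>)\<^sup>2 * (cmod (h y) * exp ((cmod \<zeta> + 3) * \<bar>y\<bar>)) \<partial>lborel)"
    proof (rule order.trans[OF integral_norm_bound integral_mono'])
      show "integrable lborel (\<lambda>y. (cmod \<eta>)\<^sup>2 * (cmod (h y) * exp ((cmod \<zeta> + 3) * \<bar>y\<bar>)))"
        by (intro integrable_mult_right h)
      fix y :: real
      let ?w = "of_real y * \<eta>"
      have "exp ?w - (\<Sum>k\<le>1. ?w ^ k / fact k) = exp ?w - 1 - ?w" by (simp add: atMost_Suc)
      with Taylor_exp[of ?w 1] have "cmod (exp ?w - 1 - ?w) \<le> exp \<bar>Re ?w\<bar> * (cmod ?w)\<^sup>2" by (simp add: numeral_2_eq_2 diff_diff_eq)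
      also have "\<dots> \<le> exp \<bar>y\<bar> * ((cmod \<eta>)\<^sup>2 * (exp \<bar>y\<bar>)\<^sup>2)"
      proof (rule mult_mono)
        have "\<bar>y\<bar> * \<bar>Re \<eta>\<bar> \<le> \<bar>y\<bar> * 1"
          using abs_Re_le_cmod[of \<eta>] that by (intro mult_left_mono) auto
        then show "exp \<bar>Re ?w\<bar> \<le> exp \<bar>y\<bar>" by (simp add: abs_mult)
        have "\<bar>y\<bar>\<^sup>2 \<le> (exp \<bar>y\<bar>)\<^sup>2" by (intro power_mono le_exp) simp
        then have "(cmod \<eta>)\<^sup>2 * \<bar>y\<bar>\<^sup>2 \<le> (cmod \<eta>)\<^sup>2 * (exp \<bar>y\<bar>)\<^sup>2" by (intro mult_left_mono) auto
        then show "(cmod ?w)\<^sup>2 \<le> (cmod \<eta>)\<^sup>2 * (exp \<bar>y\<bar>)\<^sup>2"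
          by (simp add: norm_mult power_mult_distrib mult.commute)
      qed auto
      also have "\<dots> = (cmod \<eta>)\<^sup>2 * exp (3 * \<bar>y\<bar>)" by (simp add: power2_eq_square flip: exp_add)
      finally have 1: "cmod (exp ?w - 1 - ?w) \<le> (cmod \<eta>)\<^sup>2 * exp (3 * \<bar>y\<bar>)" .
      have "h y * exp (of_real y * (\<zeta> + \<eta>)) - h y * exp (of_real y * \<zeta>) - \<eta> * (h y * (of_real y * exp (of_real y * \<zeta>))) = h y * (exp (of_real y * \<zeta>) * (exp ?w - 1 - ?w))"
        by (simp add: exp_add algebra_simps)
      also have "cmod \<dots> \<le> cmod (h y) * (exp (cmod \<zeta> * \<bar>y\<bar>) * ((cmod \<eta>)\<^sup>2 * exp (3 * \<bar>y\<bar>)))"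
        unfolding norm_mult by (intro mult_left_mono mult_mono norm_e 1[unfolded norm_mult]) auto
      also have "\<dots> = (cmod \<eta>)\<^sup>2 * (cmod (h y) * exp ((cmod \<zeta> + 3) * \<bar>y\<bar>))" by (simp add: algebra_simps exp_add)
      finally show "norm (h y * exp (of_real y * (\<zeta> + \<eta>)) - h y * exp (of_real y * \<zeta>) - \<eta> * (h y * (of_real y * exp (of_real y * \<zeta>)))) \<le> (cmod \<eta>)\<^sup>2 * (cmod (h y) * exp ((cmod \<zeta> + 3) * \<bar>y\<bar>))" .
    qed simp
    also have "\<dots> = (cmod \<eta>)\<^sup>2 * K" by (simp add: K_def)
    finally show ?thesis .
  qed
  have "((\<lambda>\<eta>. (B (\<zeta> + \<eta>) - B \<zeta>) / \<eta> - D) \<longlongrightarrow> 0) (at 0)"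
  proof (rule Lim_null_comparison)
    have "\<forall>\<^sub>F \<eta> in at (0::complex). cmod \<eta> < 1 \<and> \<eta> \<noteq> 0"
      by (auto simp: eventually_at intro!: exI[of _ 1])
    then show "\<forall>\<^sub>F \<eta> in at 0. norm ((B (\<zeta> + \<eta>) - B \<zeta>) / \<eta> - D) \<le> cmod \<eta> * K"
    proof eventually_elim
      case (elim \<eta>)
      then have "(B (\<zeta> + \<eta>) - B \<zeta>) / \<eta> - D = (B (\<zeta> + \<eta>) - B \<zeta> - \<eta> * D) / \<eta>" by (simp add: field_simps)
      then show ?case using step[of \<eta>] elim by (simp add: norm_divide divide_simps power2_eq_square mult_ac)
    qed
    show "((\<lambda>\<eta>. cmod \<eta> * K) \<longlongrightarrow> 0) (at 0)" by (auto intro!: tendsto_eq_intros)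
  qed
  then show ?thesis unfolding DERIV_def B_def[symmetric] D_def[symmetric] by (rule LIM_zero_cancel)
qed

text \<open>In essence the Bargmann transform. Expanding (y - x)^2 splits off exp (-pi x^2), and the
  remaining exp (2 pi y x) joins the oscillation to form exp (2 pi y (x - i \<omega>)).\<close>

lemma STFT_entire:
  assumes [measurable]: "f \<in> borel_measurable borel" and f: "integrable lborel (\<lambda>x. (cmod (f x))\<^sup>2)"
  obtains B where "B holomorphic_on UNIV" "\<And>x \<omega>. STFT f x \<omega> = of_real (exp (- pi * x\<^sup>2)) * B (of_real x - \<i> * of_real \<omega>)"
proof -
  define h where "h y = f y * of_real (gauss_window y)" for y
  have [measurable]: "h \<in> borel_measurable borel" unfolding h_def by measurable
  have "integrable lborel (\<lambda>y. cmod (h y) * exp (c * \<bar>y\<bar>))" for c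
  proof -
    have "integrable lborel (\<lambda>y. f y * of_real (gauss_window y * exp (c * \<bar>y\<bar>)))"
    proof (rule L2_product_integrable)
      show "integrable lborel (\<lambda>y. (cmod (of_real (gauss_window y * exp (c * \<bar>y\<bar>))))\<^sup>2)"
      proof (rule Bochner_Integration.integrable_bound)
        show "integrable lborel (\<lambda>y. sqrt 2 * exp (c\<^sup>2 / pi) * exp (- pi * (y - 0)\<^sup>2))"
          using has_bochner_integral_gaussian[of pi 0] by (intro integrable_mult_right) (auto simp: has_bochner_integral_iff)
        show "AE y in lborel. norm ((cmod (of_real (gauss_window y * exp (c * \<bar>y\<bar>))))\<^sup>2) \<le> norm (sqrt 2 * exp (c\<^sup>2 / pi) * exp (- pi * (y - 0)\<^sup>2))"
        proof (intro AE_I2)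
          fix y :: real
          \<comment> \<open>Completing this square trades the factor exp (2 c |y|) for half of the
            Gaussian decay.\<close>
          have "0 \<le> (c - pi * \<bar>y\<bar>)\<^sup>2 / pi" by simp
          also have "\<dots> = c\<^sup>2 / pi - 2 * (c * \<bar>y\<bar>) + pi * y\<^sup>2"
            by (simp add: power2_diff power_mult_distrib field_simps) (simp add: power2_eq_square)
          finally have "- 2 * pi * y\<^sup>2 + 2 * (c * \<bar>y\<bar>) \<le> c\<^sup>2 / pi + - pi * y\<^sup>2" by simp
          then have "exp (- 2 * pi * y\<^sup>2) * exp (2 * (c * \<bar>y\<bar>)) \<le> exp (c\<^sup>2 / pi) * exp (- pi * y\<^sup>2)"
            by (simp flip: exp_add)
          moreover have "(exp (c * \<bar>y\<bar>))\<^sup>2 = exp (2 * (c * \<bar>y\<bar>))" by (simp flip: exp_double)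
          ultimately show "norm ((cmod (of_real (gauss_window y * exp (c * \<bar>y\<bar>))))\<^sup>2) \<le> norm (sqrt 2 * exp (c\<^sup>2 / pi) * exp (- pi * (y - 0)\<^sup>2))"
            by (simp add: power_mult_distrib gauss_window_square norm_mult)
        qed
      qed measurable
    qed (use f in auto)
    from integrable_norm[OF this] show ?thesis by (simp add: h_def norm_mult mult.assoc)
  qed
  note deriv = laplace_transform_deriv[OF \<open>h \<in> borel_measurable borel\<close> this]
  define B where "B \<zeta> = (\<integral>y. h y * exp (of_real y * (of_real (2 * pi) * \<zeta>)) \<partial>lborel)" for \<zeta>
  show thesis
  proof (rule that)
    have "\<exists>D. (B has_field_derivative D) (at \<zeta>)" for \<zeta>
      unfolding B_def using DERIV_chain2[OF deriv, of "\<lambda>\<zeta>. of_real (2 * pi) * \<zeta>" "of_real (2 * pi)" \<zeta> UNIV]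
      by (auto intro!: derivative_eq_intros)
    then show "B holomorphic_on UNIV" by (auto simp: holomorphic_on_def field_differentiable_def)
    fix x \<omega>
    have "f y * cnj (wave_packet x \<omega> y) = of_real (exp (- pi * x\<^sup>2)) * (h y * exp (of_real y * (of_real (2 * pi) * (of_real x - \<i> * of_real \<omega>))))" for y
    proof -
      have "- pi * (y - x)\<^sup>2 = - pi * x\<^sup>2 + - pi * y\<^sup>2 + 2 * pi * y * x" by (simp add: power2_eq_square algebra_simps)
      then have "gauss_window (y - x) = exp (- pi * x\<^sup>2) * gauss_window y * exp (2 * pi * y * x)"
        by (simp only: gauss_window_def exp_add) simp
      moreover have "exp (of_real y * (of_real (2 * pi) * (of_real x - \<i> * of_real \<omega>))) = of_real (exp (2 * pi * y * x)) * cnj (exp (2 * complex_of_real pi * \<i> * of_real y * of_real \<omega>))"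
        by (simp add: exp_cnj exp_of_real[symmetric] algebra_simps flip: exp_add)
      ultimately show ?thesis by (simp add: h_def wave_packet_def)
    qed
    then show "STFT f x \<omega> = of_real (exp (- pi * x\<^sup>2)) * B (of_real x - \<i> * of_real \<omega>)"
      by (simp add: STFT_eq_inner B_def)
  qed
qed

text \<open>Where B does not vanish, ln u is a constant minus 2 pi x^2 plus 2 Re (log B(x - i y)).
  The last term is harmonic, so only -4 pi survives. Its gradient is written as (2 Re Q, 2 Im Q)
  with Q = B' / B, which calls for no branch of the logarithm; the sign of Im Q reflects the
  conjugated variable x - i y.\<close>

lemma log_laplacian_entire:
  fixes K :: real
  assumes B: "B holomorphic_on UNIV" and K: "K > 0"
  defines "c \<equiv> \<lambda>z :: real \<times> real. complex_of_real (fst z) - \<i> * of_real (snd z)"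
  defines "u \<equiv> \<lambda>z. K * exp (- 2 * pi * (fst z)\<^sup>2) * (cmod (B (c z)))\<^sup>2"
  defines "Q \<equiv> \<lambda>\<zeta>. deriv B \<zeta> / B \<zeta>"
  assumes bnd: "\<And>t. t > 0 \<Longrightarrow> bounded {z. t \<le> u z}"
  shows "log_laplacian u (\<lambda>z. 2 * Re (Q (c z)) - 4 * pi * fst z) (\<lambda>z. 2 * Im (Q (c z)))
     (\<lambda>z. 2 * Re (deriv Q (c z)) - 4 * pi) (\<lambda>z. - 2 * Re (deriv Q (c z)))"
proof -
  define S where "S = {\<zeta>. B \<zeta> \<noteq> 0}"
  have Bc: "continuous_on UNIV B" using B by (rule holomorphic_on_imp_continuous_on)
  have B': "deriv B holomorphic_on UNIV" using B by (intro holomorphic_deriv) auto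
  have cc: "continuous_on X c" for X unfolding c_def by (intro continuous_intros)
  have oS: "open S" unfolding S_def using Bc by (intro open_Collect_neq) auto
  have Q: "Q holomorphic_on S" unfolding Q_def
    by (intro holomorphic_intros holomorphic_on_subset[OF B] holomorphic_on_subset[OF B']) (auto simp: S_def)
  have Q': "deriv Q holomorphic_on S" by (intro holomorphic_deriv Q oS)
  have upos: "u z > 0 \<longleftrightarrow> c z \<in> S" for z using K by (simp add: u_def S_def zero_less_mult_iff)
  have cQ: "continuous_on {z. u z > 0} (\<lambda>z. Q (c z))" "continuous_on {z. u z > 0} (\<lambda>z. deriv Q (c z))"
    using Q Q' by (auto intro!: continuous_on_compose2[OF holomorphic_on_imp_continuous_on cc] simp: upos)
  have Bm: "(\<lambda>z. B (c z)) \<in> borel_measurable borel" "(\<lambda>z. deriv B (c z)) \<in> borel_measurable borel"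
    using B B' by (auto intro!: borel_measurable_continuous_onI continuous_on_compose2[OF holomorphic_on_imp_continuous_on cc])
  have Qm[measurable]: "(\<lambda>z. Q (c z)) \<in> borel_measurable borel"
    unfolding Q_def using Bm by (intro borel_measurable_divide)
  have vx: "((\<lambda>x. Q (c (x, y))) has_vector_derivative deriv Q (c (x, y))) (at x)" 
    and vy: "((\<lambda>y. Q (c (x, y))) has_vector_derivative - \<i> * deriv Q (c (x, y))) (at y)" if "c (x, y) \<in> S" for x y
  proof -
    have d: "(Q has_field_derivative deriv Q (c (x, y))) (at (c (x, y)))"
      using Q oS that by (rule holomorphic_derivI)
    have "((\<lambda>x. c (x, y)) has_vector_derivative 1) (at x)" "((\<lambda>y. c (x, y)) has_vector_derivative - \<i>) (at y)"
      unfolding c_def by (auto intro!: derivative_eq_intros simp: has_vector_derivative_def scaleR_conv_of_real)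
    from this[THEN field_vector_diff_chain_at, OF d]
    show "((\<lambda>x. Q (c (x, y))) has_vector_derivative deriv Q (c (x, y))) (at x)" 
      "((\<lambda>y. Q (c (x, y))) has_vector_derivative - \<i> * deriv Q (c (x, y))) (at y)" by (simp_all add: o_def)
  qed
  show ?thesis
  proof
    show "continuous_on UNIV u" unfolding u_def
      by (intro continuous_intros continuous_on_compose2[OF Bc cc]) auto
    show "0 \<le> u z" for z using K by (simp add: u_def)
    show "bounded {z. t \<le> u z}" if "t > 0" for t using bnd that .
    show "(\<lambda>z. 2 * Re (Q (c z)) - 4 * pi * fst z) \<in> borel_measurable borel" "(\<lambda>z. 2 * Im (Q (c z))) \<in> borel_measurable borel"
      unfolding borel_prod[symmetric] by (measurable, simp add: borel_prod)+
    show "continuous_on {z. 0 < u z} (\<lambda>z. 2 * Re (Q (c z)) - 4 * pi * fst z)" "continuous_on {z. 0 < u z} (\<lambda>z. 2 * Im (Q (c z)))"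
      "continuous_on {z. 0 < u z} (\<lambda>z. 2 * Re (deriv Q (c z)) - 4 * pi)" "continuous_on {z. 0 < u z} (\<lambda>z. - 2 * Re (deriv Q (c z)))"
      by (intro continuous_intros cQ)+
    show "2 * Re (deriv Q (c z)) - 4 * pi + - 2 * Re (deriv Q (c z)) = - 4 * pi" for z by simp
    fix x y assume "u (x, y) > 0"
    then have z: "c (x, y) \<in> S" by (simp add: upos)
    have "((\<lambda>x. Re (Q (c (x, y)))) has_real_derivative Re (deriv Q (c (x, y)))) (at x)"
      using bounded_linear.has_vector_derivative[OF bounded_linear_Re vx[OF z]] by (simp add: has_real_derivative_iff_has_vector_derivative)
    then have "((\<lambda>x. 2 * Re (Q (c (x, y))) - 4 * pi * x) has_real_derivative 2 * Re (deriv Q (c (x, y))) - 4 * pi * 1) (at x)"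
      by (intro DERIV_diff DERIV_cmult DERIV_ident)
    then show "((\<lambda>x. 2 * Re (Q (c (x, y))) - 4 * pi * fst (x, y)) has_real_derivative 2 * Re (deriv Q (c (x, y))) - 4 * pi) (at x)"
      by simp
    have "((\<lambda>y. Im (Q (c (x, y)))) has_real_derivative - Re (deriv Q (c (x, y)))) (at y)"
      using bounded_linear.has_vector_derivative[OF bounded_linear_Im vy[OF z]] by (simp add: has_real_derivative_iff_has_vector_derivative)
    from DERIV_cmult[OF this, of 2]
    show "((\<lambda>y. 2 * Im (Q (c (x, y)))) has_real_derivative - 2 * Re (deriv Q (c (x, y)))) (at y)"
      by simp
  next
    fix z assume "u z > 0"
    then have z: "B (c z) \<noteq> 0" by (simp add: upos S_def)
    have "(c has_derivative c) (at z)"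
      unfolding c_def by (auto intro!: derivative_eq_intros)
    moreover have "(B has_derivative (\<lambda>h. deriv B (c z) * h)) (at (c z))"
      using holomorphic_derivI[OF B open_UNIV] by (simp add: has_field_derivative_def)
    ultimately have b: "((\<lambda>z. B (c z)) has_derivative (\<lambda>h. deriv B (c z) * c h)) (at z)"
      by (rule has_derivative_compose)
    \<comment> \<open>Since B' = Q B, the inner product is |B|^2 Re (Q c(h)), and c(h) = h1 - i h2
      pairs Re Q with h1 and Im Q with h2.\<close>
    have key: "B (c z) \<bullet> (deriv B (c z) * c h) = (cmod (B (c z)))\<^sup>2 * (Re (Q (c z)) * fst h + Im (Q (c z)) * snd h)" for h
    proof -
      have "deriv B (c z) = Q (c z) * B (c z)" using z by (simp add: Q_def)
      then have "B (c z) \<bullet> (deriv B (c z) * c h) = B (c z) \<bullet> (Q (c z) * B (c z) * c h)" by simp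
      also have "\<dots> = (cmod (B (c z)))\<^sup>2 * (Re (Q (c z)) * fst h + Im (Q (c z)) * snd h)"
        unfolding cmod_power2 by (simp add: inner_complex_def c_def power2_eq_square algebra_simps)
      finally show ?thesis .
    qed
    have "((\<lambda>z. K * exp (- 2 * pi * (fst z)\<^sup>2) * (B (c z) \<bullet> B (c z))) has_derivative
        (\<lambda>h. K * exp (- 2 * pi * (fst z)\<^sup>2) * (2 * (B (c z) \<bullet> (deriv B (c z) * c h)))
            - 4 * pi * fst z * fst h * (K * exp (- 2 * pi * (fst z)\<^sup>2) * (B (c z) \<bullet> B (c z))))) (at z)"
      by (rule derivative_eq_intros b refl)+ (auto simp: inner_commute algebra_simps)
    then show "(u has_derivative (\<lambda>h. u z * ((2 * Re (Q (c z)) - 4 * pi * fst z, 2 * Im (Q (c z))) \<bullet> h))) (at z)"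
      unfolding u_def power2_norm_eq_inner
      by (rule has_derivative_eq_rhs) (auto simp: key power2_norm_eq_inner[symmetric] inner_prod_def algebra_simps)
  qed
qed

section \<open>Concentration of the short-time Fourier transform\<close>

lemma nn_integral_exp_lessThan:
  "(\<integral>\<^sup>+c. ennreal (exp c) * indicator {..<M::real} c \<partial>lborel) = ennreal (exp M)"
proof -
  have "(\<integral>\<^sup>+c. ennreal (exp c) * indicator {..<M} c \<partial>lborel) = (\<integral>\<^sup>+c. ennreal (exp (- c)) * indicator {- M<..} c \<partial>lborel)"
    by (subst nn_integral_real_affine[where c="-1" and t=0]) (auto intro!: nn_integral_cong split: split_indicator)
  also have "\<dots> = (\<integral>\<^sup>+c. ennreal (exp (- c)) * indicator {- M..} c \<partial>lborel)"
    by (intro nn_integral_cong_AE, rule AE_mp[OF AE_lborel_singleton[of "- M"]]) (auto split: split_indicator)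
  also have "\<dots> = ennreal (0 - (- exp (- (- M))))"
  proof (rule nn_integral_FTC_atLeast)
    show "((\<lambda>x::real. - exp (- x)) \<longlongrightarrow> 0) at_top" by real_asymp
  qed (auto intro!: derivative_eq_intros)
  finally show ?thesis by simp
qed

lemma nn_integral_exp_segment_less:
  assumes "a > 0"
  shows "(\<integral>\<^sup>+c. ennreal (a * exp (a * c)) * indicator {c. L \<le> c \<and> c < M} c \<partial>lborel) = ennreal (exp (a * M) - exp (a * L))"
proof (cases "L \<le> M")
  case True
  have "(\<integral>\<^sup>+c. ennreal (a * exp (a * c)) * indicator {c. L \<le> c \<and> c < M} c \<partial>lborel) = (\<integral>\<^sup>+c. ennreal (a * exp (a * c)) * indicator {L..M} c \<partial>lborel)"
    by (intro nn_integral_cong_AE, rule AE_mp[OF AE_lborel_singleton[of M]]) (auto split: split_indicator)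
  also have "\<dots> = ennreal (exp (a * M) - exp (a * L))"
    by (rule nn_integral_FTC_Icc) (use assms True in \<open>auto intro!: derivative_eq_intros\<close>)
  finally show ?thesis .
next
  case False
  then have "{c. L \<le> c \<and> c < M} = {}" by auto
  moreover have "exp (a * M) - exp (a * L) \<le> 0" using False assms by simp
  ultimately show ?thesis by (simp add: ennreal_neg)
qed

lemma powr_eq_exp_ln: "u > 0 \<Longrightarrow> u powr a = exp (a * ln (u::real))"
  by (simp add: powr_def)

lemma exp_less_iff_less_ln: "u > 0 \<Longrightarrow> exp c < u \<longleftrightarrow> c < ln (u::real)"
  by (metis exp_less_cancel_iff exp_ln)

text \<open>Tonelli for u = integral of exp c over c < ln u; zeros of u belong to no superlevel
  set.\<close>

lemma nn_integral_superlevel_mass: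
  fixes u :: "real \<times> real \<Rightarrow> real"
  assumes [measurable]: "u \<in> borel_measurable borel" and u: "\<And>z. 0 \<le> u z"
  shows "(\<integral>\<^sup>+c. ennreal (exp c) * emeasure lborel {z. exp c < u z} \<partial>lborel) = (\<integral>\<^sup>+z. ennreal (u z) \<partial>lborel)"
proof -
  have "(\<integral>\<^sup>+c. ennreal (exp c) * emeasure lborel {z. exp c < u z} \<partial>lborel) = 
      (\<integral>\<^sup>+c. \<integral>\<^sup>+z. ennreal (exp c) * indicator {z. exp c < u z} z \<partial>lborel \<partial>lborel)"
    by (intro nn_integral_cong) (simp add: nn_integral_cmult)
  also have "\<dots> = (\<integral>\<^sup>+z. \<integral>\<^sup>+c. ennreal (exp c) * indicator {z. exp c < u z} z \<partial>lborel \<partial>lborel)"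
    by (rule lborel_pair.Fubini') (simp add: indicator_def)
  also have "\<dots> = (\<integral>\<^sup>+z. ennreal (u z) \<partial>lborel)"
  proof (rule nn_integral_cong)
    fix z
    show "(\<integral>\<^sup>+c. ennreal (exp c) * indicator {z. exp c < u z} z \<partial>lborel) = ennreal (u z)"
    proof (cases "u z > 0")
      case True
      then have "(\<integral>\<^sup>+c. ennreal (exp c) * indicator {z. exp c < u z} z \<partial>lborel) = (\<integral>\<^sup>+c. ennreal (exp c) * indicator {..<ln (u z)} c \<partial>lborel)"
        by (intro nn_integral_cong) (auto simp: exp_less_iff_less_ln split: split_indicator)
      then show ?thesis using True by (simp add: nn_integral_exp_lessThan)
    next
      case False
      then have "u z = 0" using u[of z] by simp
      then show ?thesis by (simp add: indicator_def not_less less_imp_le)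
    qed
  qed
  finally show ?thesis .
qed

text \<open>Keeping only the layers above L yields the positive part of u^a - exp (a L);
  \<open>ennreal\<close> supplies the truncation.\<close>

lemma nn_integral_superlevel_excess:
  fixes u :: "real \<times> real \<Rightarrow> real"
  assumes [measurable]: "u \<in> borel_measurable borel" and u: "\<And>z. 0 \<le> u z" and "a > 0"
  shows "(\<integral>\<^sup>+z. ennreal (u z powr a - exp (a * L)) \<partial>lborel) =
     (\<integral>\<^sup>+c. ennreal (a * exp (a * c)) * indicator {L..} c * emeasure lborel {z. exp c < u z} \<partial>lborel)"
proof -
  have "(\<integral>\<^sup>+c. ennreal (a * exp (a * c)) * indicator {L..} c * emeasure lborel {z. exp c < u z} \<partial>lborel) = 
      (\<integral>\<^sup>+c. \<integral>\<^sup>+z. ennreal (a * exp (a * c)) * indicator {L..} c * indicator {z. exp c < u z} z \<partial>lborel \<partial>lborel)"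
    by (intro nn_integral_cong) (simp add: nn_integral_cmult)
  also have "\<dots> = (\<integral>\<^sup>+z. \<integral>\<^sup>+c. ennreal (a * exp (a * c)) * indicator {L..} c * indicator {z. exp c < u z} z \<partial>lborel \<partial>lborel)"
    by (rule lborel_pair.Fubini') (simp add: indicator_def)
  also have "\<dots> = (\<integral>\<^sup>+z. ennreal (u z powr a - exp (a * L)) \<partial>lborel)"
  proof (rule nn_integral_cong)
    fix z
    show "(\<integral>\<^sup>+c. ennreal (a * exp (a * c)) * indicator {L..} c * indicator {z. exp c < u z} z \<partial>lborel) = ennreal (u z powr a - exp (a * L))"
    proof (cases "u z > 0")
      case True
      then have "(\<integral>\<^sup>+c. ennreal (a * exp (a * c)) * indicator {L..} c * indicator {z. exp c < u z} z \<partial>lborel) = (\<integral>\<^sup>+c. ennreal (a * exp (a * c)) * indicator {c. L \<le> c \<and> c < ln (u z)} c \<partial>lborel)"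
        by (intro nn_integral_cong) (auto simp: exp_less_iff_less_ln split: split_indicator)
      then show ?thesis using True \<open>a > 0\<close> by (simp add: nn_integral_exp_segment_less powr_eq_exp_ln)
    next
      case False
      then have "u z = 0" using u[of z] by simp
      then show ?thesis using \<open>a > 0\<close> by (simp add: indicator_def not_less less_imp_le ennreal_neg)
    qed
  qed
  finally show ?thesis ..
qed

lemma emeasure_ball_R2:
  "r \<ge> 0 \<Longrightarrow> emeasure lborel (ball (z :: real \<times> real) r) = ennreal (pi * r\<^sup>2)"
  by (subst emeasure_ball) (simp_all add: unit_ball_vol_2 power2_eq_square)

section \<open>The normalised spectrogram and its distribution function\<close>

locale L2_signal =
  fixes f :: "real \<Rightarrow> complex"
  assumes f_meas [measurable]: "f \<in> borel_measurable borel"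
    and f_L2: "integrable lborel (\<lambda>x. (cmod (f x))\<^sup>2)"
    and f_pos: "0 < (\<integral>x. (cmod (f x))\<^sup>2 \<partial>lborel)"
begin

definition energy :: real where "energy = (\<integral>x. (cmod (f x))\<^sup>2 \<partial>lborel)"

definition u :: "real \<times> real \<Rightarrow> real" where "u z = (cmod (STFT f (fst z) (snd z)))\<^sup>2 / energy"

definition \<mu> :: "real \<Rightarrow> real" where "\<mu> c = measure lborel {z. exp c < u z}"

lemma energy_pos: "energy > 0" using f_pos by (simp add: energy_def)

lemma u_nonneg: "0 \<le> u z" using energy_pos by (simp add: u_def)

lemma u_entire:
  obtains B where "B holomorphic_on UNIV"
    "u = (\<lambda>z. (1 / energy) * exp (- 2 * pi * (fst z)\<^sup>2) * (cmod (B (complex_of_real (fst z) - \<i> * of_real (snd z))))\<^sup>2)"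
proof -
  obtain B where B: "B holomorphic_on UNIV" "\<And>x \<omega>. STFT f x \<omega> = of_real (exp (- pi * x\<^sup>2)) * B (of_real x - \<i> * of_real \<omega>)"
    using STFT_entire[OF f_meas f_L2] by blast
  show thesis
  proof (rule that[OF B(1)], rule ext)
    fix z :: "real \<times> real"
    have "(exp (- pi * (fst z)\<^sup>2))\<^sup>2 = exp (- 2 * pi * (fst z)\<^sup>2)" by (simp flip: exp_double)
    then show "u z = (1 / energy) * exp (- 2 * pi * (fst z)\<^sup>2) * (cmod (B (complex_of_real (fst z) - \<i> * of_real (snd z))))\<^sup>2"
      by (simp add: u_def B(2) norm_mult power_mult_distrib)
  qed
qed

lemma u_cont: "continuous_on UNIV u"
proof -
  obtain B where B: "B holomorphic_on UNIV"
    "u = (\<lambda>z. (1 / energy) * exp (- 2 * pi * (fst z)\<^sup>2) * (cmod (B (complex_of_real (fst z) - \<i> * of_real (snd z))))\<^sup>2)"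
    by (rule u_entire)
  show ?thesis unfolding B(2)
    by (intro continuous_intros continuous_on_compose2[OF holomorphic_on_imp_continuous_on[OF B(1)]]) auto
qed

lemma u_meas [measurable]: "u \<in> borel_measurable borel"
  using u_cont by (rule borel_measurable_continuous_onI)

text \<open>The exact defect against a unit wave packet: nonnegativity gives u \<le> 1, and at a
  point with u = 1 it identifies f.\<close>

lemma cauchy_schwarz_defect:
  "has_bochner_integral lborel (\<lambda>y. (cmod (f y - STFT f x \<omega> * wave_packet x \<omega> y))\<^sup>2) (energy * (1 - u (x, \<omega>)))"
proof -
  have "energy * (1 - u (x, \<omega>)) = 1 * (1 * energy - (cmod (STFT f x \<omega>))\<^sup>2)"
    using energy_pos by (simp add: u_def field_simps)
  then show ?thesis
    using L2_defect[OF f_meas wave_packet_measurable f_L2 L2_wave_packet, of x \<omega>]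
    unfolding L2_wave_packet_1 by (simp add: STFT_eq_inner energy_def)
qed

lemma u_le_1: "u z \<le> 1"
proof -
  have "0 \<le> energy * (1 - u (fst z, snd z))"
    unfolding has_bochner_integral_integral_eq[OF cauchy_schwarz_defect, symmetric] by simp
  then show ?thesis using energy_pos by (simp add: zero_le_mult_iff)
qed

lemma u_eq_1D:
  assumes "u (x, \<omega>) = 1"
  shows "AE y in lborel. f y = STFT f x \<omega> * wave_packet x \<omega> y"
proof -
  have "has_bochner_integral lborel (\<lambda>y. (cmod (f y - STFT f x \<omega> * wave_packet x \<omega> y))\<^sup>2) 0"
    using cauchy_schwarz_defect[of x \<omega>] assms by simp
  then have "AE y in lborel. (cmod (f y - STFT f x \<omega> * wave_packet x \<omega> y))\<^sup>2 = 0"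
    by (subst integral_nonneg_eq_0_iff_AE[symmetric]) (auto simp: has_bochner_integral_iff)
  then show ?thesis by eventually_elim simp
qed

lemma nn_integral_u: "(\<integral>\<^sup>+z. ennreal (u z) \<partial>lborel) \<le> 1"
proof -
  have "(\<integral>\<^sup>+z. ennreal (u z) \<partial>lborel) = (\<integral>\<^sup>+x. \<integral>\<^sup>+\<omega>. ennreal (u (x, \<omega>)) \<partial>lborel \<partial>lborel)"
    by (subst lborel.nn_integral_fst) (simp_all add: lborel_prod)
  also have "\<dots> = (\<integral>\<^sup>+x. \<integral>\<^sup>+\<omega>. ennreal (1 / energy) * ennreal ((cmod (STFT f x \<omega>))\<^sup>2) \<partial>lborel \<partial>lborel)"
    using energy_pos by (intro nn_integral_cong) (simp add: u_def ennreal_mult[symmetric])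
  also have "\<dots> = ennreal (1 / energy) * (\<integral>\<^sup>+x. \<integral>\<^sup>+\<omega>. ennreal ((cmod (STFT f x \<omega>))\<^sup>2) \<partial>lborel \<partial>lborel)"
  proof -
    have "(\<lambda>(x, \<omega>). (cmod (STFT f x \<omega>))\<^sup>2) = (\<lambda>z. energy * u z)" using energy_pos by (auto simp: u_def)
    then have [measurable]: "(\<lambda>(x, \<omega>). (cmod (STFT f x \<omega>))\<^sup>2) \<in> borel_measurable (borel \<Otimes>\<^sub>M borel)"
      unfolding borel_prod by simp
    have [measurable]: "(\<lambda>(x, \<omega>). ennreal ((cmod (STFT f x \<omega>))\<^sup>2)) \<in> borel_measurable (borel \<Otimes>\<^sub>M borel)"
      using measurable_compose[OF \<open>(\<lambda>(x, \<omega>). (cmod (STFT f x \<omega>))\<^sup>2) \<in> borel_measurable (borel \<Otimes>\<^sub>M borel)\<close> measurable_ennreal]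
      by (simp add: split_beta')
    have [measurable]: "(\<lambda>\<omega>. ennreal ((cmod (STFT f x \<omega>))\<^sup>2)) \<in> borel_measurable borel" for x
      using measurable_Pair2[OF \<open>(\<lambda>(x, \<omega>). ennreal ((cmod (STFT f x \<omega>))\<^sup>2)) \<in> borel_measurable (borel \<Otimes>\<^sub>M borel)\<close>, of x] by simp
    show ?thesis by (simp add: nn_integral_cmult)
  qed
  also have "\<dots> \<le> ennreal (1 / energy) * ennreal energy"
    using STFT_bessel[OF f_meas f_L2] by (intro mult_left_mono) (auto simp: energy_def)
  also have "\<dots> = 1" using energy_pos by (simp add: ennreal_mult[symmetric])
  finally show ?thesis .
qed

text \<open>A Lipschitz bound for sqrt u whose constant does not depend on f: 1 - exp (-s) \<le> s
  applied to the overlap of two wave packets.\<close>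

lemma u_increment:
  assumes "dist z z' < \<delta>"
  shows "sqrt (u z) \<le> sqrt (u z') + sqrt pi * \<delta>"
proof -
  obtain x \<omega> x' \<omega>' where z: "z = (x, \<omega>)" "z' = (x', \<omega>')" by (cases z, cases z')
  define d where "d = (x - x')\<^sup>2 + (\<omega> - \<omega>')\<^sup>2"
  have d: "sqrt d = dist z z'" by (simp add: z dist_prod_def dist_real_def d_def)
  have "d \<le> \<delta>\<^sup>2" using assms unfolding d[symmetric] by (meson less_imp_le sqrt_le_D)
  then have "pi * d \<le> pi * \<delta>\<^sup>2" by (intro mult_left_mono) auto
  moreover have "1 - pi * d / 2 \<le> exp (- pi * d / 2)" using exp_ge_add_one_self[of "- pi * d / 2"] by simp
  moreover have "\<delta> > 0" using assms zero_le_dist[of z z'] by linarith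
  ultimately have le: "2 - 2 * exp (- pi * d / 2) \<le> pi * \<delta>\<^sup>2"
    by linarith
  have "cmod (STFT f x \<omega>) \<le> cmod (STFT f x' \<omega>') + sqrt (energy * (2 - 2 * exp (- pi * d / 2)))"
    unfolding energy_def d_def by (rule STFT_increment[OF f_meas f_L2])
  also have "\<dots> \<le> cmod (STFT f x' \<omega>') + sqrt (energy * (pi * \<delta>\<^sup>2))"
    using le energy_pos by (intro add_left_mono real_sqrt_le_mono mult_left_mono) auto
  finally have "cmod (STFT f x \<omega>) / sqrt energy \<le> (cmod (STFT f x' \<omega>') + sqrt (energy * (pi * \<delta>\<^sup>2))) / sqrt energy"
    using energy_pos by (intro divide_right_mono) auto
  then show ?thesis
    using energy_pos \<open>\<delta> > 0\<close> by (simp add: u_def z real_sqrt_divide real_sqrt_mult add_divide_distrib)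
qed

text \<open>Integrability plus uniform continuity forces decay: a value at least t at z keeps u
  above t / 4 on a disc of fixed radius around z, which far out would exceed the tail mass of
  u.\<close>

lemma u_bounded:
  assumes "t > 0"
  shows "bounded {z. t \<le> u z}"
proof -
  \<comment> \<open>Chosen so that the Lipschitz loss sqrt pi * \<delta> is half of sqrt t.\<close>
  define \<delta> where "\<delta> = sqrt t / (2 * sqrt pi)"
  have \<delta>: "\<delta> > 0" using assms by (simp add: \<delta>_def)
  have near: "t / 4 \<le> u z'" if "t \<le> u z" "dist z z' < \<delta>" for z z'
  proof -
    have "sqrt t \<le> sqrt (u z)" using that(1) by simp
    also have "\<dots> \<le> sqrt (u z') + sqrt pi * \<delta>" by (rule u_increment[OF that(2)])
    also have "sqrt pi * \<delta> = sqrt t / 2" by (simp add: \<delta>_def)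
    finally have "(sqrt t / 2)\<^sup>2 \<le> (sqrt (u z'))\<^sup>2" using assms by (intro power_mono) auto
    then show ?thesis using assms u_nonneg by (simp add: power_divide)
  qed
  have ui: "integrable lborel u"
  proof (rule integrableI_bounded)
    show "(\<integral>\<^sup>+z. ennreal (norm (u z)) \<partial>lborel) < \<infinity>"
      using nn_integral_u u_nonneg by (auto intro: le_less_trans)
  qed simp
  define T where "T n z = u z * indicator (- cball 0 (real n)) z" for n z
  have Ti: "integrable lborel (T n)" for n
    unfolding T_def by (rule Bochner_Integration.integrable_bound[OF ui]) (auto split: split_indicator)
  have "(\<lambda>n. \<integral>z. T n z \<partial>lborel) \<longlonglongrightarrow> (\<integral>z. 0 \<partial>(lborel :: (real \<times> real) measure))"
  proof (rule integral_dominated_convergence[where w=u])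
    show "AE z in lborel. (\<lambda>n. T n z) \<longlonglongrightarrow> 0"
    proof (intro AE_I2 tendsto_eventually)
      fix z :: "real \<times> real"
      obtain N where "norm z \<le> real N" using real_arch_simple by blast
      then show "\<forall>\<^sub>F n in sequentially. T n z = 0"
        unfolding eventually_sequentially by (intro exI[of _ N]) (auto simp: T_def)
    qed
    show "T n \<in> borel_measurable lborel" for n unfolding T_def by measurable
    show "AE z in lborel. norm (T n z) \<le> u z" for n
      using u_nonneg by (auto simp: T_def split: split_indicator)
  qed (use ui in auto)
  then have "\<forall>\<^sub>F n in sequentially. (\<integral>z. T n z \<partial>lborel) < t / 4 * (pi * \<delta>\<^sup>2)"
    using assms \<delta> by (intro order_tendstoD(2)[where y=0]) auto
  then obtain n where n: "(\<integral>z. T n z \<partial>lborel) < t / 4 * (pi * \<delta>\<^sup>2)"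
    by (auto simp: eventually_sequentially)
  have "norm z \<le> real n + \<delta>" if "t \<le> u z" for z
  proof (rule ccontr)
    assume far: "\<not> norm z \<le> real n + \<delta>"
    have out: "z' \<notin> cball 0 (real n)" if "z' \<in> ball z \<delta>" for z'
    proof -
      have "norm z \<le> norm z' + dist z z'" by (simp add: dist_norm norm_triangle_sub)
      then show ?thesis using that far by (auto simp: dist_norm)
    qed
    have "t / 4 * (pi * \<delta>\<^sup>2) = (\<integral>z'. t / 4 * indicator (ball z \<delta>) z' \<partial>lborel)"
      using \<delta> by (simp add: measure_def emeasure_ball_R2)
    also have "\<dots> \<le> (\<integral>z'. T n z' \<partial>lborel)"
    proof (rule integral_mono[OF _ Ti])
      show "integrable lborel (\<lambda>z'. t / 4 * indicator (ball z \<delta>) z')"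
        using \<delta> by (intro integrable_mult_right integrable_real_indicator) (auto simp: emeasure_ball_R2)
      show "t / 4 * indicator (ball z \<delta>) z' \<le> T n z'" for z'
        using out[of z'] near[OF that, of z'] u_nonneg[of z'] by (auto simp: T_def split: split_indicator)
    qed
    finally show False using n by simp
  qed
  then show ?thesis by (intro boundedI) auto
qed

lemma u_log_laplacian: "\<exists>p q p1 q2. log_laplacian u p q p1 q2"
proof -
  obtain B where B: "B holomorphic_on UNIV"
    "u = (\<lambda>z. (1 / energy) * exp (- 2 * pi * (fst z)\<^sup>2) * (cmod (B (complex_of_real (fst z) - \<i> * of_real (snd z))))\<^sup>2)"
    by (rule u_entire)
  note bounded = u_bounded[unfolded B(2)]
  have "1 / energy > 0" using energy_pos by simp
  from log_laplacian_entire[OF B(1) this bounded] show ?thesis unfolding B(2) by blast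
qed

lemma \<mu>_nonneg: "0 \<le> \<mu> c" by (simp add: \<mu>_def)

lemma \<mu>_emeasure: "emeasure lborel {z. exp c < u z} = ennreal (\<mu> c)"
proof -
  obtain p q p1 q2 where "log_laplacian u p q p1 q2" using u_log_laplacian by blast
  then interpret log_laplacian u p q p1 q2 .
  show ?thesis using finite_superlevel[of c] unfolding \<mu>_def by (intro emeasure_eq_ennreal_measure) auto
qed

lemma \<mu>_antimono: "c \<le> c' \<Longrightarrow> \<mu> c' \<le> \<mu> c"
  and \<mu>_slope: "c1 < c2 \<Longrightarrow> \<mu> c2 > 0 \<Longrightarrow> c2 - c1 \<le> \<mu> c1 - \<mu> c2"
proof -
  obtain p q p1 q2 where "log_laplacian u p q p1 q2" using u_log_laplacian by blast
  then interpret log_laplacian u p q p1 q2 .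
  have A: "A = \<mu>" by (auto simp: A_def \<mu>_def)
  show "c \<le> c' \<Longrightarrow> \<mu> c' \<le> \<mu> c" using A_antimono by (simp add: A)
  have "(b - a) * \<mu> b \<le> \<mu> a * (\<mu> a - \<mu> b)" if "a < b" for a b
  proof (rule field_le_epsilon)
    fix e :: real assume "e > 0"
    \<comment> \<open>Solves 2 \<epsilon> (\<mu> a + \<mu> b) + \<epsilon> = e, so the
      regularisation costs less than e; the summand 1 keeps the denominator positive.\<close>
    define \<epsilon> where "\<epsilon> = e / (2 * (\<mu> a + \<mu> b) + 1)"
    have D: "2 * (\<mu> a + \<mu> b) + 1 > 0" by (intro add_nonneg_pos mult_nonneg_nonneg add_nonneg_nonneg \<mu>_nonneg) auto
    have "\<epsilon> > 0" using \<open>e > 0\<close> D by (simp add: \<epsilon>_def)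
    have "\<epsilon> * (2 * (\<mu> a + \<mu> b) + 1) = e" using D by (simp add: \<epsilon>_def)
    then have "2 * \<epsilon> * \<mu> a + 2 * \<epsilon> * \<mu> b + \<epsilon> = e" by (simp add: algebra_simps)
    moreover have "(b - a) * \<mu> b - 2 * \<epsilon> * \<mu> b \<le> \<mu> a * (\<mu> a - \<mu> b) + 2 * \<epsilon> * \<mu> a"
      using level_inequality[OF that \<open>\<epsilon> > 0\<close>] by (simp add: A left_diff_distrib)
    ultimately show "(b - a) * \<mu> b \<le> \<mu> a * (\<mu> a - \<mu> b) + e" using \<open>\<epsilon> > 0\<close> by linarith
  qed
  then show "c1 < c2 \<Longrightarrow> \<mu> c2 > 0 \<Longrightarrow> c2 - c1 \<le> \<mu> c1 - \<mu> c2"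
    using A_antimono by (intro slope_by_subdivision) (auto simp: A)
qed

lemma \<mu>_mass: "(\<integral>\<^sup>+c. ennreal (exp c * \<mu> c) \<partial>lborel) \<le> 1"
proof -
  have "(\<integral>\<^sup>+c. ennreal (exp c * \<mu> c) \<partial>lborel) = (\<integral>\<^sup>+z. ennreal (u z) \<partial>lborel)"
    using nn_integral_superlevel_mass[OF u_meas u_nonneg] by (simp add: \<mu>_emeasure ennreal_mult \<mu>_nonneg)
  then show ?thesis using nn_integral_u by simp
qed

lemma \<mu>_zero: "c \<ge> 0 \<Longrightarrow> \<mu> c = 0"
proof -
  assume "c \<ge> 0"
  then have "{z. exp c < u z} = {}" using u_le_1 by (auto simp: not_less intro: order.trans[OF _ one_le_exp_iff[THEN iffD2]])
  then show ?thesis by (simp only: \<mu>_def measure_empty)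
qed

text \<open>The maximum of u over the compact set u \<ge> exp (-1) is attained and is global. If it
  were below 1, \<mu> would vanish at its logarithm, which is a negative level.\<close>

lemma \<mu>_pos_imp_peak:
  assumes "\<And>c. c < 0 \<Longrightarrow> \<mu> c \<noteq> 0"
  obtains z where "u z = 1"
proof -
  have ne: "\<exists>z. exp c < u z" if "c < 0" for c
  proof (rule ccontr)
    assume "\<nexists>z. exp c < u z"
    then have "{z. exp c < u z} = {}" by auto
    then have "\<mu> c = 0" by (simp only: \<mu>_def measure_empty)
    then show False using assms that by blast
  qed
  have "closed {z. exp (-1) \<le> u z}" using u_cont by (intro closed_Collect_le) auto
  then have "compact {z. exp (-1) \<le> u z}" using u_bounded[of "exp (-1)"] by (simp add: compact_eq_bounded_closed)
  moreover have "{z. exp (-1) \<le> u z} \<noteq> {}" using ne[of "-1"] by (auto intro: less_imp_le)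
  ultimately obtain z where z: "exp (-1) \<le> u z" "\<And>y. exp (-1) \<le> u y \<Longrightarrow> u y \<le> u z"
    using continuous_attains_sup[of "{z. exp (-1) \<le> u z}" u] u_cont by (auto intro: continuous_on_subset)
  have pos: "u z > 0" using z(1) exp_gt_zero[of "-1::real"] by linarith
  have "u z = 1"
  proof (rule ccontr)
    assume "u z \<noteq> 1"
    then have "u z < 1" using u_le_1[of z] by simp
    then have "ln (u z) < 0" using pos by simp
    from ne[OF this] obtain y where y: "u z < u y" using pos by auto
    then have "u y \<le> u z" using z by (intro z(2)) auto
    then show False using y by simp
  qed
  then show thesis by (rule that)
qed

section \<open>Bathtub comparison and the equality case\<close>

text \<open>Layer-cake form of the integral of the positive part of u^a - exp (a L); the levels stop
  at 0 because u \<le> 1.\<close>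

definition excess :: "real \<Rightarrow> real \<Rightarrow> real" where
  "excess a L = (\<integral>c. a * exp (a * c) * \<mu> c * indicator {L..0} c \<partial>lborel)"

lemma has_bochner_integral_excess:
  assumes "a \<ge> 1" "L < 0"
  shows "has_bochner_integral lborel (\<lambda>z. max 0 (u z powr a - exp (a * L))) (excess a L)"
proof (rule has_bochner_integral_nn_integral)
  note cr = crossing_comparison[OF \<mu>_nonneg \<mu>_antimono \<mu>_slope \<mu>_mass assms]
  have "(\<integral>\<^sup>+z. ennreal (max 0 (u z powr a - exp (a * L))) \<partial>lborel) = (\<integral>\<^sup>+c. ennreal (a * exp (a * c)) * indicator {L..} c * ennreal (\<mu> c) \<partial>lborel)"
    using nn_integral_superlevel_excess[OF u_meas u_nonneg, of a L] assms by (simp add: ennreal_max_0 \<mu>_emeasure)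
  also have "\<dots> = (\<integral>\<^sup>+c. ennreal (a * exp (a * c) * \<mu> c * indicator {L..0} c) \<partial>lborel)"
  proof (rule nn_integral_cong)
    fix c
    show "ennreal (a * exp (a * c)) * indicator {L..} c * ennreal (\<mu> c) = ennreal (a * exp (a * c) * \<mu> c * indicator {L..0} c)"
      using assms \<mu>_zero[of c] \<mu>_nonneg[of c] by (cases "c \<le> 0") (auto simp: ennreal_mult split: split_indicator)
  qed
  also have "\<dots> = ennreal (excess a L)"
    unfolding excess_def using cr(1) assms \<mu>_nonneg by (intro nn_integral_eq_integral) (auto intro!: AE_I2)
  finally show "(\<integral>\<^sup>+z. ennreal (max 0 (u z powr a - exp (a * L))) \<partial>lborel) = ennreal (excess a L)" .
  show "0 \<le> excess a L" unfolding excess_def using assms \<mu>_nonneg by (intro integral_nonneg_AE) auto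
qed auto

lemma excess_le:
  assumes "a \<ge> 1" "L < 0"
  shows "excess a L \<le> L * exp (a * L) + (1 - exp (a * L)) / a"
    and "excess a L = L * exp (a * L) + (1 - exp (a * L)) / a \<Longrightarrow> \<exists>z. u z = 1"
proof -
  note cr = crossing_comparison[OF \<mu>_nonneg \<mu>_antimono \<mu>_slope \<mu>_mass assms]
  show "excess a L \<le> L * exp (a * L) + (1 - exp (a * L)) / a" using cr(2) by (simp add: excess_def)
  assume "excess a L = L * exp (a * L) + (1 - exp (a * L)) / a"
  then have "\<not> (\<exists>c<0. \<mu> c = 0)" using cr(3) by (auto simp: excess_def)
  then show "\<exists>z. u z = 1" using \<mu>_pos_imp_peak by metis
qed

definition concentration :: "real \<Rightarrow> (real \<times> real) set \<Rightarrow> real" where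
  "concentration a \<Omega> = (\<integral>z. u z powr a * indicator \<Omega> z \<partial>lebesgue)"

text \<open>The loss in the bathtub principle when \<open>\<Omega>\<close> is compared with a superlevel set of \<open>u\<close>.\<close>

definition defect :: "real \<Rightarrow> real \<Rightarrow> (real \<times> real) set \<Rightarrow> real \<times> real \<Rightarrow> real" where
  "defect a m \<Omega> z = max 0 (u z powr a - exp (- a * m)) - (u z powr a - exp (- a * m)) * indicator \<Omega> z"

lemma defect_nonneg: "0 \<le> defect a m \<Omega> z"
  by (auto simp: defect_def split: split_indicator)

text \<open>The threshold exp (-a m) is dictated by the Gaussian, whose superlevel set at u = exp
  (-m) has area m, and not by the distribution of u. The superlevel set of u may thus differ from
  \<Omega> in measure, and the term exp (-a m) m accounts for this.\<close>

lemma has_bochner_integral_defect: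
  assumes \<Omega>: "\<Omega> \<in> lmeasurable" and m: "m = measure lebesgue \<Omega>" "m > 0" and a: "a \<ge> 1"
  shows "has_bochner_integral lebesgue (defect a m \<Omega>) (excess a (- m) + exp (- a * m) * m - concentration a \<Omega>)"
proof -
  have [measurable]: "\<Omega> \<in> sets lebesgue" using \<Omega> by (rule fmeasurableD)
  have um: "(\<lambda>z. u z powr a) \<in> borel_measurable lebesgue"
    by (rule measurable_completion) measurable
  have i1: "integrable lebesgue (indicator \<Omega> :: _ \<Rightarrow> real)"
    using \<Omega> by (simp add: integrable_real_indicator fmeasurable_def)
  have i2: "integrable lebesgue (\<lambda>z. u z powr a * indicator \<Omega> z)"
  proof (rule Bochner_Integration.integrable_bound[OF i1])
    show "AE z in lebesgue. norm (u z powr a * indicator \<Omega> z) \<le> norm (indicator \<Omega> z :: real)"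
      using a u_nonneg u_le_1 by (auto intro!: powr_le1 split: split_indicator)
  qed (use um in measurable)
  have "has_bochner_integral lborel (\<lambda>z. max 0 (u z powr a - exp (a * - m))) (excess a (- m))"
    using has_bochner_integral_excess[of a "- m"] m a by simp
  then have "has_bochner_integral lebesgue (\<lambda>z. max 0 (u z powr a - exp (- a * m))) (excess a (- m))"
    by (auto simp: has_bochner_integral_iff integrable_completion integral_completion)
  moreover have "has_bochner_integral lebesgue (\<lambda>z. u z powr a * indicator \<Omega> z - exp (- a * m) * indicator \<Omega> z) (concentration a \<Omega> - exp (- a * m) * m)"
    using i1 i2 \<Omega> unfolding concentration_def m(1)
    by (intro has_bochner_integral_diff has_bochner_integral_mult_right) (auto simp: has_bochner_integral_iff)
  ultimately have "has_bochner_integral lebesgue (\<lambda>z. max 0 (u z powr a - exp (- a * m)) - (u z powr a * indicator \<Omega> z - exp (- a * m) * indicator \<Omega> z))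
     (excess a (- m) - (concentration a \<Omega> - exp (- a * m) * m))"
    by (rule has_bochner_integral_diff)
  then show ?thesis by (simp add: defect_def[abs_def] algebra_simps)
qed

text \<open>Two nonnegative losses separate the sides: the shortfall of the excess against its
  Gaussian value, and the integral of \<open>defect\<close>. Equality holds exactly when both
  vanish.\<close>

lemma concentration_le:
  assumes \<Omega>: "\<Omega> \<in> lmeasurable" and m: "m = measure lebesgue \<Omega>" "m > 0" and a: "a \<ge> 1"
  shows "concentration a \<Omega> \<le> (1 - exp (- a * m)) / a"
    and "concentration a \<Omega> = (1 - exp (- a * m)) / a \<longleftrightarrow>
       excess a (- m) = - m * exp (- a * m) + (1 - exp (- a * m)) / a \<and> (AE z in lebesgue. defect a m \<Omega> z = 0)"
proof -
  define d where "d = excess a (- m) + exp (- a * m) * m - concentration a \<Omega>"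
  have hb: "has_bochner_integral lebesgue (defect a m \<Omega>) d"
    unfolding d_def by (rule has_bochner_integral_defect[OF assms])
  have d0: "0 \<le> d"
    unfolding has_bochner_integral_integral_eq[OF hb, symmetric] by (intro integral_nonneg_AE AE_I2 defect_nonneg)
  have ex: "excess a (- m) \<le> - m * exp (- a * m) + (1 - exp (- a * m)) / a"
    using excess_le(1)[OF a, of "- m"] m by simp
  have eq: "(AE z in lebesgue. defect a m \<Omega> z = 0) \<longleftrightarrow> d = 0"
    using hb defect_nonneg by (subst integral_nonneg_eq_0_iff_AE[symmetric]) (auto simp: has_bochner_integral_iff)
  have c: "concentration a \<Omega> = excess a (- m) + m * exp (- a * m) - d" by (simp add: d_def)
  show "concentration a \<Omega> \<le> (1 - exp (- a * m)) / a" using d0 ex c by linarith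
  show "concentration a \<Omega> = (1 - exp (- a * m)) / a \<longleftrightarrow>
       excess a (- m) = - m * exp (- a * m) + (1 - exp (- a * m)) / a \<and> (AE z in lebesgue. defect a m \<Omega> z = 0)"
    unfolding eq using d0 ex c by linarith
qed

lemma u_gaussian:
  assumes "AE y in lborel. f y = c * wave_packet x\<^sub>0 \<omega>\<^sub>0 y"
  shows "c \<noteq> 0" "u z = exp (- pi * (dist z (x\<^sub>0, \<omega>\<^sub>0))\<^sup>2)"
proof -
  have "energy = (\<integral>y. (cmod c)\<^sup>2 * (cmod (wave_packet x\<^sub>0 \<omega>\<^sub>0 y))\<^sup>2 \<partial>lborel)"
    unfolding energy_def
    by (rule integral_cong_AE) (use assms in \<open>auto elim!: eventually_mono simp: norm_mult power_mult_distrib\<close>)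
  then have e: "energy = (cmod c)\<^sup>2" by (simp add: L2_wave_packet_1)
  then show c: "c \<noteq> 0" using energy_pos by auto
  have "STFT f x \<omega> = (\<integral>y. c * (wave_packet x\<^sub>0 \<omega>\<^sub>0 y * cnj (wave_packet x \<omega> y)) \<partial>lborel)" for x \<omega>
    unfolding STFT_eq_inner[OF f_meas]
    by (rule integral_cong_AE) (use assms in \<open>auto elim!: eventually_mono\<close>)
  then have S: "STFT f x \<omega> = c * STFT (wave_packet x\<^sub>0 \<omega>\<^sub>0) x \<omega>" for x \<omega>
    by (simp add: STFT_eq_inner)
  have "cmod (STFT (wave_packet x\<^sub>0 \<omega>\<^sub>0) x \<omega>) = exp (- pi * ((x - x\<^sub>0)\<^sup>2 + (\<omega> - \<omega>\<^sub>0)\<^sup>2) / 2)" for x \<omega>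
    unfolding STFT_wave_packet by (simp add: norm_mult)
  then have "(cmod (STFT (wave_packet x\<^sub>0 \<omega>\<^sub>0) x \<omega>))\<^sup>2 = exp (- pi * ((x - x\<^sub>0)\<^sup>2 + (\<omega> - \<omega>\<^sub>0)\<^sup>2))" for x \<omega>
    by (simp flip: exp_double)
  then show "u z = exp (- pi * (dist z (x\<^sub>0, \<omega>\<^sub>0))\<^sup>2)"
    using c by (simp add: u_def S e norm_mult power_mult_distrib dist_prod_def dist_real_def)
qed

text \<open>For the extremiser the superlevel sets are discs of area -t, so \<mu> coincides with the
  comparison function on levels t \<le> 0.\<close>

lemma excess_gaussian:
  assumes "AE y in lborel. f y = c * wave_packet x\<^sub>0 \<omega>\<^sub>0 y" "a \<ge> 1" "L < 0"
  shows "excess a L = L * exp (a * L) + (1 - exp (a * L)) / a"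
proof -
  have \<mu>: "\<mu> t = - t" if "t \<le> 0" for t
  proof -
    have "exp t < u z \<longleftrightarrow> dist (x\<^sub>0, \<omega>\<^sub>0) z < sqrt (- t / pi)" for z
    proof -
      have "exp t < u z \<longleftrightarrow> pi * (dist z (x\<^sub>0, \<omega>\<^sub>0))\<^sup>2 < - t"
        unfolding u_gaussian(2)[OF assms(1)] by (simp add: less_minus_iff)
      also have "\<dots> \<longleftrightarrow> (dist z (x\<^sub>0, \<omega>\<^sub>0))\<^sup>2 < - t / pi" by (simp add: field_simps)
      also have "\<dots> \<longleftrightarrow> dist z (x\<^sub>0, \<omega>\<^sub>0) < sqrt (- t / pi)"
        using real_sqrt_less_iff[of "(dist z (x\<^sub>0, \<omega>\<^sub>0))\<^sup>2" "- t / pi"] by simp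
      finally show ?thesis by (simp add: dist_commute)
    qed
    then have "{z. exp t < u z} = ball (x\<^sub>0, \<omega>\<^sub>0) (sqrt (- t / pi))" by auto
    then show ?thesis using that by (simp add: \<mu>_def measure_def emeasure_ball_R2 divide_nonpos_nonneg)
  qed
  have "excess a L = (\<integral>c. a * exp (a * c) * (- c) * indicator {L..0} c \<partial>lborel)"
    unfolding excess_def by (intro Bochner_Integration.integral_cong refl) (auto simp: \<mu> split: split_indicator)
  also have "\<dots> = L * exp (a * L) + (1 - exp (a * L)) / a"
    using has_bochner_integral_exp_segment[of a L] assms by (simp add: has_bochner_integral_iff)
  finally show ?thesis .
qed

text \<open>The defect is |u^a - exp (-a m)| on the symmetric difference of \<Omega> and the
  superlevel set, and 0 elsewhere. For the Gaussian the superlevel set is the ball and the level set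
  a circle, hence null.\<close>

lemma defect_gaussian:
  assumes f: "AE y in lborel. f y = c * wave_packet x\<^sub>0 \<omega>\<^sub>0 y" and a: "a \<ge> 1" and m: "m = pi * r\<^sup>2" "r > 0"
    and \<Omega>: "\<Omega> \<in> sets lebesgue"
  shows "(AE z in lebesgue. defect a m \<Omega> z = 0) \<longleftrightarrow> sym_diff \<Omega> (ball (x\<^sub>0, \<omega>\<^sub>0) r) \<in> null_sets lebesgue"
proof -
  have pw: "u z powr a = exp (- a * pi * (dist z (x\<^sub>0, \<omega>\<^sub>0))\<^sup>2)" for z
    unfolding u_gaussian(2)[OF f] by (simp add: powr_def)
  have lt: "exp (- a * m) < u z powr a \<longleftrightarrow> z \<in> ball (x\<^sub>0, \<omega>\<^sub>0) r" for z
  proof -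
    have "exp (- a * m) < u z powr a \<longleftrightarrow> (a * pi) * (dist z (x\<^sub>0, \<omega>\<^sub>0))\<^sup>2 < (a * pi) * r\<^sup>2"
      unfolding pw m(1) by (simp add: mult.assoc)
    also have "\<dots> \<longleftrightarrow> (dist z (x\<^sub>0, \<omega>\<^sub>0))\<^sup>2 < r\<^sup>2" using a by simp
    also have "\<dots> \<longleftrightarrow> dist z (x\<^sub>0, \<omega>\<^sub>0) < r" using m(2) real_sqrt_less_iff[of "(dist z (x\<^sub>0, \<omega>\<^sub>0))\<^sup>2" "r\<^sup>2"] by simp
    finally show ?thesis by (simp add: dist_commute)
  qed
  have eq: "exp (- a * m) = u z powr a \<longleftrightarrow> z \<in> sphere (x\<^sub>0, \<omega>\<^sub>0) r" for z
  proof -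
    have "exp (- a * m) = u z powr a \<longleftrightarrow> (a * pi) * (dist z (x\<^sub>0, \<omega>\<^sub>0))\<^sup>2 = (a * pi) * r\<^sup>2"
      unfolding pw m(1) by (auto simp: mult.assoc)
    also have "\<dots> \<longleftrightarrow> (dist z (x\<^sub>0, \<omega>\<^sub>0))\<^sup>2 = r\<^sup>2" using a by simp
    also have "\<dots> \<longleftrightarrow> dist z (x\<^sub>0, \<omega>\<^sub>0) = r" using m(2) by (simp add: power2_eq_iff_nonneg)
    finally show ?thesis by (simp add: dist_commute)
  qed
  have "sphere (x\<^sub>0, \<omega>\<^sub>0) r \<in> null_sets lebesgue"
    using negligible_sphere negligible_iff_null_sets by blast
  then have "AE z in lebesgue. z \<notin> sphere (x\<^sub>0, \<omega>\<^sub>0) r" by (rule AE_not_in)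
  then have "AE z in lebesgue. defect a m \<Omega> z = 0 \<longleftrightarrow> z \<notin> sym_diff \<Omega> (ball (x\<^sub>0, \<omega>\<^sub>0) r)"
  proof eventually_elim
    case (elim z)
    then have "exp (- a * m) \<noteq> u z powr a" using eq by simp
    then show ?case
      using lt[of z] unfolding defect_def by (cases "z \<in> \<Omega>"; cases "z \<in> ball (x\<^sub>0, \<omega>\<^sub>0) r") (auto simp: max_def)
  qed
  then have "(AE z in lebesgue. defect a m \<Omega> z = 0) \<longleftrightarrow> (AE z in lebesgue. z \<notin> sym_diff \<Omega> (ball (x\<^sub>0, \<omega>\<^sub>0) r))"
    by (rule eventually_subst)
  also have "\<dots> \<longleftrightarrow> sym_diff \<Omega> (ball (x\<^sub>0, \<omega>\<^sub>0) r) \<in> null_sets lebesgue"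
    using \<Omega> by (intro AE_iff_null_sets[symmetric] sets.Un sets.Diff) auto
  finally show ?thesis .
qed

lemma concentration_eq_iff:
  assumes \<Omega>: "\<Omega> \<in> lmeasurable" and m: "m = measure lebesgue \<Omega>" "m > 0" and a: "a \<ge> 1"
  shows "concentration a \<Omega> = (1 - exp (- a * m)) / a \<longleftrightarrow>
     (\<exists>x\<^sub>0 \<omega>\<^sub>0. (\<exists>r>0. sym_diff \<Omega> (ball (x\<^sub>0, \<omega>\<^sub>0) r) \<in> null_sets lebesgue) \<and>
        (\<exists>c. c \<noteq> 0 \<and> (AE y in lborel. f y = c * wave_packet x\<^sub>0 \<omega>\<^sub>0 y)))"
    (is "?eq \<longleftrightarrow> ?opt")
proof
  assume ?eq
  then have ex: "excess a (- m) = - m * exp (- a * m) + (1 - exp (- a * m)) / a"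
    and d: "AE z in lebesgue. defect a m \<Omega> z = 0"
    using concentration_le(2)[OF assms] by auto
  \<comment> \<open>Equality in the excess produces a point with u = 1, where the vanishing
    Cauchy-Schwarz defect identifies f; once u is known, the bathtub defect determines
    \<Omega>.\<close>
  obtain z\<^sub>0 where "u z\<^sub>0 = 1" using excess_le(2)[OF a, of "- m"] ex m by auto
  then obtain x\<^sub>0 \<omega>\<^sub>0 where "u (x\<^sub>0, \<omega>\<^sub>0) = 1" by (cases z\<^sub>0) auto
  from u_eq_1D[OF this] have f: "AE y in lborel. f y = STFT f x\<^sub>0 \<omega>\<^sub>0 * wave_packet x\<^sub>0 \<omega>\<^sub>0 y" .
  define r where "r = sqrt (m / pi)"
  have r: "m = pi * r\<^sup>2" "r > 0" using m by (auto simp: r_def)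
  have "sym_diff \<Omega> (ball (x\<^sub>0, \<omega>\<^sub>0) r) \<in> null_sets lebesgue"
    using defect_gaussian[OF f a r fmeasurableD[OF \<Omega>]] d by simp
  then show ?opt using r(2) f u_gaussian(1)[OF f] by blast
next
  assume ?opt
  then obtain x\<^sub>0 \<omega>\<^sub>0 r c where r: "r > 0" and n: "sym_diff \<Omega> (ball (x\<^sub>0, \<omega>\<^sub>0) r) \<in> null_sets lebesgue"
    and f: "AE y in lborel. f y = c * wave_packet x\<^sub>0 \<omega>\<^sub>0 y" by blast
  have "measure lebesgue \<Omega> = measure lebesgue (ball (x\<^sub>0, \<omega>\<^sub>0) r)"
  proof (rule measure_eq_AE)
    show "AE z in lebesgue. z \<in> \<Omega> \<longleftrightarrow> z \<in> ball (x\<^sub>0, \<omega>\<^sub>0) r"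
      using AE_not_in[OF n] by eventually_elim auto
  qed (use fmeasurableD[OF \<Omega>] in auto)
  also have "\<dots> = pi * r\<^sup>2" using r by (simp add: measure_def emeasure_ball_R2)
  finally have mr: "m = pi * r\<^sup>2" using m by simp
  show ?eq
    unfolding concentration_le(2)[OF assms] using excess_gaussian[OF f a, of "- m"] m
      defect_gaussian[OF f a mr r fmeasurableD[OF \<Omega>]] n by simp
qed

end

section \<open>From Lebesgue measurable to Borel measurable signals\<close>

lemma lebesgue_measurable_complex_AE_borel:
  fixes f :: "real \<Rightarrow> complex"
  assumes [measurable]: "f \<in> borel_measurable lebesgue"
  obtains g where "g \<in> borel_measurable borel" "AE x in lborel. f x = g x"
proof -
  have "(\<lambda>x. Re (f x)) \<in> borel_measurable lebesgue" "(\<lambda>x. Im (f x)) \<in> borel_measurable lebesgue" by measurable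
  then obtain r i where g: "r \<in> borel_measurable lborel" "AE x in lborel. Re (f x) = r x"
     "i \<in> borel_measurable lborel" "AE x in lborel. Im (f x) = i x"
    using completion_ex_borel_measurable_real[of _ lborel] by metis
  show thesis
  proof (rule that)
    show "(\<lambda>x. Complex (r x) (i x)) \<in> borel_measurable borel"
      using g(1,3) unfolding Complex_eq by simp
    show "AE x in lborel. f x = Complex (r x) (i x)"
      using g(2,4) by eventually_elim (simp add: complex_eq_iff)
  qed
qed

theorem theorem5p2:
  fixes p :: real and \<Omega> :: "(real \<times> real) set" and f :: "real \<Rightarrow> complex"
  assumes "2 \<le> p"
    and "\<Omega> \<in> lmeasurable"
    and "f \<in> L2_functions"
    and "\<not> (AE x in lebesgue. f x = 0)"
  shows "(LINT (x, \<omega>):\<Omega>|lebesgue. cmod (STFT f x \<omega>) powr p) / L2_norm f powr p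
           \<le> 2 / p * (1 - exp (- p * measure lebesgue \<Omega> / 2))
       \<and> (0 < measure lebesgue \<Omega> \<longrightarrow>
           ((LINT (x, \<omega>):\<Omega>|lebesgue. cmod (STFT f x \<omega>) powr p) / L2_norm f powr p
              = 2 / p * (1 - exp (- p * measure lebesgue \<Omega> / 2))
            \<longleftrightarrow>
            (\<exists>x\<^sub>0 \<omega>\<^sub>0.
               (\<exists>r>0. sym_diff \<Omega> (ball (x\<^sub>0, \<omega>\<^sub>0) r) \<in> null_sets lebesgue) \<and>
               (\<exists>c. c \<noteq> 0 \<and>
                  (AE x in lebesgue.
                     f x = c * exp (2 * complex_of_real pi * \<i> * complex_of_real x * complex_of_real \<omega>\<^sub>0)
                             * complex_of_real (gauss_window (x - x\<^sub>0)))))))"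
proof -
  have fm: "f \<in> borel_measurable lebesgue" and f2: "integrable lebesgue (\<lambda>x. (cmod (f x))\<^sup>2)"
    using assms(3) by (auto simp: L2_functions_def)
  \<comment> \<open>The transform, the norm and the extremality condition see f only up to null
    sets, so a Borel representative can stand in for it in the product measure arguments.\<close>
  obtain g where gm[measurable]: "g \<in> borel_measurable borel" and fg: "AE x in lborel. f x = g x"
    using fm by (rule lebesgue_measurable_complex_AE_borel)
  have fg': "AE x in lebesgue. f x = g x" using fg by (rule AE_completion)
  have gm': "g \<in> borel_measurable lebesgue" by (rule measurable_completion) simp
  have gsq: "integrable lebesgue (\<lambda>x. (cmod (g x))\<^sup>2)"
    by (rule integrable_cong_AE_imp[OF f2]) (use gm' fg' in \<open>auto elim!: eventually_mono\<close>)
  have g2: "integrable lborel (\<lambda>x. (cmod (g x))\<^sup>2)"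
    using gsq by (subst (asm) integrable_completion) auto
  have norm: "(LINT x|lebesgue. (cmod (f x))\<^sup>2) = (\<integral>x. (cmod (g x))\<^sup>2 \<partial>lborel)"
  proof -
    have "(LINT x|lebesgue. (cmod (f x))\<^sup>2) = (LINT x|lebesgue. (cmod (g x))\<^sup>2)"
      by (rule integral_cong_AE) (use fm gm' fg' in \<open>auto elim!: eventually_mono\<close>)
    then show ?thesis by (simp add: integral_completion)
  qed
  interpret L2_signal g
  proof
    show "0 < (\<integral>x. (cmod (g x))\<^sup>2 \<partial>lborel)"
    proof (rule ccontr)
      assume "\<not> ?thesis"
      then have "(\<integral>x. (cmod (g x))\<^sup>2 \<partial>lborel) = 0" by (simp add: not_less order_antisym integral_nonneg_AE)
      then have "AE x in lborel. (cmod (g x))\<^sup>2 = 0"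
        using g2 by (subst (asm) integral_nonneg_eq_0_iff_AE) auto
      with fg have "AE x in lborel. f x = 0" by eventually_elim simp
      then show False using assms(4) AE_completion by blast
    qed
  qed (use g2 in auto)
  have S: "STFT f x \<omega> = STFT g x \<omega>" for x \<omega>
  proof -
    have "(\<lambda>y. exp (- 2 * complex_of_real pi * \<i> * complex_of_real y * complex_of_real \<omega>)) \<in> borel_measurable borel"
      by (intro borel_measurable_continuous_onI continuous_intros)
    then have e: "(\<lambda>y. exp (- 2 * complex_of_real pi * \<i> * complex_of_real y * complex_of_real \<omega>)) \<in> borel_measurable lebesgue"
      "(\<lambda>y. complex_of_real (gauss_window (x - y))) \<in> borel_measurable lebesgue"
      by (auto intro!: measurable_completion)
    show ?thesis unfolding STFT_def
      by (rule integral_cong_AE) (use fg' fm gm' e in \<open>auto elim!: eventually_mono\<close>)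
  qed
  define a where "a = p / 2"
  define m where "m = measure lebesgue \<Omega>"
  have a: "a \<ge> 1" using assms(1) by (simp add: a_def)
  have L2: "L2_norm f = sqrt energy" by (simp add: L2_norm_def norm energy_def)
  have "u (x, \<omega>) powr a = cmod (STFT f x \<omega>) powr p / L2_norm f powr p" for x \<omega>
  proof -
    have "u (x, \<omega>) = (cmod (STFT f x \<omega>) / L2_norm f) powr 2"
      using energy_pos by (simp add: u_def S L2 power_divide)
    then have "u (x, \<omega>) powr a = (cmod (STFT f x \<omega>) / L2_norm f) powr p"
      by (simp only: powr_powr) (simp add: a_def)
    then show ?thesis using energy_pos by (simp add: powr_divide L2)
  qed
  then have "concentration a \<Omega> = (LINT z|lebesgue. (indicator \<Omega> z *\<^sub>R (case z of (x, \<omega>) \<Rightarrow> cmod (STFT f x \<omega>) powr p)) / L2_norm f powr p)"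
    unfolding concentration_def by (intro Bochner_Integration.integral_cong refl) (auto simp: split_beta')
  then have conc: "(LINT (x, \<omega>):\<Omega>|lebesgue. cmod (STFT f x \<omega>) powr p) / L2_norm f powr p = concentration a \<Omega>"
    by (simp add: set_lebesgue_integral_def)
  have rhs: "2 / p * (1 - exp (- p * measure lebesgue \<Omega> / 2)) = (1 - exp (- a * m)) / a"
    using assms(1) by (simp add: a_def m_def)
  have wp: "(AE x in lebesgue. f x = c * exp (2 * complex_of_real pi * \<i> * complex_of_real x * complex_of_real \<omega>\<^sub>0)
                 * complex_of_real (gauss_window (x - x\<^sub>0))) \<longleftrightarrow> (AE y in lborel. g y = c * wave_packet x\<^sub>0 \<omega>\<^sub>0 y)" for c x\<^sub>0 \<omega>\<^sub>0
    unfolding AE_completion_iff wave_packet_def mult.assoc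
    by (rule eventually_subst) (use fg in \<open>auto elim!: eventually_mono\<close>)
  show ?thesis
  proof (cases "m > 0")
    case True
    show ?thesis
      unfolding conc rhs wp
      using concentration_le(1)[OF assms(2) m_def True a] concentration_eq_iff[OF assms(2) m_def True a] by blast
  next
    \<comment> \<open>For null \<Omega> both sides are 0 and the equality claim is void.\<close>
    case False
    then have m0: "m = 0" by (simp add: m_def not_less order_antisym)
    have "emeasure lebesgue \<Omega> = ennreal m" using assms(2) by (simp add: m_def emeasure_eq_measure2)
    then have "\<Omega> \<in> null_sets lebesgue" using m0 assms(2) by (intro null_setsI) (auto simp: fmeasurableD)
    then have "AE z in lebesgue. z \<notin> \<Omega>" by (rule AE_not_in)
    then have "AE z in lebesgue. u z powr a * indicator \<Omega> z = 0" by eventually_elim simp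
    then have "concentration a \<Omega> = 0" unfolding concentration_def by (rule integral_eq_zero_AE)
    then show ?thesis unfolding conc rhs using m0 by (simp add: m_def)
  qed
qed

end
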